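(* For every positive integer $n$ with $n\equiv 0 \pmod 3$, the class number of the real quadratic field $K=\mathbb{Q}(\sqrt{3(4\cdot 3^n-1)})$ is divisible by $3$. Moreover, there are infinitely many such real quadratic fields whose class number is divisible by $3$. *)

theory Defs
  imports Complex_Main "HOL-Computational_Algebra.Polynomial" "HOL-Algebra.Algebra" "HOL-Algebra.Algebraic_Closure_Type"
    "HOL-Number_Theory.Cong"
begin

text \<open>Real number fields are represented as subfields of the reals, so that equality of two
  quadratic fields is equality of sets; non-isomorphic quadratic fields are distinct sets, and
  distinct quadratic subfields of the reals are non-isomorphic.\<close>

abbreviation real_ring :: "real ring" where
  "real_ring \<equiv> ring_of_type_algebra"

text \<open>The smallest subfield of the reals containing the square root of \<open>d\<close>;
  like every subfield of the reals it contains \<open>\<rat>\<close>.\<close>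

definition rat_adjoin_sqrt :: "real \<Rightarrow> real set" where
  "rat_adjoin_sqrt d = generate_field real_ring {sqrt d}"

definition real_quadratic_field :: "real set \<Rightarrow> bool" where
  "real_quadratic_field K \<longleftrightarrow> subfield K real_ring \<and> ring.dimension real_ring 2 \<rat> K"

definition ring_of_integers :: "real set \<Rightarrow> real ring" where
  "ring_of_integers K = real_ring\<lparr>carrier := {x \<in> K. algebraic_int x}\<rparr>"

text \<open>Nonzero ideals \<open>I\<close>, \<open>J\<close> are equivalent if \<open>a I = b J\<close> for some nonzero \<open>a\<close>, \<open>b\<close> in the ring.
  The notation \<open>a <# I\<close> is the library's multiplicative translate \<open>{a x | x \<in> I}\<close>.\<close>

definition nonzero_ideals :: "('a, 'b) ring_scheme \<Rightarrow> 'a set set" where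
  "nonzero_ideals R = {I. ideal I R \<and> I \<noteq> {\<zero>\<^bsub>R\<^esub>}}"

definition ideal_class_rel :: "('a, 'b) ring_scheme \<Rightarrow> ('a set \<times> 'a set) set" where
  "ideal_class_rel R = {(I, J). I \<in> nonzero_ideals R \<and> J \<in> nonzero_ideals R \<and>
     (\<exists>a \<in> carrier R - {\<zero>\<^bsub>R\<^esub>}. \<exists>b \<in> carrier R - {\<zero>\<^bsub>R\<^esub>}. a <#\<^bsub>R\<^esub> I = b <#\<^bsub>R\<^esub> J)}"

lemma equiv_ideal_class_rel:
  fixes R (structure)
  assumes "domain R"
  shows "equiv (nonzero_ideals R) (ideal_class_rel R)"
proof -
  interpret domain R by fact
  have lcos_assoc: "x <# (y <# I) = (x \<otimes> y) <# I"
    if "x \<in> carrier R" "y \<in> carrier R" "I \<subseteq> carrier R" for x y I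
    using that by (force simp: l_coset_def m_assoc)
  show ?thesis
  proof (rule equivI)
    show "ideal_class_rel R \<subseteq> nonzero_ideals R \<times> nonzero_ideals R"
      by (auto simp: ideal_class_rel_def)
    show "refl_on (nonzero_ideals R) (ideal_class_rel R)"
      using one_closed one_not_zero unfolding refl_on_def ideal_class_rel_def by blast
    show "sym (ideal_class_rel R)"
    proof (rule symI)
      fix I J assume "(I, J) \<in> ideal_class_rel R"
      then obtain a b where "I \<in> nonzero_ideals R" "J \<in> nonzero_ideals R"
        "a \<in> carrier R - {\<zero>}" "b \<in> carrier R - {\<zero>}" "b <# J = a <# I"
        unfolding ideal_class_rel_def by fastforce
      then show "(J, I) \<in> ideal_class_rel R"
        unfolding ideal_class_rel_def by blast
    qed
    show "trans (ideal_class_rel R)"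
    proof (rule transI)
      fix I J L assume "(I, J) \<in> ideal_class_rel R" "(J, L) \<in> ideal_class_rel R"
      then obtain a b c d where ids: "I \<in> nonzero_ideals R" "J \<in> nonzero_ideals R" "L \<in> nonzero_ideals R"
        and nz: "a \<in> carrier R - {\<zero>}" "b \<in> carrier R - {\<zero>}" "c \<in> carrier R - {\<zero>}" "d \<in> carrier R - {\<zero>}"
        and eq: "a <# I = b <# J" "c <# J = d <# L"
        unfolding ideal_class_rel_def by blast
      have sub: "I \<subseteq> carrier R" "J \<subseteq> carrier R" "L \<subseteq> carrier R"
        using ids ideal.Icarr by (fastforce simp: nonzero_ideals_def)+
      have "(c \<otimes> a) <# I = c <# (a <# I)"
        using sub nz by (simp add: lcos_assoc)
      also have "\<dots> = b <# (c <# J)"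
        using sub nz by (simp add: eq(1) lcos_assoc m_comm)
      also have "\<dots> = (b \<otimes> d) <# L"
        using sub nz by (simp add: eq(2) lcos_assoc)
      finally have "(c \<otimes> a) <# I = (b \<otimes> d) <# L" .
      moreover have "c \<otimes> a \<in> carrier R - {\<zero>}" "b \<otimes> d \<in> carrier R - {\<zero>}"
        using nz by (auto simp: integral_iff)
      ultimately show "(I, L) \<in> ideal_class_rel R"
        using ids unfolding ideal_class_rel_def by blast
    qed
  qed
qed

definition ideal_classes :: "real set \<Rightarrow> real set set set" where
  "ideal_classes K =
     nonzero_ideals (ring_of_integers K) // ideal_class_rel (ring_of_integers K)"

text \<open>As \<open>card\<close> of an infinite set is 0, statements about this number are to be accompanied by
  the finiteness of \<open>ideal_classes K\<close>.\<close>

definition class_number :: "real set \<Rightarrow> nat" where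
  "class_number K = card (ideal_classes K)"

end

theory Submission
  imports Defs "HOL-Number_Theory.Number_Theory" "HOL-Analysis.Kronecker_Approximation_Theorem"
begin

text \<open>
  Let \<open>n = 3m\<close>, \<open>4 \<cdot> 3\<^sup>n - 1 = M' g\<^sup>2\<close> with \<open>M'\<close> squarefree, \<open>D = 3 M'\<close> and \<open>K = \<rat>(\<surd>D)\<close>. Since
  \<open>D \<equiv> 1 (mod 8)\<close>, the prime 2 splits in \<open>K\<close>; let \<open>P\<close> be a prime above it. If \<open>P\<^sup>k\<close> fixes an ideal class,
  then \<open>P\<^sup>k\<close> is principal, which yields odd \<open>x\<close>, \<open>y\<close> with \<open>x\<^sup>2 - D y\<^sup>2 = \<plusminus>2\<^sup>k\<^sup>+\<^sup>2\<close>. This forces \<open>3 dvd k\<close>: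
  the Eisenstein integer \<open>\<beta> = (g x + y \<surd>-3) / 2\<close> has norm \<open>3\<^sup>n\<^sup>+\<^sup>1 y\<^sup>2 \<plusminus> 2\<^sup>k g\<^sup>2\<close>, so that \<open>\<plusminus>2\<^sup>k \<equiv> 3\<^sup>n x\<^sup>2 (mod \<beta>)\<close>,
  where \<open>3\<^sup>n\<close> is a cube; cubic reciprocity evaluates the symbol of \<open>x\<close> modulo \<open>\<beta>\<close>, and shows that 2 is not
  a cubic residue modulo \<open>\<beta>\<close> because \<open>y\<close> is odd. Hence all cycles of multiplication by \<open>P\<close> on the
  finite set of ideal classes have length divisible by 3.

  Given finitely many of these fields, let \<open>N\<close> be the product of the numbers \<open>4 \<cdot> 3\<^sup>n - 1\<close> belonging to
  them. For \<open>n = 3 \<phi>(N)\<close> the number \<open>4 \<cdot> 3\<^sup>n - 1\<close> is coprime to \<open>N\<close>, so a coincidence of fields would make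
  it a square, although it is 3 modulo 4.
\<close>

text \<open>Modulo a prime q dividing x, 2 \<beta> is congruent to y \<surd>-3; this makes the
  symbol (\<beta>/q) trivial, and with it, by reciprocity, the symbol of x. Modulo 2, \<beta> is a
  nontrivial cube root of unity, so the symbol of 2 is nontrivial. As -1 is a cube, both signs in
  the norm equation can be treated together. The obstacle is that reciprocity needs \<beta> to be
  primary, that is, 3 must divide its coefficient at \<omega>. In general \<beta> has to be
  multiplied by a cube root of unity W first, and powers of W then enter the symbols of x and of 2.
  But W \<noteq> 1 is needed only if 3 does not divide y, and then the norm equation modulo 9 ties x
  to k in such a way that the powers of W cancel. Two choices keep the prerequisites small.
  Reciprocity is needed only against rational primes q, and the exponent (q^2 - 1)/3 treats split
  and inert q alike. And the group of ideal classes is never formed: it suffices that multiplication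
  by P permutes the classes, for which only P needs an inverse up to principal ideals.\<close>

hide_const (open) Divisibility.prime

subsection \<open>Eisenstein integers\<close>

text \<open>\<open>Eis a b\<close> stands for a + b \<omega> with \<omega> a primitive cube root of
  unity. Thus \<open>re\<close> and \<open>im\<close> are coordinates in the basis 1, \<omega> and
  not the real and imaginary part.\<close>

datatype eis = Eis (re: int) (im: int)

instantiation eis :: comm_ring_1
begin
definition "0 = Eis 0 0"
definition "1 = Eis 1 0"
definition "x + y = Eis (re x + re y) (im x + im y)"
definition "x - y = Eis (re x - re y) (im x - im y)"
definition "- x = Eis (- re x) (- im x)"
definition "x * y = Eis (re x * re y - im x * im y) (re x * im y + im x * re y - im x * im y)"
instance
  by standard
    (auto simp: zero_eis_def one_eis_def plus_eis_def minus_eis_def uminus_eis_def times_eis_def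
      algebra_simps)
end

lemma eis_sel_simps [simp]:
  "re 0 = 0" "im 0 = 0" "re 1 = 1" "im 1 = 0"
  "re (x + y) = re x + re y" "im (x + y) = im x + im y"
  "re (x - y) = re x - re y" "im (x - y) = im x - im y"
  "re (- x) = - re x" "im (- x) = - im x"
  "re (x * y) = re x * re y - im x * im y"
  "im (x * y) = re x * im y + im x * re y - im x * im y"
  by (auto simp: zero_eis_def one_eis_def plus_eis_def minus_eis_def uminus_eis_def times_eis_def)

lemma eis_eqI: "re x = re y \<Longrightarrow> im x = im y \<Longrightarrow> x = y"
  by (rule eis.expand) simp

lemma re_of_nat [simp]: "re (of_nat n) = int n" and im_of_nat [simp]: "im (of_nat n) = 0"
  by (induction n) auto

lemma re_of_int [simp]: "re (of_int n) = n" and im_of_int [simp]: "im (of_int n) = 0"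
  by (cases n rule: int_cases2; simp)+

lemma re_numeral [simp]: "re (numeral n) = numeral n" and im_numeral [simp]: "im (numeral n) = 0"
  using re_of_int[of "numeral n"] im_of_int[of "numeral n"] by simp_all

definition eis_norm :: "eis \<Rightarrow> int" where
  "eis_norm x = re x ^ 2 - re x * im x + im x ^ 2"

lemma eis_norm_mult: "eis_norm (x * y) = eis_norm x * eis_norm y"
  by (simp add: eis_norm_def power2_eq_square algebra_simps)

lemma four_eis_norm: "4 * eis_norm x = (2 * re x - im x) ^ 2 + 3 * im x ^ 2"
  by (simp add: eis_norm_def power2_eq_square algebra_simps)

lemma eis_norm_nonneg: "eis_norm x \<ge> 0"
proof -
  have "4 * eis_norm x \<ge> 0"
    unfolding four_eis_norm by (intro add_nonneg_nonneg mult_nonneg_nonneg) auto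
  then show ?thesis by simp
qed

lemma eis_norm_eq_0_iff: "eis_norm x = 0 \<longleftrightarrow> x = 0"
proof
  assume "eis_norm x = 0"
  then have "(2 * re x - im x) ^ 2 + 3 * im x ^ 2 = 0"
    using four_eis_norm[of x] by simp
  moreover have "(2 * re x - im x) ^ 2 \<ge> 0" "im x ^ 2 \<ge> 0"
    by auto
  ultimately have "im x ^ 2 = 0" "(2 * re x - im x) ^ 2 = 0"
    by linarith+
  then show "x = 0"
    by (intro eis_eqI) auto
qed (simp add: eis_norm_def)

instance eis :: idom
proof
  fix x y :: eis
  assume "x \<noteq> 0" "y \<noteq> 0"
  then have "eis_norm (x * y) \<noteq> 0"
    by (simp add: eis_norm_mult eis_norm_eq_0_iff)
  then show "x * y \<noteq> 0"
    by (simp add: eis_norm_eq_0_iff)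
qed

definition cnj_eis :: "eis \<Rightarrow> eis" where
  "cnj_eis x = Eis (re x - im x) (- im x)"

lemma re_cnj_eis [simp]: "re (cnj_eis x) = re x - im x"
  and im_cnj_eis [simp]: "im (cnj_eis x) = - im x"
  by (simp_all add: cnj_eis_def)

lemma cnj_eis_mult: "cnj_eis (x * y) = cnj_eis x * cnj_eis y"
  and cnj_eis_add: "cnj_eis (x + y) = cnj_eis x + cnj_eis y"
  and cnj_eis_0 [simp]: "cnj_eis 0 = 0"
  and cnj_eis_1 [simp]: "cnj_eis 1 = 1"
  by (rule eis_eqI; simp add: algebra_simps)+

lemma cnj_eis_sum: "cnj_eis (sum f A) = (\<Sum>x\<in>A. cnj_eis (f x))"
  by (induction A rule: infinite_finite_induct) (auto simp: cnj_eis_add)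

lemma mult_cnj_eis: "x * cnj_eis x = of_int (eis_norm x)"
  by (rule eis_eqI) (simp_all add: eis_norm_def power2_eq_square algebra_simps)

definition \<omega> :: eis where "\<omega> = Eis 0 1"

lemma re_omega [simp]: "re \<omega> = 0" and im_omega [simp]: "im \<omega> = 1"
  by (simp_all add: \<omega>_def)

lemma omega_squared: "\<omega> ^ 2 = - 1 - \<omega>"
  by (rule eis_eqI) (simp_all add: power2_eq_square)

lemma of_int_dvd_eis_iff: "of_int m dvd x \<longleftrightarrow> m dvd re x \<and> m dvd im x"
proof
  assume "m dvd re x \<and> m dvd im x"
  then obtain a b where "re x = m * a" "im x = m * b"
    by (auto elim!: dvdE)
  then have "x = of_int m * Eis a b"
    by (intro eis_eqI) auto
  then show "of_int m dvd x"
    by simp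
qed (auto elim!: dvdE)

definition cube_units :: "eis set" where
  "cube_units = {1, \<omega>, \<omega> ^ 2}"

lemma cube_units_cases:
  assumes "u \<in> cube_units"
  obtains "u = 1" | "u = \<omega>" | "u = - 1 - \<omega>"
  using assms by (auto simp: cube_units_def omega_squared)

lemma cube_units_mult: "u \<in> cube_units \<Longrightarrow> v \<in> cube_units \<Longrightarrow> u * v \<in> cube_units"
  by (auto simp: cube_units_def omega_squared eis.expand intro!: eis_eqI)

lemma cube_units_power: "u \<in> cube_units \<Longrightarrow> u ^ n \<in> cube_units"
  by (induction n) (auto intro: cube_units_mult simp: cube_units_def[THEN eqset_imp_iff, of 1])

lemma cube_units_cube: "u \<in> cube_units \<Longrightarrow> u ^ 3 = 1"
  by (erule cube_units_cases) (auto simp: power3_eq_cube intro!: eis_eqI)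

lemma cube_units_power_mod_3:
  assumes "u \<in> cube_units"
  shows "u ^ n = u ^ (n mod 3)"
proof -
  have "u ^ n = (u ^ 3) ^ (n div 3) * u ^ (n mod 3)"
    by (metis mult_div_mod_eq power_add power_mult)
  then show ?thesis
    by (simp add: cube_units_cube[OF assms])
qed

lemma cube_units_cnj: "u \<in> cube_units \<Longrightarrow> cnj_eis u = u ^ 2"
  by (erule cube_units_cases) (auto simp: power2_eq_square intro!: eis_eqI)

text \<open>The difference of two distinct cube roots of unity has a coordinate 1 or -1. This lemma
  is what turns congruences between values of cubic symbols into equations.\<close>

lemma cube_units_eqI:
  assumes "u \<in> cube_units" "v \<in> cube_units" "of_int q dvd u - v" "\<bar>q\<bar> > 1"
  shows "u = v"
proof -
  have "\<not> q dvd 1"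
    using assms(4) by auto
  then show ?thesis
    using assms(1-3) by (auto elim!: cube_units_cases simp: of_int_dvd_eis_iff dvd_diff_commute)
qed

section \<open>Congruences and the Frobenius map modulo a prime\<close>

lemma dvd_power_diff: "(d::'a::comm_ring_1) dvd x - y \<Longrightarrow> d dvd x ^ n - y ^ n"
  by (metis dvd_trans power_diff_sumr2 dvd_triv_left)

lemma dvd_mult_diff: "(d::'a::comm_ring_1) dvd x - y \<Longrightarrow> d dvd z - w \<Longrightarrow> d dvd x * z - y * w"
proof -
  assume "d dvd x - y" "d dvd z - w"
  then have "d dvd (x - y) * z + y * (z - w)" by auto
  then show ?thesis by (simp add: algebra_simps)
qed

lemma dvd_diff_trans: "(d::'a::comm_ring_1) dvd x - y \<Longrightarrow> d dvd y - z \<Longrightarrow> d dvd x - z"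
  using dvd_add[of d "x - y" "y - z"] by simp

lemma square_mod_3:
  fixes n :: nat
  assumes "\<not> 3 dvd n"
  shows "n ^ 2 = 3 * ((n ^ 2 - 1) div 3) + 1"
proof -
  have "n mod 3 = 1 \<or> n mod 3 = 2"
    using assms by presburger
  then have "n ^ 2 mod 3 = 1"
    by (auto simp: power2_eq_square mod_mult_eq[of n 3 n, symmetric])
  then show ?thesis
    by presburger
qed

lemma freshmans_dream_dvd:
  fixes x y :: "'a :: comm_ring_1"
  assumes "prime q"
  shows "of_nat q dvd (x + y) ^ q - (x ^ q + y ^ q)"
proof -
  have q: "q > 0"
    using assms by (simp add: prime_gt_0_nat)
  have "(x + y) ^ q = (\<Sum>k\<le>q. of_nat (q choose k) * x ^ k * y ^ (q - k))"
    by (rule binomial_ring)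
  also have "{..q} = insert 0 (insert q {0<..<q})"
    using q by auto
  also have "(\<Sum>k\<in>\<dots>. of_nat (q choose k) * x ^ k * y ^ (q - k))
      = y ^ q + (x ^ q + (\<Sum>k\<in>{0<..<q}. of_nat (q choose k) * x ^ k * y ^ (q - k)))"
    using q by (subst sum.insert) (auto simp: sum.insert)
  finally have "(x + y) ^ q - (x ^ q + y ^ q)
      = (\<Sum>k\<in>{0<..<q}. of_nat (q choose k) * x ^ k * y ^ (q - k))"
    by (simp add: algebra_simps)
  also have "of_nat q dvd \<dots>"
  proof (rule dvd_sum)
    fix k assume "k \<in> {0<..<q}"
    then have "q dvd (q choose k)"
      using assms by (intro dvd_choose_prime) auto
    then have "(of_nat q :: 'a) dvd of_nat (q choose k)"
      by (metis dvd_def of_nat_mult)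
    then show "(of_nat q :: 'a) dvd of_nat (q choose k) * x ^ k * y ^ (q - k)"
      by (simp add: dvd_mult2 mult.assoc)
  qed
  finally show ?thesis .
qed

lemma freshmans_dream_sum_dvd:
  fixes f :: "'b \<Rightarrow> 'a :: comm_ring_1"
  assumes "prime q"
  shows "of_nat q dvd (\<Sum>i\<in>A. f i) ^ q - (\<Sum>i\<in>A. f i ^ q)"
proof (induction A rule: infinite_finite_induct)
  case (insert a A)
  have "of_nat q dvd (f a + sum f A) ^ q - (f a ^ q + sum f A ^ q)"
    by (rule freshmans_dream_dvd[OF assms])
  from dvd_add[OF this insert.IH] show ?case
    using insert.hyps by (simp add: algebra_simps)
qed (use assms in \<open>auto simp: prime_gt_0_nat power_0_left\<close>)

subsection \<open>Cubic residue characters\<close>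

text \<open>Functions on the residues modulo \<open>p\<close> are represented by periodic functions
  on the integers; this lemma and the next one are the substitutions t + c and c t in sums over all
  residues.\<close>

lemma sum_residues_shift:
  fixes f :: "int \<Rightarrow> 'a::comm_monoid_add"
  assumes "p > 0" and per: "\<And>a b. [a = b] (mod int p) \<Longrightarrow> f a = f b"
  shows "(\<Sum>t<p. f (int t + c)) = (\<Sum>t<p. f (int t))"
proof (rule sum.reindex_bij_witness[of _ "\<lambda>u. nat ((int u - c) mod int p)" "\<lambda>t. nat ((int t + c) mod int p)"])
  fix a assume "a \<in> {..<p}"
  then have a: "int a mod int p = int a" by simp
  show "nat ((int (nat ((int a + c) mod int p)) - c) mod int p) = a"
    using assms(1) a by (simp add: mod_diff_left_eq)
  show "nat ((int a + c) mod int p) \<in> {..<p}"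
    using assms(1) by (simp add: nat_less_iff)
  show "f (int (nat ((int a + c) mod int p))) = f (int a + c)"
    using assms(1) by (intro per) (simp add: Cong.cong_def)
  show "nat ((int (nat ((int a - c) mod int p)) + c) mod int p) = a"
    using assms(1) a by (simp add: mod_add_left_eq)
  show "nat ((int a - c) mod int p) \<in> {..<p}"
    using assms(1) by (simp add: nat_less_iff)
qed

lemma sum_residues_mult:
  fixes f :: "int \<Rightarrow> 'a::comm_monoid_add"
  assumes "p > 0" and per: "\<And>a b. [a = b] (mod int p) \<Longrightarrow> f a = f b" and "coprime c (int p)"
  shows "(\<Sum>t<p. f (c * int t)) = (\<Sum>t<p. f (int t))"
proof -
  obtain d where d: "[c * d = 1] (mod int p)"
    using assms(3) cong_solve_coprime_int by blast
  have *: "[c * ((d * x) mod int p) = x] (mod int p)" "[d * ((c * x) mod int p) = x] (mod int p)" for x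
  proof -
    have "[c * ((d * x) mod int p) = (c * d) * x] (mod int p)"
      by (simp add: Cong.cong_def mod_mult_right_eq mult.assoc)
    also have "[(c * d) * x = 1 * x] (mod int p)"
      using d by (intro cong_mult) auto
    finally show "[c * ((d * x) mod int p) = x] (mod int p)" by simp
    have "[d * ((c * x) mod int p) = (c * d) * x] (mod int p)"
      by (simp add: Cong.cong_def mod_mult_right_eq mult_ac)
    also have "[(c * d) * x = 1 * x] (mod int p)"
      using d by (intro cong_mult) auto
    finally show "[d * ((c * x) mod int p) = x] (mod int p)" by simp
  qed
  show ?thesis
  proof (rule sum.reindex_bij_witness[of _ "\<lambda>u. nat ((d * int u) mod int p)" "\<lambda>t. nat ((c * int t) mod int p)"])
    fix a assume "a \<in> {..<p}"
    then have a: "int a mod int p = int a" by simp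
    show "nat ((d * int (nat ((c * int a) mod int p))) mod int p) = a"
      using assms(1) a *(2)[of "int a"] by (simp add: Cong.cong_def)
    show "nat ((c * int a) mod int p) \<in> {..<p}" "nat ((d * int a) mod int p) \<in> {..<p}"
      using assms(1) by (simp_all add: nat_less_iff)
    show "f (int (nat ((c * int a) mod int p))) = f (c * int a)"
      using assms(1) by (intro per) (simp add: Cong.cong_def)
    show "nat ((c * int (nat ((d * int a) mod int p))) mod int p) = a"
      using assms(1) a *(1)[of "int a"] by (simp add: Cong.cong_def)
  qed
qed

lemma fermat_theorem_int:
  assumes "prime p" "\<not> int p dvd t"
  shows "[t ^ (p - 1) = 1] (mod int p)"
proof -
  define s where "s = nat (t mod int p)"
  have s: "[t = int s] (mod int p)"
    using prime_gt_0_nat[OF assms(1)] by (simp add: s_def Cong.cong_def)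
  then have "\<not> p dvd s"
    using assms(2) cong_dvd_iff[OF s] by simp
  then have "[s ^ (p - 1) = 1] (mod p)"
    by (rule fermat_theorem[OF assms(1)])
  then have "[int s ^ (p - 1) = 1] (mod int p)"
    using cong_int_iff[of "s ^ (p - 1)" 1 p] by simp
  then show ?thesis
    using cong_pow[OF s] cong_trans by blast
qed

text \<open>\<open>r\<close> is a primitive cube root of unity modulo \<open>p\<close>; choosing it
  means choosing one of the two Eisenstein primes above \<open>p\<close>. The number
  \<open>k\<close> is the exponent (p - 1)/3 of Euler's criterion.\<close>

locale cubic_residue_symbol =
  fixes p k :: nat and r :: int
  assumes prime_p: "prime p" and p_eq: "p = 3 * k + 1" and r_root: "int p dvd r ^ 2 + r + 1"
begin

lemma k_pos: "k > 0"
  using prime_p p_eq by (cases k) auto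

lemma p_pos: "p > 0"
  using p_eq by simp

lemma p_ge_7: "p \<ge> 7"
proof -
  have "k \<noteq> 1"
    using prime_p p_eq by auto
  then show ?thesis
    using k_pos p_eq by simp
qed

lemma prime_int_p: "prime (int p)"
  using prime_p by simp

lemma coprime_int_p_iff: "coprime c (int p) \<longleftrightarrow> \<not> int p dvd c"
  using prime_int_p prime_imp_coprime coprime_commute
  by (metis coprime_absorb_left not_prime_unit dvd_refl coprime_common_divisor)

text \<open>Modulo \<open>p\<close>, this is the ring homomorphism from the Eisenstein integers onto the integers modulo
  \<open>p\<close> that sends \<open>\<omega>\<close> to \<open>r\<close>; its kernel is the prime ideal with respect to which \<open>chi\<close> below is the
  cubic residue symbol.\<close>

definition red :: "eis \<Rightarrow> int" where
  "red x = re x + im x * r"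

lemma red_add: "red (x + y) = red x + red y"
  by (simp add: red_def algebra_simps)

lemma red_sum: "red (sum f A) = (\<Sum>x\<in>A. red (f x))"
  by (induction A rule: infinite_finite_induct) (auto simp: red_add, simp_all add: red_def)

lemma red_mult: "[red (x * y) = red x * red y] (mod int p)"
proof -
  have "red x * red y - red (x * y) = im x * im y * (r ^ 2 + r + 1)"
    by (simp add: red_def algebra_simps power2_eq_square)
  then have "int p dvd red x * red y - red (x * y)"
    using r_root by simp
  then show ?thesis
    using cong_iff_dvd_diff cong_sym by blast
qed

lemma not_dvd_r: "\<not> int p dvd r" "\<not> int p dvd r - 1" "\<not> int p dvd r + 2" "\<not> int p dvd 2 * r + 1"
proof -
  have n1: "\<not> int p dvd 1" and n3: "\<not> int p dvd 3"
    using p_ge_7 zdvd_imp_le[of "int p" 3] zdvd_imp_le[of "int p" 1] by auto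
  \<comment> \<open>Bezout identities: a common divisor of r^2 + r + 1 and of any of the four
    numbers divides 1 or 3.\<close>
  have id: "1 = (r ^ 2 + r + 1) - r * (r + 1)" "3 = (r ^ 2 + r + 1) - (r - 1) * (r + 2)"
    "3 = 4 * (r ^ 2 + r + 1) - (2 * r + 1) * (2 * r + 1)"
    by (simp_all add: algebra_simps power2_eq_square)
  show "\<not> int p dvd r"
    using n1 id(1) r_root by (metis dvd_diff dvd_mult2)
  show "\<not> int p dvd r - 1" "\<not> int p dvd r + 2"
    using n3 id(2) r_root by (metis dvd_diff dvd_mult2, metis dvd_diff dvd_mult)
  show "\<not> int p dvd 2 * r + 1"
    using n3 id(3) r_root by (metis dvd_diff dvd_mult)
qed

lemma red_inj:
  assumes "u \<in> insert 0 cube_units" "v \<in> insert 0 cube_units" "[red u = red v] (mod int p)"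
  shows "u = v"
proof -
  have n1: "\<not> int p dvd 1"
    using p_ge_7 by auto
  have d: "int p dvd red u - red v"
    using assms(3) by (simp add: cong_iff_dvd_diff)
  have r1: "\<not> int p dvd r + 1"
  proof
    assume "int p dvd r + 1"
    then have "int p dvd (r ^ 2 + r + 1) - r * (r + 1)"
      using r_root by (intro dvd_diff) auto
    then show False
      using n1 by (simp add: algebra_simps power2_eq_square)
  qed
  \<comment> \<open>The differences of the reductions 0, 1, r, -r - 1 are, up to sign, the six
    numbers listed in \<open>pos\<close>, none of which is a multiple of \<open>p\<close>.\<close>
  define D where "D = {a. int p dvd a}"
  have neg: "- a \<in> D \<longleftrightarrow> a \<in> D" for a
    by (simp add: D_def)
  have pos: "1 \<notin> D" "r \<notin> D" "r - 1 \<notin> D" "r + 2 \<notin> D" "2 * r + 1 \<notin> D" "r + 1 \<notin> D"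
    using not_dvd_r n1 r1 by (simp_all add: D_def)
  have D: "-1 \<notin> D" "- r \<notin> D" "1 - r \<notin> D" "- r - 2 \<notin> D" "- 2 * r - 1 \<notin> D" "- r - 1 \<notin> D"
    using pos neg[of 1] neg[of r] neg[of "r - 1"] neg[of "r + 2"] neg[of "2 * r + 1"] neg[of "r + 1"]
    by simp_all
  have red: "red 0 = 0" "red 1 = 1" "red \<omega> = r" "red (- 1 - \<omega>) = - r - 1"
    by (simp_all add: red_def)
  have "red u - red v \<in> D"
    using d by (simp add: D_def)
  moreover have "u \<in> {0, 1, \<omega>, - 1 - \<omega>}" "v \<in> {0, 1, \<omega>, - 1 - \<omega>}"
    using assms(1,2) by (auto simp: cube_units_def omega_squared)
  ultimately show ?thesis
  proof -
    assume *: "red u - red v \<in> D" "u \<in> {0, 1, \<omega>, - 1 - \<omega>}" "v \<in> {0, 1, \<omega>, - 1 - \<omega>}"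
    have "- r - 1 - r = - 2 * r - 1" "r - (- r - 1) = 2 * r + 1" "1 - (- r - 1) = r + 2"
      "- r - 1 - 1 = - r - 2" "0 - (- r - 1) = r + 1" "0 - r = - r" "0 - 1 = (- 1 :: int)"
      by simp_all
    with * pos D show "u = v"
      by (elim insertE emptyE; simp only: red diff_zero)
  qed
qed

text \<open>Euler's criterion taken as the definition: t^k is 0 or a cube root of unity modulo
  \<open>p\<close>, and \<open>chi t\<close> is its unique lift to the Eisenstein integers.\<close>

definition chi :: "int \<Rightarrow> eis" where
  "chi t = (THE u. u \<in> insert 0 cube_units \<and> [red u = t ^ k] (mod int p))"

lemma ex_cube_unit: "\<exists>u. u \<in> insert 0 cube_units \<and> [red u = t ^ k] (mod int p)"
proof (cases "int p dvd t")
  case True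
  then have "int p dvd t ^ k"
    using k_pos by (meson dvd_power dvd_trans)
  then show ?thesis
    by (intro exI[of _ 0]) (simp add: red_def cong_iff_dvd_diff)
next
  case False
  have "[(t ^ k) ^ 3 = 1] (mod int p)"
    using fermat_theorem_int[OF prime_p False] p_eq by (simp add: power_mult[symmetric] mult.commute)
  then have "int p dvd (t ^ k) ^ 3 - 1"
    by (simp add: cong_iff_dvd_diff)
  \<comment> \<open>Modulo \<open>p\<close> the polynomial x^3 - 1 splits with the roots 1, r and -1
    - r, the reductions of the three cube roots of unity.\<close>
  moreover have "(x - 1) * ((x - r) * (x + 1 + r)) = x ^ 3 - 1 + (1 - x) * (r ^ 2 + r + 1)" for x :: int
    by (simp add: algebra_simps power2_eq_square power3_eq_cube)
  ultimately have "int p dvd (t ^ k - 1) * ((t ^ k - r) * (t ^ k + 1 + r))"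
    using r_root by (metis dvd_add dvd_mult)
  then have "int p dvd t ^ k - 1 \<or> int p dvd t ^ k - r \<or> int p dvd t ^ k + 1 + r"
    using prime_int_p by (simp add: prime_dvd_mult_iff)
  then have "[red 1 = t ^ k] (mod int p) \<or> [red \<omega> = t ^ k] (mod int p) \<or> [red (\<omega> ^ 2) = t ^ k] (mod int p)"
  proof (elim disjE)
    assume "int p dvd t ^ k - 1"
    then have "[t ^ k = red 1] (mod int p)"
      by (simp add: cong_iff_dvd_diff red_def)
    then show ?thesis using cong_sym by blast
  next
    assume "int p dvd t ^ k - r"
    then have "[t ^ k = red \<omega>] (mod int p)"
      by (simp add: cong_iff_dvd_diff red_def)
    then show ?thesis using cong_sym by blast
  next
    assume "int p dvd t ^ k + 1 + r"
    moreover have "t ^ k - red (\<omega> ^ 2) = t ^ k + 1 + r"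
      by (simp add: red_def omega_squared)
    ultimately have "[t ^ k = red (\<omega> ^ 2)] (mod int p)"
      by (simp only: cong_iff_dvd_diff)
    then show ?thesis using cong_sym by blast
  qed
  then show ?thesis
    unfolding cube_units_def by blast
qed

lemma chi_in: "chi t \<in> insert 0 cube_units"
  and red_chi: "[red (chi t) = t ^ k] (mod int p)"
proof -
  have "\<exists>!u. u \<in> insert 0 cube_units \<and> [red u = t ^ k] (mod int p)"
  proof (rule ex_ex1I[OF ex_cube_unit])
    fix u v
    assume "u \<in> insert 0 cube_units \<and> [red u = t ^ k] (mod int p)"
      "v \<in> insert 0 cube_units \<and> [red v = t ^ k] (mod int p)"
    then show "u = v"
      using red_inj[of u v] cong_trans[OF _ cong_sym] by blast
  qed
  from theI'[OF this] show "chi t \<in> insert 0 cube_units" "[red (chi t) = t ^ k] (mod int p)"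
    unfolding chi_def by auto
qed

lemma chi_eqI: "u \<in> insert 0 cube_units \<Longrightarrow> [red u = t ^ k] (mod int p) \<Longrightarrow> chi t = u"
  using red_inj[OF chi_in, of u t] cong_trans[OF red_chi cong_sym] by blast

lemma chi_cong: "[s = t] (mod int p) \<Longrightarrow> chi s = chi t"
  using red_chi[of t] chi_in[of t] cong_trans[OF red_chi cong_sym[OF cong_pow]]
  by (intro chi_eqI) blast+

lemma chi_mult: "chi (s * t) = chi s * chi t"
proof (rule chi_eqI)
  show "chi s * chi t \<in> insert 0 cube_units"
    using chi_in[of s] chi_in[of t] cube_units_mult by auto
  have "[red (chi s * chi t) = red (chi s) * red (chi t)] (mod int p)"
    by (rule red_mult)
  also have "[red (chi s) * red (chi t) = s ^ k * t ^ k] (mod int p)"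
    by (intro cong_mult red_chi)
  finally show "[red (chi s * chi t) = (s * t) ^ k] (mod int p)"
    by (simp add: power_mult_distrib)
qed

lemma chi_1 [simp]: "chi 1 = 1"
  by (rule chi_eqI) (auto simp: cube_units_def red_def)

lemma chi_0_iff: "chi t = 0 \<longleftrightarrow> int p dvd t"
proof
  assume "chi t = 0"
  then have "int p dvd t ^ k"
    using red_chi[of t] by (simp add: red_def cong_iff_dvd_diff)
  then show "int p dvd t"
    using prime_int_p prime_dvd_power by blast
next
  assume "int p dvd t"
  then have "int p dvd t ^ k"
    using k_pos by (meson dvd_power dvd_trans)
  then show "chi t = 0"
    by (intro chi_eqI) (auto simp: red_def cong_iff_dvd_diff)
qed

lemma chi_unit: "\<not> int p dvd t \<Longrightarrow> chi t \<in> cube_units"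
  using chi_in[of t] chi_0_iff[of t] by auto

lemma chi_minus_1: "chi (-1) = 1"
proof -
  have n: "\<not> int p dvd -1" using p_ge_7 by auto
  have "chi (-1) ^ 2 = 1"
    using chi_mult[of "-1" "-1"] by (simp add: power2_eq_square)
  moreover have "chi (-1) ^ 3 = 1"
    using chi_unit[OF n] cube_units_cube by blast
  moreover have "chi (-1) ^ 3 = chi (-1) ^ 2 * chi (-1)"
    by (simp add: power2_eq_square power3_eq_cube)
  ultimately show ?thesis
    by simp
qed

lemma chi_minus: "chi (- t) = chi t"
  using chi_mult[of "-1" t] chi_minus_1 by simp

lemma cnj_chi: "cnj_eis (chi t) = chi t ^ 2"
  using chi_in[of t] cube_units_cnj by (auto simp: power2_eq_square)

lemma chi_cubed: "\<not> int p dvd t \<Longrightarrow> chi t ^ 3 = 1"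
  using chi_unit cube_units_cube by blast

section \<open>Primitive roots and vanishing sums over residues\<close>

lemma primitive_root:
  obtains g :: nat where "coprime p g" "ord p g = p - 1"
proof -
  have "odd p"
    using prime_odd_nat[OF prime_p] p_ge_7 by simp
  then have "\<exists>q j. p = q ^ j \<and> prime q \<and> odd q \<and> j > 0"
    using prime_p by (intro exI[of _ p] exI[of _ 1]) simp
  then have "p \<in> cyclic_moduli"
    unfolding cyclic_moduli_def by blast
  then obtain g where "residue_primroot p g"
    using residue_primroot_iff_in_cyclic_moduli by blast
  then have "coprime p g" "ord p g = p - 1"
    using prime_p by (simp_all add: residue_primroot_def totient_prime)
  then show ?thesis
    by (rule that)
qed

text \<open>Multiplication by a primitive root g permutes the residues and scales the sum by g^i,
  which is not 1 modulo \<open>p\<close> for 0 < i < p - 1. For i = 0 the sum is \<open>p\<close>,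
  because 0^0 = 1.\<close>

lemma sum_power_residues:
  assumes "i < p - 1"
  shows "int p dvd (\<Sum>t<p. int t ^ i)"
proof (cases "i = 0")
  case False
  obtain g where g: "coprime p g" "ord p g = p - 1"
    by (rule primitive_root)
  have "\<not> [g ^ i = 1] (mod p)"
    using assms False g(2) ord_divides[of g i p] by (auto dest: dvd_imp_le)
  then have "\<not> [int (g ^ i) = int 1] (mod int p)"
    by (subst cong_int_iff)
  then have gi: "\<not> int p dvd int g ^ i - 1"
    by (simp add: cong_iff_dvd_diff)
  define S where "S = (\<Sum>t<p. int t ^ i)"
  have "(\<Sum>t<p. (int g * int t) ^ i mod int p) = (\<Sum>t<p. int t ^ i mod int p)"
    using p_pos g(1)
    by (intro sum_residues_mult[of p "\<lambda>t. t ^ i mod int p"])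
      (auto simp: coprime_commute Cong.cong_def intro: cong_pow[unfolded Cong.cong_def])
  then have "[(\<Sum>t<p. (int g * int t) ^ i) = S] (mod int p)"
    unfolding Cong.cong_def S_def by (metis mod_sum_eq)
  then have "[int g ^ i * S = S] (mod int p)"
    unfolding S_def by (simp add: power_mult_distrib sum_distrib_left)
  then have "int p dvd (int g ^ i - 1) * S"
    by (simp add: cong_iff_dvd_diff algebra_simps)
  then show ?thesis
    using gi prime_int_p by (auto simp: prime_dvd_mult_iff S_def)
qed simp

lemma chi_nontrivial: obtains c where "\<not> int p dvd c" "chi c \<noteq> 1"
proof -
  obtain g where g: "coprime p g" "ord p g = p - 1"
    by (rule primitive_root)
  have "\<not> [g ^ k = 1] (mod p)"
    using k_pos p_eq g(2) ord_divides[of g k p] by (auto dest: dvd_imp_le)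
  then have "\<not> [int (g ^ k) = int 1] (mod int p)"
    by (subst cong_int_iff)
  then have "chi (int g) \<noteq> 1"
    using red_chi[of "int g"] by (auto simp: red_def cong_sym_eq)
  moreover have "\<not> int p dvd int g"
    using g(1) coprime_int_p_iff[of "int g"] by (simp add: coprime_commute)
  ultimately show ?thesis
    using that by blast
qed

lemma sum_chi: "(\<Sum>t<p. chi (int t)) = 0"
proof -
  obtain c where c: "\<not> int p dvd c" "chi c \<noteq> 1"
    by (rule chi_nontrivial)
  have "(\<Sum>t<p. chi (int t)) = (\<Sum>t<p. chi (c * int t))"
    using p_pos c coprime_int_p_iff by (intro sum_residues_mult[symmetric]) (auto intro: chi_cong)
  also have "\<dots> = chi c * (\<Sum>t<p. chi (int t))"
    by (simp add: chi_mult sum_distrib_left)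
  finally have "(chi c - 1) * (\<Sum>t<p. chi (int t)) = 0"
    by (simp add: algebra_simps)
  then show ?thesis
    using c(2) by simp
qed

end

subsection \<open>Gauss sums in the group ring\<close>

lemma freshmans_dream_sum_dvd_power:
  fixes f :: "'b \<Rightarrow> 'a :: comm_ring_1"
  assumes "prime q"
  shows "of_nat q dvd (\<Sum>i\<in>A. f i) ^ (q ^ n) - (\<Sum>i\<in>A. f i ^ (q ^ n))"
proof (induction n)
  case (Suc n)
  have "of_nat q dvd ((\<Sum>i\<in>A. f i) ^ (q ^ n)) ^ q - (\<Sum>i\<in>A. f i ^ (q ^ n)) ^ q"
    using Suc by (rule dvd_power_diff)
  moreover have "of_nat q dvd (\<Sum>i\<in>A. f i ^ (q ^ n)) ^ q - (\<Sum>i\<in>A. (f i ^ (q ^ n)) ^ q)"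
    by (rule freshmans_dream_sum_dvd[OF assms])
  ultimately show ?case
    by (auto dest: dvd_diff_trans simp: power_mult[symmetric] mult.commute)
qed simp

text \<open>Polynomials modulo \<open>X\<^sup>p - 1\<close> stand for the group ring of the cyclic group of order \<open>p\<close>. In it the
  element \<open>cyc p f\<close> below replaces the Gauss sum of \<open>f\<close>, so that no roots of unity of order \<open>p\<close> are needed.\<close>

definition cyc_cong :: "nat \<Rightarrow> 'a::comm_ring_1 poly \<Rightarrow> 'a poly \<Rightarrow> bool" where
  "cyc_cong p P Q \<longleftrightarrow> (monom 1 p - 1) dvd P - Q"

lemma cyc_cong_refl [simp]: "cyc_cong p P P"
  by (simp add: cyc_cong_def)

lemma cyc_cong_sym: "cyc_cong p P Q \<Longrightarrow> cyc_cong p Q P"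
  unfolding cyc_cong_def by (metis dvd_minus_iff minus_diff_eq)

lemma cyc_cong_trans [trans]: "cyc_cong p P Q \<Longrightarrow> cyc_cong p Q R \<Longrightarrow> cyc_cong p P R"
  unfolding cyc_cong_def by (rule dvd_diff_trans)

lemma cyc_cong_mult: "cyc_cong p P Q \<Longrightarrow> cyc_cong p R S \<Longrightarrow> cyc_cong p (P * R) (Q * S)"
  unfolding cyc_cong_def by (rule dvd_mult_diff)

lemma cyc_cong_add: "cyc_cong p P Q \<Longrightarrow> cyc_cong p R S \<Longrightarrow> cyc_cong p (P + R) (Q + S)"
  unfolding cyc_cong_def add_diff_add by (rule dvd_add)

lemma cyc_cong_smult: "cyc_cong p P Q \<Longrightarrow> cyc_cong p (smult c P) (smult c Q)"
  unfolding cyc_cong_def smult_diff_right[symmetric] by (rule dvd_smult)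

lemma cyc_cong_sum: "(\<And>i. i \<in> A \<Longrightarrow> cyc_cong p (f i) (g i)) \<Longrightarrow> cyc_cong p (sum f A) (sum g A)"
  unfolding cyc_cong_def sum_subtractf[symmetric] by (rule dvd_sum)

lemma cyc_cong_monom:
  assumes "[i = j] (mod p)"
  shows "cyc_cong p (monom a i) (monom a j)"
proof -
  have *: "cyc_cong p (monom a i) (monom a (i mod p))" for i
  proof -
    have "monom (1::'a) p - 1 dvd monom 1 p ^ (i div p) - 1 ^ (i div p)"
      by (rule dvd_power_diff) simp
    then have "monom (1::'a) p - 1 dvd monom a (i mod p) * (monom 1 p ^ (i div p) - 1)"
      by simp
    also have "monom a (i mod p) * (monom 1 p ^ (i div p) - 1) = monom a i - monom a (i mod p)"
      by (simp add: algebra_simps monom_power mult_monom)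
    finally show ?thesis
      by (simp add: cyc_cong_def)
  qed
  show ?thesis
    using cyc_cong_trans[OF *[of i] cyc_cong_sym[OF *[of j, folded assms[unfolded Cong.cong_def]]]] .
qed

lemma cyc_cong_imp_eq:
  fixes P Q :: "'a :: idom poly"
  assumes "cyc_cong p P Q" "degree P < p" "degree Q < p"
  shows "P = Q"
proof (rule ccontr)
  assume "P \<noteq> Q"
  have "degree (monom (1::'a) p - 1) = p"
  proof (cases "p = 0")
    case False
    then have "degree (- 1 :: 'a poly) < degree (monom (1::'a) p)"
      by (simp add: degree_monom_eq)
    from degree_add_eq_left[OF this] show ?thesis
      by (simp add: degree_monom_eq)
  qed (use assms in simp)
  moreover have "degree (monom (1::'a) p - 1) \<le> degree (P - Q)"
    using assms(1) \<open>P \<noteq> Q\<close> by (intro dvd_imp_degree_le) (auto simp: cyc_cong_def)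
  moreover have "degree (P - Q) < p"
    using assms(2,3) by (rule degree_diff_less)
  ultimately show False
    by simp
qed

definition cyc :: "nat \<Rightarrow> (int \<Rightarrow> 'a) \<Rightarrow> 'a::comm_ring_1 poly" where
  "cyc p f = (\<Sum>t<p. monom (f (int t)) t)"

lemma coeff_cyc: "i < p \<Longrightarrow> coeff (cyc p f) i = f (int i)"
  by (simp add: cyc_def coeff_sum)

lemma degree_cyc: "p > 0 \<Longrightarrow> degree (cyc p f) < p"
  unfolding cyc_def by (rule degree_sum_less) (auto intro: le_less_trans[OF degree_monom_le])

lemma cyc_cong_reduce:
  assumes "p > 0"
  obtains Q where "cyc_cong p P Q" "degree Q < p"
proof
  show "cyc_cong p P (\<Sum>i\<le>degree P. monom (coeff P i) (i mod p))"
    by (subst poly_as_sum_of_monoms[of P, symmetric], intro cyc_cong_sum cyc_cong_monom)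
      (simp add: Cong.cong_def)
  show "degree (\<Sum>i\<le>degree P. monom (coeff P i) (i mod p)) < p"
    using assms by (intro degree_sum_less) (auto intro: le_less_trans[OF degree_monom_le])
qed

text \<open>The group ring is free on the powers of X below p, so divisibility by q in it can be
  tested on coefficients: once the quotient is reduced to degree below \<open>p\<close>, the
  congruence becomes an equation of polynomials.\<close>

lemma cyc_cong_of_nat_dvd:
  fixes P Q :: "'a :: idom poly"
  assumes "of_nat q dvd P - S" "cyc_cong p S Q" "degree P < p" "degree Q < p"
  shows "of_nat q dvd coeff P i - coeff Q i"
proof -
  obtain H where H: "P - S = of_nat q * H"
    using assms(1) by (auto elim!: dvdE)
  obtain H' where H': "cyc_cong p H H'" "degree H' < p"
    using assms(3) cyc_cong_reduce[of p H] by (metis less_nat_zero_code neq0_conv)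
  have "cyc_cong p (P - S) (of_nat q * H')"
    unfolding H by (intro cyc_cong_mult H') simp
  moreover have "cyc_cong p (S - Q) 0"
    using assms(2) by (simp add: cyc_cong_def)
  ultimately have "cyc_cong p ((P - S) + (S - Q)) (of_nat q * H' + 0)"
    by (rule cyc_cong_add)
  then have "cyc_cong p (P - Q) (of_nat q * H')"
    by simp
  then have "P - Q = of_nat q * H'"
  proof (rule cyc_cong_imp_eq)
    show "degree (P - Q) < p"
      by (rule degree_diff_less) fact+
    show "degree (of_nat q * H') < p"
      using H'(2) by (simp add: of_nat_poly order.strict_trans1[OF degree_smult_le])
  qed
  then have "coeff P i - coeff Q i = of_nat q * coeff H' i"
    by (simp add: of_nat_poly flip: coeff_diff)
  then show ?thesis
    by simp
qed

definition conv :: "nat \<Rightarrow> (int \<Rightarrow> 'a) \<Rightarrow> (int \<Rightarrow> 'a) \<Rightarrow> int \<Rightarrow> 'a::comm_ring_1" where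
  "conv p f g u = (\<Sum>s<p. f (int s) * g (u - int s))"

lemma cyc_mult:
  assumes "p > 0" and g: "\<And>a b. [a = b] (mod int p) \<Longrightarrow> g a = g b"
  shows "cyc_cong p (cyc p f * cyc p g) (cyc p (conv p f g))"
proof -
  have "cyc p f * cyc p g = (\<Sum>s<p. \<Sum>t<p. monom (f (int s) * g (int t)) (s + t))"
    by (simp add: cyc_def sum_product mult_monom)
  also have "cyc_cong p \<dots> (\<Sum>s<p. \<Sum>t<p. monom (f (int s) * g (int t)) ((s + t) mod p))"
    by (intro cyc_cong_sum cyc_cong_monom) (simp add: Cong.cong_def)
  also have "(\<Sum>s<p. \<Sum>t<p. monom (f (int s) * g (int t)) ((s + t) mod p))
      = (\<Sum>s<p. \<Sum>u<p. monom (f (int s) * g (int u - int s)) u)"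
  proof (rule sum.cong[OF refl])
    fix s assume s: "s \<in> {..<p}"
    show "(\<Sum>t<p. monom (f (int s) * g (int t)) ((s + t) mod p))
        = (\<Sum>u<p. monom (f (int s) * g (int u - int s)) u)"
    proof (rule sum.reindex_bij_witness[of _ "\<lambda>u. (u + (p - s)) mod p" "\<lambda>t. (s + t) mod p"])
      fix a assume a: "a \<in> {..<p}"
      have "s + a + (p - s) = a + p" "s + (a + (p - s)) = a + p"
        using s by auto
      then show "((s + a) mod p + (p - s)) mod p = a" "(s + (a + (p - s)) mod p) mod p = a"
        using a by (simp_all only: mod_add_left_eq mod_add_right_eq) simp_all
      show "(s + a) mod p \<in> {..<p}" "(a + (p - s)) mod p \<in> {..<p}"
        using assms(1) by simp_all
      have "[int ((s + a) mod p) - int s = int a] (mod int p)"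
        by (simp add: Cong.cong_def zmod_int mod_diff_left_eq)
      from g[OF this]
      show "monom (f (int s) * g (int ((s + a) mod p) - int s)) ((s + a) mod p)
          = monom (f (int s) * g (int a)) ((s + a) mod p)"
        by simp
    qed
  qed
  also have "\<dots> = (\<Sum>u<p. \<Sum>s<p. monom (f (int s) * g (int u - int s)) u)"
    by (rule sum.swap)
  also have "\<dots> = cyc p (conv p f g)"
    by (simp add: cyc_def conv_def monom_sum)
  finally show ?thesis .
qed

text \<open>The sum on the left is what Frobenius produces: it replaces X^t by X^(ct). For Gauss
  sums this is the Galois action on the roots of unity, and the lemma expresses the result by a new
  coefficient function.\<close>

lemma cyc_reindex:
  assumes "p > 0" and f: "\<And>a b. [a = b] (mod int p) \<Longrightarrow> f a = f b" and "coprime (int c) (int p)"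
  shows "cyc_cong p (\<Sum>t<p. monom (f (int c * int t)) (c * t)) (cyc p f)"
proof -
  define h where "h = (\<lambda>t. monom (f t) (nat (t mod int p)))"
  have nat_mod: "nat (int c * int t mod int p) = c * t mod p" for t
    by (metis nat_int of_nat_mult zmod_int)
  have "cyc_cong p (\<Sum>t<p. monom (f (int c * int t)) (c * t)) (\<Sum>t<p. h (int c * int t))"
    unfolding h_def nat_mod
    by (intro cyc_cong_sum cyc_cong_monom) (simp add: Cong.cong_def)
  also have "(\<Sum>t<p. h (int c * int t)) = (\<Sum>t<p. h (int t))"
  proof (rule sum_residues_mult)
    show "h a = h b" if "[a = b] (mod int p)" for a b
      using f[OF that] that by (simp only: h_def Cong.cong_def)
  qed fact+
  also have "\<dots> = cyc p f"
    by (auto simp: cyc_def h_def intro!: sum.cong)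
  finally show ?thesis .
qed

subsection \<open>Jacobi sums and reciprocity\<close>

context cubic_residue_symbol
begin

definition jac :: eis where
  "jac = conv p chi chi 1"

definition cchi :: "int \<Rightarrow> eis" where
  "cchi t = cnj_eis (chi t)"

lemma cchi_eq: "cchi t = chi t ^ 2"
  by (simp add: cchi_def cnj_chi)

lemma cchi_cong: "[s = t] (mod int p) \<Longrightarrow> cchi s = cchi t"
  by (simp add: cchi_eq chi_cong[of s t])

lemma cchi_mult: "cchi (s * t) = cchi s * cchi t"
  by (simp add: cchi_eq chi_mult power_mult_distrib)

lemma sum_cchi: "(\<Sum>t<p. cchi (int t)) = 0"
  unfolding cchi_def cnj_eis_sum[symmetric] by (simp add: sum_chi)

lemma conv_chi_scale:
  assumes "\<not> int p dvd u"
  shows "conv p chi chi u = chi u ^ 2 * jac"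
    and "conv p chi cchi u = chi u ^ 3 * conv p chi cchi 1"
proof -
  have cop: "coprime u (int p)"
    using assms by (simp add: coprime_int_p_iff)
  have diff: "[u - a = u - b] (mod int p)" if "[a = b] (mod int p)" for a b
    using that by (intro cong_diff) auto
  have fac: "u - u * x = u * (1 - x)" for x :: int
    by (simp add: algebra_simps)
  have "conv p chi chi u = (\<Sum>s<p. chi (u * int s) * chi (u - u * int s))"
    unfolding conv_def
    by (rule sum_residues_mult[symmetric, OF p_pos _ cop, of "\<lambda>x. chi x * chi (u - x)"])
      (simp add: chi_cong diff cong: arg_cong2[of _ _ _ _ "(*)"])
  also have "\<dots> = chi u ^ 2 * jac"
    unfolding jac_def conv_def fac
    by (simp add: chi_mult sum_distrib_left power2_eq_square mult_ac)
  finally show "conv p chi chi u = chi u ^ 2 * jac" .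
  have "conv p chi cchi u = (\<Sum>s<p. chi (u * int s) * cchi (u - u * int s))"
    unfolding conv_def
    by (rule sum_residues_mult[symmetric, OF p_pos _ cop, of "\<lambda>x. chi x * cchi (u - x)"])
      (metis chi_cong cchi_cong diff)
  also have "\<dots> = chi u ^ 3 * conv p chi cchi 1"
    unfolding conv_def fac
    by (simp add: chi_mult cchi_mult cchi_eq[of u] sum_distrib_left power2_eq_square power3_eq_cube mult_ac)
  finally show "conv p chi cchi u = chi u ^ 3 * conv p chi cchi 1" .
qed

lemma conv_chi_0:
  assumes "int p dvd u"
  shows "conv p chi chi u = 0" and "conv p chi cchi u = of_nat (p - 1)"
proof -
  have minus: "chi (u - s) = chi s" for s
  proof -
    have "[u - s = - s] (mod int p)"
      using assms by (simp add: cong_iff_dvd_diff)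
    then show ?thesis
      using chi_cong chi_minus by metis
  qed
  have "conv p chi chi u = (\<Sum>s<p. cchi (int s))"
    unfolding conv_def minus cchi_eq by (simp add: power2_eq_square)
  then show "conv p chi chi u = 0"
    by (simp add: sum_cchi)
  have *: "chi (int s) * cchi (int s) = (if s = 0 then 0 else 1)" if "s < p" for s
  proof (cases "s = 0")
    case False
    then have "\<not> int p dvd int s"
      using that by (auto dest: dvd_imp_le)
    then have "chi (int s) ^ 3 = 1"
      by (rule chi_cubed)
    then show ?thesis
      using False by (simp add: cchi_eq power2_eq_square power3_eq_cube mult.assoc)
  qed (simp add: chi_0_iff)
  have "conv p chi cchi u = (\<Sum>s<p. chi (int s) * cchi (int s))"
    unfolding conv_def cchi_def minus ..
  also have "\<dots> = (\<Sum>s<p. if s = 0 then 0 else 1)"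
    by (rule sum.cong) (auto simp: *)
  also have "\<dots> = (\<Sum>s\<in>{..<p} - {0}. 1)"
    by (rule sum.mono_neutral_cong_right) auto
  also have "\<dots> = of_nat (p - 1)"
    using p_pos by (simp add: card_Diff_singleton)
  finally show "conv p chi cchi u = of_nat (p - 1)" .
qed

lemma sum_conv:
  assumes g: "\<And>a b. [a = b] (mod int p) \<Longrightarrow> g a = g b"
  shows "(\<Sum>u<p. conv p f g (int u)) = (\<Sum>s<p. f (int s)) * (\<Sum>t<p. g (int t))"
proof -
  have "(\<Sum>u<p. conv p f g (int u)) = (\<Sum>s<p. \<Sum>u<p. f (int s) * g (int u - int s))"
    unfolding conv_def by (rule sum.swap)
  also have "\<dots> = (\<Sum>s<p. f (int s) * (\<Sum>u<p. g (int u + - int s)))"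
    by (simp add: sum_distrib_left)
  also have "\<dots> = (\<Sum>s<p. f (int s) * (\<Sum>t<p. g (int t)))"
    by (subst sum_residues_shift[OF p_pos, of g]) (simp_all add: g)
  finally show ?thesis
    by (simp add: sum_distrib_right)
qed

lemma not_dvd_residue: "u \<in> {..<p} - {0} \<Longrightarrow> \<not> int p dvd int u"
  by (auto dest: dvd_imp_le)

text \<open>The values at nonzero residues all agree, by scaling. Their common value follows from
  the value p - 1 at 0, because the sum over all residues is a product of two vanishing character
  sums.\<close>

lemma conv_chi_cchi: "conv p chi cchi u = (if int p dvd u then of_nat p - 1 else - 1)"
proof -
  have p1: "(of_nat (p - 1) :: eis) = of_nat p - 1"
    using p_pos by (simp add: of_nat_diff)
  have "0 = (\<Sum>u<p. conv p chi cchi (int u))"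
    by (subst sum_conv) (auto intro: cchi_cong simp: sum_chi)
  also have "{..<p} = insert 0 ({..<p} - {0})"
    using p_pos by auto
  also have "(\<Sum>u\<in>\<dots>. conv p chi cchi (int u))
      = conv p chi cchi 0 + (\<Sum>u\<in>{..<p} - {0}. conv p chi cchi (int u))"
    by (subst sum.insert) auto
  also have "(\<Sum>u\<in>{..<p} - {0}. conv p chi cchi (int u)) = (\<Sum>u\<in>{..<p} - {0}. conv p chi cchi 1)"
  proof (rule sum.cong[OF refl])
    fix u assume "u \<in> {..<p} - {0}"
    then have u: "\<not> int p dvd int u"
      by (rule not_dvd_residue)
    show "conv p chi cchi (int u) = conv p chi cchi 1"
      using conv_chi_scale(2)[OF u] chi_cubed[OF u] by simp
  qed
  also have "\<dots> = (of_nat p - 1) * conv p chi cchi 1"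
    using p_pos by (simp add: card_Diff_singleton p1)
  finally have *: "0 = conv p chi cchi 0 + (of_nat p - 1) * conv p chi cchi 1" .
  have "conv p chi cchi 0 = of_nat p - 1"
    by (simp only: conv_chi_0(2) dvd_0_right p1)
  with * have "(of_nat p - 1) * (conv p chi cchi 1 + 1) = 0"
    by (simp only: distrib_left mult_1_right add.commute)
  moreover have "(of_nat p - 1 :: eis) \<noteq> 0"
  proof
    assume "of_nat p - 1 = (0 :: eis)"
    then have "re (of_nat p - 1) = 0"
      by (simp only: eis_sel_simps)
    then show False
      using p_ge_7 by simp
  qed
  ultimately have "conv p chi cchi 1 = - 1"
    by (simp add: add_eq_0_iff2)
  then show ?thesis
    using conv_chi_scale(2)[of u] chi_cubed[of u] conv_chi_0(2)[of u] p1 by auto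
qed

lemma conv_cchi_cchi: "conv p cchi cchi u = cnj_eis (conv p chi chi u)"
  by (simp add: conv_def cchi_def cnj_eis_sum cnj_eis_mult)

abbreviation F :: "eis poly" where "F \<equiv> cyc p chi"
abbreviation Fc :: "eis poly" where "Fc \<equiv> cyc p cchi"

definition D :: "eis poly" where
  "D = cyc p (\<lambda>u. if int p dvd u then of_nat p - 1 else - 1)"

lemma smult_cyc: "smult c (cyc p f) = cyc p (\<lambda>t. c * f t)"
  by (induction p) (simp_all add: cyc_def smult_monom smult_add_right)

lemma cyc_cong_cyc: "(\<And>t. f t = g t) \<Longrightarrow> cyc p f = cyc p g"
  by (simp add: cyc_def)

lemma F_F: "cyc_cong p (F * F) (smult jac Fc)"
proof -
  have "cyc_cong p (F * F) (cyc p (conv p chi chi))"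
    by (intro cyc_mult p_pos chi_cong)
  also have "cyc p (conv p chi chi) = smult jac Fc"
    unfolding smult_cyc
  proof (rule cyc_cong_cyc)
    fix t
    show "conv p chi chi t = jac * cchi t"
      using conv_chi_scale(1)[of t] conv_chi_0(1)[of t] chi_0_iff[of t]
      by (cases "int p dvd t") (simp_all add: cchi_eq mult_ac)
  qed
  finally show ?thesis .
qed

lemma Fc_Fc: "cyc_cong p (Fc * Fc) (smult (cnj_eis jac) F)"
proof -
  have "cyc_cong p (Fc * Fc) (cyc p (conv p cchi cchi))"
    by (intro cyc_mult p_pos cchi_cong)
  also have "cyc p (conv p cchi cchi) = smult (cnj_eis jac) F"
    unfolding smult_cyc
  proof (rule cyc_cong_cyc)
    fix t
    have "cnj_eis (chi t ^ 2) = chi t"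
      using chi_in[of t] by (auto simp: cube_units_def power2_eq_square intro!: eis_eqI)
    then show "conv p cchi cchi t = cnj_eis jac * chi t"
      using conv_chi_scale(1)[of t] conv_chi_0(1)[of t] chi_0_iff[of t]
      by (cases "int p dvd t") (simp_all add: conv_cchi_cchi cnj_eis_mult mult_ac)
  qed
  finally show ?thesis .
qed

lemma F_Fc: "cyc_cong p (F * Fc) D"
proof -
  have "cyc_cong p (F * Fc) (cyc p (conv p chi cchi))"
    by (intro cyc_mult p_pos cchi_cong)
  also have "cyc p (conv p chi cchi) = D"
    unfolding D_def by (rule cyc_cong_cyc) (rule conv_chi_cchi)
  finally show ?thesis .
qed

lemma D_mult:
  assumes f: "\<And>a b. [a = b] (mod int p) \<Longrightarrow> f a = f b" and "(\<Sum>t<p. f (int t)) = 0"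
  shows "cyc_cong p (D * cyc p f) (smult (of_nat p) (cyc p f))"
proof -
  have "cyc_cong p (D * cyc p f) (cyc p (conv p (\<lambda>u. if int p dvd u then of_nat p - 1 else - 1) f))"
    unfolding D_def by (intro cyc_mult p_pos f)
  also have "cyc p (conv p (\<lambda>u. if int p dvd u then of_nat p - 1 else - 1) f) = smult (of_nat p) (cyc p f)"
    unfolding smult_cyc
  proof (rule cyc_cong_cyc)
    fix u
    have *: "(if int p dvd int s then of_nat p - 1 else - 1) * f (u - int s)
        = (if s = 0 then of_nat p * f u else 0) - f (u - int s)" if "s < p" for s
      using that not_dvd_residue[of s] by (auto simp: algebra_simps)
    have "(\<Sum>s<p. f (u - int s)) = (\<Sum>s<p. (f (u + (-1) * int s)))"
      by simp
    also have "\<dots> = (\<Sum>s<p. f (u + int s))"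
      by (rule sum_residues_mult[OF p_pos, of "\<lambda>x. f (u + x)"]) (auto intro!: f cong_add)
    also have "\<dots> = (\<Sum>s<p. f (int s))"
      using sum_residues_shift[OF p_pos, of f u] f by (simp add: add.commute)
    finally have "(\<Sum>s<p. f (u - int s)) = 0"
      using assms(2) by simp
    moreover have "conv p (\<lambda>u. if int p dvd u then of_nat p - 1 else - 1) f u
        = (\<Sum>s<p. (if s = 0 then of_nat p * f u else 0) - f (u - int s))"
      unfolding conv_def by (rule sum.cong[OF refl], rule *) simp
    ultimately show "conv p (\<lambda>u. if int p dvd u then of_nat p - 1 else - 1) f u = of_nat p * f u"
      using p_pos by (simp add: sum_subtractf)
  qed
  finally show ?thesis .
qed

lemma F_cubed: "cyc_cong p (F ^ 3) (smult jac D)"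
proof -
  have "cyc_cong p (F * F * F) (smult jac Fc * F)"
    by (intro cyc_cong_mult F_F) simp
  also have "smult jac Fc * F = smult jac (F * Fc)"
    by (simp add: mult.commute)
  also have "cyc_cong p \<dots> (smult jac D)"
    by (intro cyc_cong_smult F_Fc)
  finally show ?thesis
    by (simp add: power3_eq_cube)
qed

text \<open>The extra factor \<open>F\<close> matters: F^3 is only \<open>jac\<close> times
  \<open>D\<close>, and \<open>D\<close> becomes the scalar p when it meets an element with
  coefficient sum 0.\<close>

lemma F_power: "cyc_cong p (F ^ (3 * m + 1)) (smult ((of_nat p * jac) ^ m) F)"
proof (induction m)
  case (Suc m)
  have "F ^ (3 * Suc m + 1) = F ^ 3 * F ^ (3 * m + 1)"
    by (simp add: power_add[symmetric] del: power_Suc)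
  also have "cyc_cong p \<dots> (smult jac D * smult ((of_nat p * jac) ^ m) F)"
    by (intro cyc_cong_mult F_cubed Suc)
  also have "smult jac D * smult ((of_nat p * jac) ^ m) F = smult (jac * (of_nat p * jac) ^ m) (D * F)"
    by (simp add: mult_ac)
  also have "cyc_cong p \<dots> (smult (jac * (of_nat p * jac) ^ m) (smult (of_nat p) F))"
    by (intro cyc_cong_smult D_mult chi_cong sum_chi)
  also have "smult (jac * (of_nat p * jac) ^ m) (smult (of_nat p) F) = smult ((of_nat p * jac) ^ Suc m) F"
    by (simp add: mult_ac)
  finally show ?case .
qed simp

text \<open>Grouping the product of two copies of \<open>F\<close> and two of \<open>Fc\<close> in
  two ways yields (norm of \<open>jac\<close>) D and D^2 = p D. The coefficients at X, where that of
  \<open>D\<close> is -1, give the claim.\<close>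

lemma norm_jac: "eis_norm jac = int p"
proof -
  have "cyc_cong p ((F * F) * (Fc * Fc)) (smult jac Fc * smult (cnj_eis jac) F)"
    by (intro cyc_cong_mult F_F Fc_Fc)
  also have "smult jac Fc * smult (cnj_eis jac) F = smult (of_int (eis_norm jac)) (F * Fc)"
    by (simp add: mult_cnj_eis[symmetric] mult_ac)
  also have "cyc_cong p \<dots> (smult (of_int (eis_norm jac)) D)"
    by (intro cyc_cong_smult F_Fc)
  finally have 1: "cyc_cong p ((F * F) * (Fc * Fc)) (smult (of_int (eis_norm jac)) D)" .
  have "(F * F) * (Fc * Fc) = (F * Fc) * (F * Fc)"
    by (simp add: mult_ac)
  also have "cyc_cong p \<dots> (D * D)"
    by (intro cyc_cong_mult F_Fc)
  also have "D * D = D * cyc p (\<lambda>u. if int p dvd u then of_nat p - 1 else - 1)"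
    by (simp add: D_def)
  also have "cyc_cong p \<dots> (smult (of_nat p) (cyc p (\<lambda>u. if int p dvd u then of_nat p - 1 else - 1)))"
  proof (rule D_mult)
    fix a b assume "[a = b] (mod int p)"
    then have "int p dvd a \<longleftrightarrow> int p dvd b"
      by (simp add: Cong.cong_def dvd_eq_mod_eq_0)
    then show "(if int p dvd a then of_nat p - 1 else - 1) = (if int p dvd b then of_nat p - 1 else (- 1 :: eis))"
      by simp
  next
    have "(\<Sum>t<p. conv p chi cchi (int t)) = 0"
      by (subst sum_conv) (auto intro: cchi_cong simp: sum_chi)
    then show "(\<Sum>t<p. if int p dvd int t then of_nat p - 1 else - 1) = (0 :: eis)"
      by (simp add: conv_chi_cchi)
  qed
  finally have "cyc_cong p (F * F * (Fc * Fc)) (smult (of_nat p) D)"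
    by (simp add: D_def)
  with 1 have "cyc_cong p (smult (of_nat p) D) (smult (of_int (eis_norm jac)) D)"
    using cyc_cong_sym cyc_cong_trans by blast
  then have "smult (of_nat p) D = smult (of_int (eis_norm jac)) D"
    unfolding D_def smult_cyc by (rule cyc_cong_imp_eq) (use p_pos degree_cyc in auto)
  then have "coeff (smult (of_nat p) D) 1 = coeff (smult (of_int (eis_norm jac)) D) 1"
    by simp
  moreover have "coeff D 1 = - 1"
    using p_ge_7 by (simp add: D_def coeff_cyc)
  ultimately have "re (of_nat p) = re (of_int (eis_norm jac))"
    by simp
  then show ?thesis
    by simp
qed

text \<open>Cubing is additive modulo 3, so the coefficient of F^3 at X is congruent to the cube of
  a character value, which is 1. By \<open>F_cubed\<close> it equals -\<open>jac\<close>. This makes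
  \<open>jac\<close> primary.\<close>

lemma jac_mod_3: "of_nat 3 dvd jac + 1"
proof -
  define f where "f = (\<lambda>t. chi t ^ 3)"
  have p3: "coprime (int 3) (int p)"
    using p_ge_7 coprime_int_p_iff[of 3] by (auto dest: zdvd_imp_le)
  have f: "f a = f b" if "[a = b] (mod int p)" for a b
    using chi_cong[OF that] by (simp add: f_def)
  have scale: "f (int 3 * t) = f t" for t
  proof -
    have "chi (int 3) ^ 3 = 1"
      using p3 coprime_int_p_iff by (intro chi_cubed) blast
    then show ?thesis
      by (simp add: f_def chi_mult power_mult_distrib)
  qed
  have "of_nat 3 dvd F ^ 3 - (\<Sum>t<p. (monom (chi (int t)) t) ^ 3)"
    unfolding cyc_def by (rule freshmans_dream_sum_dvd) simp
  also have "(\<Sum>t<p. (monom (chi (int t)) t) ^ 3) = (\<Sum>t<p. monom (f (int 3 * int t)) (3 * t))"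
    unfolding scale by (simp add: f_def monom_power mult.commute)
  finally have 1: "of_nat 3 dvd F ^ 3 - (\<Sum>t<p. monom (f (int 3 * int t)) (3 * t))" .
  have 2: "cyc_cong p (\<Sum>t<p. monom (f (int 3 * int t)) (3 * t)) (cyc p f)"
    using p_pos f p3 by (rule cyc_reindex)
  obtain H where H: "F ^ 3 - (\<Sum>t<p. monom (f (int 3 * int t)) (3 * t)) = of_nat 3 * H"
    using 1 by (rule dvdE)
  have "cyc_cong p (smult jac D + - (of_nat 3 * H)) (F ^ 3 + - (of_nat 3 * H))"
    by (intro cyc_cong_add cyc_cong_sym[OF F_cubed]) simp
  also have "F ^ 3 + - (of_nat 3 * H) = (\<Sum>t<p. monom (f (int 3 * int t)) (3 * t))"
    unfolding H[symmetric] by simp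
  also note 2
  finally have 3: "cyc_cong p (smult jac D + - (of_nat 3 * H)) (cyc p f)" .
  have "of_nat 3 dvd coeff (smult jac D) 1 - coeff (cyc p f) 1"
    by (rule cyc_cong_of_nat_dvd[OF _ 3]) (use p_pos degree_cyc in \<open>simp_all add: D_def smult_cyc\<close>)
  moreover have "coeff (smult jac D) 1 = - jac" "coeff (cyc p f) 1 = 1"
    using p_ge_7 by (simp_all add: D_def coeff_cyc f_def)
  ultimately have "of_nat 3 dvd - (jac + 1)"
    by (simp only: minus_add_distrib diff_conv_add_uminus)
  then show ?thesis
    by (simp only: dvd_minus_iff)
qed

text \<open>Under \<open>red\<close> the Jacobi sum becomes the sum of s^k (1 - s)^k over the
  residues s. Only powers of s with exponents from k to 2k < p - 1 occur, and their sums vanish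
  modulo \<open>p\<close>. So \<open>jac\<close> lies in the prime that defines
  \<open>chi\<close>.\<close>

lemma red_jac: "int p dvd red jac"
proof -
  have "[red jac = (\<Sum>s<p. red (chi (int s) * chi (1 - int s)))] (mod int p)"
    by (simp add: jac_def conv_def red_sum)
  also have "[(\<Sum>s<p. red (chi (int s) * chi (1 - int s))) = (\<Sum>s<p. int s ^ k * (1 - int s) ^ k)] (mod int p)"
  proof (rule cong_sum)
    fix s
    have "[red (chi (int s) * chi (1 - int s)) = red (chi (int s)) * red (chi (1 - int s))] (mod int p)"
      by (rule red_mult)
    also have "[red (chi (int s)) * red (chi (1 - int s)) = int s ^ k * (1 - int s) ^ k] (mod int p)"
      by (intro cong_mult red_chi)
    finally show "[red (chi (int s) * chi (1 - int s)) = int s ^ k * (1 - int s) ^ k] (mod int p)" .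
  qed
  also have "(\<Sum>s<p. int s ^ k * (1 - int s) ^ k)
      = (\<Sum>s<p. \<Sum>i\<le>k. of_nat (k choose i) * (-1) ^ i * int s ^ (k + i))"
  proof (rule sum.cong[OF refl])
    fix s
    have "(1 - int s) ^ k = (- int s + 1) ^ k"
      by simp
    also have "\<dots> = (\<Sum>i\<le>k. of_nat (k choose i) * (- int s) ^ i * 1 ^ (k - i))"
      by (rule binomial_ring)
    finally show "int s ^ k * (1 - int s) ^ k = (\<Sum>i\<le>k. of_nat (k choose i) * (-1) ^ i * int s ^ (k + i))"
      by (simp add: sum_distrib_left power_add power_minus[of "int s"] mult_ac)
  qed
  also have "\<dots> = (\<Sum>i\<le>k. of_nat (k choose i) * (-1) ^ i * (\<Sum>s<p. int s ^ (k + i)))"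
    by (subst sum.swap) (simp add: sum_distrib_left)
  also have "[\<dots> = 0] (mod int p)"
    unfolding cong_0_iff
  proof (rule dvd_sum, rule dvd_mult)
    fix i assume "i \<in> {..k}"
    then show "int p dvd (\<Sum>s<p. int s ^ (k + i))"
      using k_pos p_eq by (intro sum_power_residues) simp
  qed
  finally show ?thesis
    by (simp add: cong_0_iff)
qed

text \<open>F^(q^2) is computed twice. Since q^2 = 3m + 1, it is (p jac)^m F. Modulo q, Frobenius
  applied twice leaves the values of \<open>chi\<close> fixed and moves X^t to X^(q^2 t), which
  gives chi(q)^(-2) F = chi(q) F. Using q^2 instead of q covers both residue classes of q modulo 3.
  The coefficients at X are compared.\<close>

theorem jac_reciprocity:
  assumes q: "prime q" "q \<noteq> 3" "q \<noteq> p"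
  shows "of_nat q dvd (of_nat p * jac) ^ ((q ^ 2 - 1) div 3) - chi (int q)"
proof -
  define m where "m = (q ^ 2 - 1) div 3"
  have q3: "\<not> 3 dvd q"
    using q by (metis prime_nat_iff one_eq_numeral_iff semiring_norm(84))
  have q2: "q ^ 2 = 3 * m + 1"
    using square_mod_3[OF q3] unfolding m_def .
  have pq: "\<not> p dvd q"
    using q prime_p by (metis primes_dvd_imp_eq)
  have cop: "coprime (int (q ^ 2)) (int p)"
    using pq prime_p coprime_commute prime_imp_coprime by (metis coprime_int_iff coprime_power_left_iff)
  have chi_q3: "chi (int q) ^ 3 = 1"
    using pq by (intro chi_cubed) simp
  define f where "f = (\<lambda>t. chi (int q) * chi t)"
  have f: "f a = f b" if "[a = b] (mod int p)" for a b
    using chi_cong[OF that] by (simp add: f_def)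
  have scale: "f (int (q ^ 2) * t) = chi t" for t
    using chi_q3 by (simp add: f_def chi_mult power2_eq_square power3_eq_cube flip: mult.assoc)
  have chi_pow: "chi t ^ (q ^ 2) = chi t" for t
    using chi_in[of t] cube_units_cube[of "chi t"] by (auto simp: q2 power_mult power_add)
  have "of_nat q dvd F ^ (q ^ 2) - (\<Sum>t<p. (monom (chi (int t)) t) ^ (q ^ 2))"
    unfolding cyc_def by (rule freshmans_dream_sum_dvd_power[OF q(1)])
  also have "(\<Sum>t<p. (monom (chi (int t)) t) ^ (q ^ 2))
      = (\<Sum>t<p. monom (f (int (q ^ 2) * int t)) (q ^ 2 * t))"
    unfolding scale by (simp add: chi_pow monom_power mult.commute)
  finally obtain H where H: "F ^ (q ^ 2) - (\<Sum>t<p. monom (f (int (q ^ 2) * int t)) (q ^ 2 * t)) = of_nat q * H"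
    by (rule dvdE)
  have 2: "cyc_cong p (\<Sum>t<p. monom (f (int (q ^ 2) * int t)) (q ^ 2 * t)) (cyc p f)"
    using p_pos f cop by (rule cyc_reindex)
  define P where "P = smult ((of_nat p * jac) ^ m) F"
  have 3: "cyc_cong p (F ^ (q ^ 2)) P"
    unfolding q2 P_def by (rule F_power)
  have "cyc_cong p (P + - (of_nat q * H)) (F ^ (q ^ 2) + - (of_nat q * H))"
    using 3 by (intro cyc_cong_add) (auto intro: cyc_cong_sym)
  also have "F ^ (q ^ 2) + - (of_nat q * H) = (\<Sum>t<p. monom (f (int (q ^ 2) * int t)) (q ^ 2 * t))"
    unfolding H[symmetric] by simp
  also note 2
  finally have 4: "cyc_cong p (P + - (of_nat q * H)) (cyc p f)" .
  have "of_nat q dvd coeff P 1 - coeff (cyc p f) 1"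
    by (rule cyc_cong_of_nat_dvd[OF _ 4])
      (use p_pos degree_cyc in \<open>auto simp: P_def smult_cyc\<close>)
  then show ?thesis
    using p_ge_7 by (simp add: P_def coeff_cyc f_def m_def)
qed

end

subsection \<open>The cubic Jacobi symbol\<close>

text \<open>Modulo \<open>p\<close> the number \<open>r\<close> has order 3, which must divide p -
  1. Concretely, if p - 1 = 3j + 1, then Fermat gives 1 = r^(p-1) = r.\<close>

lemma prime_mod_3_if_dvd:
  fixes r :: int
  assumes "prime p" "p \<noteq> 3" "int p dvd r ^ 2 + r + 1"
  shows "p mod 3 = 1"
proof -
  have r: "\<not> int p dvd r"
  proof
    assume "int p dvd r"
    then have "int p dvd (r ^ 2 + r + 1) - r * (r + 1)"
      using assms(3) by (intro dvd_diff) auto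
    then show False
      using prime_gt_1_nat[OF assms(1)] by (simp add: algebra_simps power2_eq_square)
  qed
  have r1: "\<not> int p dvd r - 1"
  proof
    assume "int p dvd r - 1"
    then have "int p dvd (r ^ 2 + r + 1) - (r - 1) * (r + 2)"
      using assms(3) by (intro dvd_diff) auto
    then have "int p dvd int 3"
      by (simp add: algebra_simps power2_eq_square)
    then have "p dvd 3"
      by (subst (asm) int_dvd_int_iff)
    then show False
      using assms(1,2) primes_dvd_imp_eq[of p 3] by simp
  qed
  have "p mod 3 \<noteq> 2"
  proof
    assume "p mod 3 = 2"
    then obtain j where j: "p - 1 = 3 * j + 1"
      by (intro that[of "p div 3"]) presburger
    have "int p dvd (r - 1) * (r ^ 2 + r + 1)"
      using assms(3) by simp
    then have "[r ^ 3 = 1] (mod int p)"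
      by (simp add: cong_iff_dvd_diff algebra_simps power2_eq_square power3_eq_cube)
    then have "[(r ^ 3) ^ j * r = 1 ^ j * r] (mod int p)"
      by (intro cong_mult cong_pow) auto
    then have "[r ^ (p - 1) = r] (mod int p)"
      unfolding j power_add power_mult by simp
    moreover have "[r ^ (p - 1) = 1] (mod int p)"
      using assms(1) r by (rule fermat_theorem_int)
    ultimately have "[r = 1] (mod int p)"
      using cong_trans cong_sym by blast
    then show False
      using r1 by (simp add: cong_iff_dvd_diff)
  qed
  moreover have "p mod 3 \<noteq> 0"
    using assms(1,2) primes_dvd_imp_eq[of 3 p] by (auto simp: mod_eq_0_iff_dvd)
  ultimately show ?thesis
    by linarith
qed

lemma coprime_eis_dvd:
  assumes "\<beta> dvd \<gamma>" "coprime (re \<gamma>) (im \<gamma>)"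
  shows "coprime (re \<beta>) (im \<beta>)"
proof (rule coprimeI)
  fix l assume "l dvd re \<beta>" "l dvd im \<beta>"
  then have "of_int l dvd \<beta>"
    by (simp add: of_int_dvd_eis_iff)
  then have "of_int l dvd \<gamma>"
    using assms(1) dvd_trans by blast
  then show "is_unit l"
    using assms(2) coprime_common_divisor[of "re \<gamma>" "im \<gamma>" l] by (simp only: of_int_dvd_eis_iff)
qed

text \<open>The function \<open>G\<close> is the symbol \<open>m \<mapsto> (m/\<beta>)\<close>; its last property is the reciprocity law
  \<open>(q/\<beta>) = (\<beta>/q)\<close> for rational primes \<open>q\<close>, in a form that does not depend on how \<open>q\<close> splits.\<close>

theorem cubic_jacobi_symbol:
  fixes \<beta> :: eis
  assumes "coprime (re \<beta>) (im \<beta>)" "3 dvd im \<beta>"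
  shows "\<exists>G :: int \<Rightarrow> eis. (\<forall>m n. G (m * n) = G m * G n) \<and>
    (\<forall>m n. [m = n] (mod eis_norm \<beta>) \<longrightarrow> G m = G n) \<and>
    (\<forall>m. coprime m (eis_norm \<beta>) \<longrightarrow> G m \<in> cube_units) \<and>
    (\<forall>q. prime q \<longrightarrow> q \<noteq> 3 \<longrightarrow> coprime (int q) (eis_norm \<beta>) \<longrightarrow>
      of_nat q dvd (\<beta> ^ 2 * cnj_eis \<beta>) ^ ((q ^ 2 - 1) div 3) - G (int q))"
  using assms
proof (induction "nat (eis_norm \<beta>)" arbitrary: \<beta> rule: less_induct)
  case less
  \<comment> \<open>Each induction step splits off from \<beta> the Jacobi sum of a prime p dividing
    the norm and multiplies the symbol by the character \<open>chi\<close> belonging to it.\<close>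
  define a b where "a = re \<beta>" and "b = im \<beta>"
  have N: "eis_norm \<beta> = a ^ 2 - a * b + b ^ 2"
    by (simp add: eis_norm_def a_def b_def)
  have "\<beta> \<noteq> 0"
    using less.prems(1) by auto
  then have pos: "eis_norm \<beta> > 0"
    using eis_norm_nonneg[of \<beta>] eis_norm_eq_0_iff[of \<beta>] by linarith
  have a3: "\<not> 3 dvd a"
    using less.prems coprime_common_divisor[of a b 3] by (auto simp: a_def b_def)
  show ?case
  proof (cases "eis_norm \<beta> = 1")
    case True
    have "b = 0"
    proof (rule ccontr)
      assume "b \<noteq> 0"
      then have "\<bar>b\<bar> \<ge> 3"
        using less.prems(2) dvd_imp_le_int[of b 3] by (simp add: b_def)
      then have "b ^ 2 \<ge> 9"
        using abs_le_square_iff[of 3 b] by simp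
      moreover have "4 = (2 * a - b) ^ 2 + 3 * b ^ 2"
        using four_eis_norm[of \<beta>] True by (simp add: a_def b_def)
      moreover have "(2 * a - b) ^ 2 \<ge> 0"
        by simp
      ultimately show False
        by linarith
    qed
    then have "a = 1 \<or> a = - 1"
      using True N by (simp add: power2_eq_1_iff)
    then have \<beta>: "\<beta> = 1 \<or> \<beta> = - 1"
      using \<open>b = 0\<close> by (auto simp: a_def b_def intro: eis_eqI)
    \<comment> \<open>For \<beta> = -1 the base is -1: the exponent (q^2 - 1)/3 is even for odd q,
      and -1 is congruent to 1 for q = 2.\<close>
    have "of_nat q dvd (\<beta> ^ 2 * cnj_eis \<beta>) ^ ((q ^ 2 - 1) div 3) - 1" if q: "prime q" "q \<noteq> 3" for q
    proof (cases "q = 2")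
      case True
      have "cnj_eis (- 1) = - 1"
        by (rule eis_eqI) auto
      then show ?thesis
        using \<beta> True by auto
    next
      case False
      then have "odd q"
        using q prime_odd_nat prime_ge_2_nat by (metis le_neq_implies_less)
      then have "even (q ^ 2 - 1)"
        by simp
      moreover have "3 * ((q ^ 2 - 1) div 3) = q ^ 2 - 1"
      proof -
        have "\<not> 3 dvd q"
          using q primes_dvd_imp_eq[of 3 q] by auto
        then show ?thesis
          using square_mod_3[of q] by linarith
      qed
      ultimately have "even ((q ^ 2 - 1) div 3)"
        by presburger
      moreover have "cnj_eis (- 1) = - 1"
        by (rule eis_eqI) auto
      ultimately show ?thesis
        using \<beta> by auto
    qed
    then show ?thesis
      by (intro exI[of _ "\<lambda>_. 1"]) (auto simp: cube_units_def)
  next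
    case False
    then have "nat (eis_norm \<beta>) \<noteq> 1"
      using pos by linarith
    then obtain p where p: "prime p" "p dvd nat (eis_norm \<beta>)"
      using prime_factor_nat by blast
    then have "int p dvd int (nat (eis_norm \<beta>))"
      by (subst int_dvd_int_iff)
    then have pN: "int p dvd eis_norm \<beta>"
      using pos by simp
    have prime_p: "prime (int p)"
      using p(1) by simp
    have pb: "\<not> int p dvd b"
    proof
      assume "int p dvd b"
      then have "int p dvd eis_norm \<beta> + b * (a - b)"
        using pN by simp
      then have "int p dvd a ^ 2"
        by (simp add: N algebra_simps power2_eq_square)
      then have "int p dvd a"
        using prime_p prime_dvd_power by blast
      then show False
        using \<open>int p dvd b\<close> less.prems(1) prime_p coprime_common_divisor[of a b "int p"]
        by (auto simp: a_def b_def)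
    qed
    have p3: "p \<noteq> 3"
    proof
      assume "p = 3"
      then have "3 dvd eis_norm \<beta> + b * (a - b)"
        using pN less.prems(2) by (simp add: b_def)
      then have "3 dvd a ^ 2"
        by (simp add: N algebra_simps power2_eq_square)
      then show False
        using a3 prime_dvd_power[of "3::int" a 2] by simp
    qed
    have "coprime b (int p)"
      using pb prime_p prime_imp_coprime coprime_commute by blast
    then obtain c where c: "[b * c = 1] (mod int p)"
      using cong_solve_coprime_int by blast
    \<comment> \<open>This is -a/b modulo p, the image of \<omega> for which a + b \<omega> reduces
      to 0. It is a root of X^2 + X + 1 because p divides the norm a^2 - a b + b^2.\<close>
    define r where "r = - a * c"
    have ab: "int p dvd a + b * r"
    proof -
      have "int p dvd b * c - 1"
        using c by (simp add: cong_iff_dvd_diff)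
      then have "int p dvd - a * (b * c - 1)"
        by (rule dvd_mult)
      then show ?thesis
        by (simp add: r_def algebra_simps)
    qed
    have "int p dvd b ^ 2 * (r ^ 2 + r + 1)"
    proof -
      have "b ^ 2 * (r ^ 2 + r + 1) = eis_norm \<beta> + (a + b * r) * (b * r - a + b)"
        by (simp add: N algebra_simps power2_eq_square)
      then show ?thesis
        using pN ab by simp
    qed
    then have r: "int p dvd r ^ 2 + r + 1"
      using pb prime_dvd_power[OF prime_p, of b 2] prime_dvd_mult_iff[OF prime_p] by blast
    have "p mod 3 = 1"
      using p(1) p3 r by (rule prime_mod_3_if_dvd)
    then have "p = 3 * (p div 3) + 1"
      by presburger
    then interpret cubic_residue_symbol p "p div 3" r
      using p(1) r by unfold_locales
    \<comment> \<open>\<beta> and \<open>jac\<close> are both in the kernel of \<open>red\<close>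
      modulo p, a prime ideal of norm p, and \<open>jac\<close> has norm p. So \<open>jac\<close>
      divides \<beta>; multiplied by the conjugate of \<open>jac\<close>, this is a divisibility by
      the integer p that can be checked on coordinates.\<close>
    have "of_int (int p) dvd \<beta> * cnj_eis jac"
    proof -
      define A B where "A = re jac" and "B = im jac"
      have AB: "int p dvd A + B * r"
        using red_jac by (simp add: red_def A_def B_def)
      have "b * A - a * B = b * (A + B * r) - B * (a + b * r)"
        "a * A - a * B + b * B = (a + b * r) * A - b * r * (A + B * r) - B * (a + b * r) + b * B * (r ^ 2 + r + 1)"
        by (simp_all add: algebra_simps power2_eq_square)
      then have "int p dvd b * A - a * B" "int p dvd a * A - a * B + b * B"
        using AB ab r by (auto intro!: dvd_add dvd_diff)
      then show ?thesis
        unfolding of_int_dvd_eis_iff by (simp add: A_def B_def a_def b_def algebra_simps)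
    qed
    then obtain \<gamma> where \<gamma>: "\<beta> * cnj_eis jac = of_int (int p) * \<gamma>"
      by (rule dvdE)
    have "of_int (int p) * \<beta> = of_int (int p) * (jac * \<gamma>)"
      using arg_cong[OF \<gamma>, of "\<lambda>x. x * jac"] mult_cnj_eis[of jac] norm_jac by (simp add: mult_ac)
    then have \<beta>: "\<beta> = jac * \<gamma>"
      using p(1) prime_gt_0_nat[OF p(1)]
      by (metis im_of_int mult_cancel_left of_int_of_nat_eq of_nat_0_less_iff order_less_irrefl re_of_int eis_sel_simps(1))
    have norm: "eis_norm \<beta> = int p * eis_norm \<gamma>"
      by (simp add: \<beta> eis_norm_mult norm_jac)
    have jac3: "3 dvd re jac + 1" "3 dvd im jac"
      using jac_mod_3 of_int_dvd_eis_iff[of 3 "jac + 1"] by simp_all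
    have "nat (eis_norm \<gamma>) < nat (eis_norm \<beta>)"
      using pos prime_gt_1_nat[OF p(1)] eis_norm_nonneg[of \<gamma>] unfolding norm
      by (simp add: zero_less_mult_iff)
    moreover have "coprime (re \<gamma>) (im \<gamma>)"
      using less.prems(1) by (rule coprime_eis_dvd[rotated]) (simp add: \<beta>)
    moreover have "3 dvd im \<gamma>"
    proof -
      have "3 dvd im (\<beta> * cnj_eis jac)"
        using jac3 less.prems(2) by simp
      then have "3 dvd int p * im \<gamma>"
        by (simp add: \<gamma>)
      moreover have "\<not> 3 dvd int p"
        using \<open>p mod 3 = 1\<close> by presburger
      ultimately show ?thesis
        using prime_dvd_mult_iff[of "3::int"] by simp
    qed
    ultimately obtain G where X: "\<And>m n. G (m * n) = G m * G n"
      "\<And>m n. [m = n] (mod eis_norm \<gamma>) \<Longrightarrow> G m = G n"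
      "\<And>m. coprime m (eis_norm \<gamma>) \<Longrightarrow> G m \<in> cube_units"
      "\<And>q. prime q \<Longrightarrow> q \<noteq> 3 \<Longrightarrow> coprime (int q) (eis_norm \<gamma>) \<Longrightarrow>
        of_nat q dvd (\<gamma> ^ 2 * cnj_eis \<gamma>) ^ ((q ^ 2 - 1) div 3) - G (int q)"
      using less.hyps[of \<gamma>] by blast
    show ?thesis
    proof (intro exI[of _ "\<lambda>m. chi m * G m"] conjI allI impI)
      fix m n
      show "chi (m * n) * G (m * n) = chi m * G m * (chi n * G n)"
        by (simp add: chi_mult X(1))
    next
      fix m n assume "[m = n] (mod eis_norm \<beta>)"
      then have "[m = n] (mod int p)" "[m = n] (mod eis_norm \<gamma>)"
        unfolding norm by (auto intro: cong_dvd_modulus)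
      then show "chi m * G m = chi n * G n"
        using chi_cong X(2) by simp
    next
      fix m assume "coprime m (eis_norm \<beta>)"
      then have "coprime m (int p)" "coprime m (eis_norm \<gamma>)"
        by (simp_all add: norm)
      then show "chi m * G m \<in> cube_units"
        using chi_unit X(3) coprime_int_p_iff cube_units_mult by blast
    next
      fix q assume q: "prime q" "q \<noteq> 3" "coprime (int q) (eis_norm \<beta>)"
      have "q \<noteq> p"
      proof
        assume "q = p"
        then have "is_unit (int p)"
          using q(3) by (simp add: norm)
        then show False
          using p(1) by simp
      qed
      \<comment> \<open>The expression \<beta>^2 cnj \<beta> is multiplicative in \<beta>, and for
        \<open>jac\<close> it is p jac, the base of the power in
        \<open>jac_reciprocity\<close>.\<close>
      have "jac ^ 2 * cnj_eis jac = jac * (jac * cnj_eis jac)"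
        by (simp add: power2_eq_square)
      then have "jac ^ 2 * cnj_eis jac = of_nat p * jac"
        by (simp add: mult_cnj_eis norm_jac mult.commute)
      then have "(\<beta> ^ 2 * cnj_eis \<beta>) = (of_nat p * jac) * (\<gamma> ^ 2 * cnj_eis \<gamma>)"
        by (simp add: \<beta> power_mult_distrib cnj_eis_mult mult_ac)
      moreover have "coprime (int q) (eis_norm \<gamma>)"
        using q(3) by (simp add: norm)
      then have "of_nat q dvd (of_nat p * jac) ^ ((q ^ 2 - 1) div 3)
          * (\<gamma> ^ 2 * cnj_eis \<gamma>) ^ ((q ^ 2 - 1) div 3) - chi (int q) * G (int q)"
        using q(1,2) \<open>q \<noteq> p\<close> by (intro dvd_mult_diff jac_reciprocity X(4))
      ultimately show "of_nat q dvd (\<beta> ^ 2 * cnj_eis \<beta>) ^ ((q ^ 2 - 1) div 3) - chi (int q) * G (int q)"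
        by (simp only: power_mult_distrib)
    qed
  qed
qed

subsection \<open>A norm equation\<close>

text \<open>The right-hand side is multiplicative in x: writing q^2 = 3i + 1 and y^2 = 3j + 1, the
  exponent for q y is i + j + 3ij, and W has order dividing 3.\<close>

lemma cube_units_mult_primes:
  fixes x :: nat
  assumes mult: "\<And>m n. G (m * n) = G m * G n" and one: "G (1::int) = (1::eis)"
    and W: "W \<in> cube_units"
    and G: "\<And>q. prime q \<Longrightarrow> q dvd x \<Longrightarrow> G (int q) = W ^ ((q ^ 2 - 1) div 3)"
    and "\<not> 3 dvd x" "x > 0"
  shows "G (int x) = W ^ ((x ^ 2 - 1) div 3)"
  using assms(4-6)
proof (induction x rule: less_induct)
  case (less x)
  show ?case
  proof (cases "x = 1")
    case False
    then obtain q where q: "prime q" "q dvd x"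
      using prime_factor_nat by blast
    then obtain y where y: "x = q * y"
      by (elim dvdE)
    have y0: "\<not> 3 dvd y" "y > 0" "\<not> 3 dvd q"
      using less.prems y by auto
    have "y < x"
      using prime_gt_1_nat[OF q(1)] y0(2) y by simp
    then have "G (int y) = W ^ ((y ^ 2 - 1) div 3)"
    proof (rule less.IH[OF _ _ y0(1,2)])
      show "G (int q') = W ^ ((q' ^ 2 - 1) div 3)" if "prime q'" "q' dvd y" for q'
        using less.prems(1)[of q'] that y by simp
    qed
    moreover have "G (int q) = W ^ ((q ^ 2 - 1) div 3)"
      using less.prems(1) q by blast
    ultimately have "G (int x) = W ^ ((q ^ 2 - 1) div 3 + (y ^ 2 - 1) div 3)"
      by (simp add: y mult power_add)
    moreover have "x ^ 2 = q ^ 2 * y ^ 2"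
      by (simp add: y power_mult_distrib)
    then have "3 * ((x ^ 2 - 1) div 3) + 1 = (3 * ((q ^ 2 - 1) div 3) + 1) * (3 * ((y ^ 2 - 1) div 3) + 1)"
      using square_mod_3[of x] square_mod_3[of y] square_mod_3[of q] y0 less.prems(2) by metis
    then have "(x ^ 2 - 1) div 3 = 3 * ((q ^ 2 - 1) div 3 * ((y ^ 2 - 1) div 3)) + ((q ^ 2 - 1) div 3 + (y ^ 2 - 1) div 3)"
      by (simp add: algebra_simps)
    then have "(x ^ 2 - 1) div 3 mod 3 = ((q ^ 2 - 1) div 3 + (y ^ 2 - 1) div 3) mod 3"
      by (simp only: mod_mult_self4)
    ultimately show ?thesis
      using cube_units_power_mod_3[OF W] by metis
  qed (use one in simp)
qed

text \<open>The residue of (x^2 - 1)/3 modulo 3 is read off from x^2 modulo 9, where squares are 0,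
  1, 4, 7 and powers of 2 have period 6. For k not divisible by 3 the congruence leaves only x^2 = 4
  with k = 2 and x^2 = 7 with k = 1 (k modulo 3), whatever the sign s.\<close>

lemma square_mod_9_cases:
  fixes x s :: int and k :: nat
  assumes s: "s = 1 \<or> s = - 1" and "\<not> 3 dvd k"
    and eq: "[x ^ 2 = s * 2 ^ (k + 2) + 6] (mod 9)"
  shows "3 dvd (nat \<bar>x\<bar> ^ 2 - 1) div 3 + k"
proof -
  define j where "j = k div 6"
  have "[2 ^ (6 * j) = (1 :: int) ^ j] (mod 9)"
    unfolding power_mult by (intro cong_pow) (simp add: Cong.cong_def)
  then have "[2 ^ (6 * j) * 2 ^ (k mod 6) = 1 * (2 :: int) ^ (k mod 6)] (mod 9)"
    by (intro cong_mult) auto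
  then have "[(2::int) ^ k = 2 ^ (k mod 6)] (mod 9)"
    by (simp add: j_def flip: power_add)
  then have "[s * 2 ^ (k + 2) + 6 = s * (2 ^ (k mod 6) * 4) + 6] (mod 9)"
    unfolding power_add by (intro cong_add cong_mult) auto
  with eq have 1: "[x ^ 2 = s * (2 ^ (k mod 6) * 4) + 6] (mod 9)"
    by (rule cong_trans)
  have x9: "x ^ 2 mod 9 \<in> {0, 1, 4, 7}"
  proof -
    have "x mod 9 \<in> {0, 1, 2, 3, 4, 5, 6, 7, 8}"
      using pos_mod_bound[of 9 x] pos_mod_sign[of 9 x] by auto
    moreover have "x ^ 2 mod 9 = (x mod 9) ^ 2 mod 9"
      by (simp add: power_mod)
    ultimately show ?thesis
      by auto
  qed
  have k6: "k mod 6 = 1 \<or> k mod 6 = 2 \<or> k mod 6 = 4 \<or> k mod 6 = 5"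
    using assms(2) by presburger
  have A: "x ^ 2 mod 9 = 4 \<and> k mod 3 = 2 \<or> x ^ 2 mod 9 = 7 \<and> k mod 3 = 1"
  proof -
    have km: "k mod 6 = 1 \<Longrightarrow> k mod 3 = 1" "k mod 6 = 2 \<Longrightarrow> k mod 3 = 2"
      "k mod 6 = 4 \<Longrightarrow> k mod 3 = 1" "k mod 6 = 5 \<Longrightarrow> k mod 3 = 2"
      by presburger+
    show ?thesis
      using s k6 1 x9 by (elim disjE) (simp_all add: Cong.cong_def km)
  qed
  define z where "z = nat \<bar>x\<bar> ^ 2"
  have "int (z mod 9) = x ^ 2 mod 9"
    by (simp add: z_def zmod_int)
  then have "z mod 9 = 4 \<and> k mod 3 = 2 \<or> z mod 9 = 7 \<and> k mod 3 = 1"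
    using A by linarith
  moreover define w where "w = z div 9"
  have "z = 9 * w + z mod 9"
    by (simp add: w_def)
  ultimately have "z = 9 * w + 4 \<and> k mod 3 = 2 \<or> z = 9 * w + 7 \<and> k mod 3 = 1"
    by auto
  then have "(z - 1) div 3 = 3 * w + 1 \<and> k mod 3 = 2 \<or> (z - 1) div 3 = 3 * w + 2 \<and> k mod 3 = 1"
    by auto
  moreover have "3 dvd 3 * w + 1 + k" if "k mod 3 = 2"
    using that by presburger
  moreover have "3 dvd 3 * w + 2 + k" if "k mod 3 = 1"
    using that by presburger
  ultimately have "3 dvd (z - 1) div 3 + k"
    by metis
  then show ?thesis
    by (simp add: z_def)
qed

lemma coprime_if_no_common_prime:
  fixes a b :: int
  assumes "\<And>l. prime l \<Longrightarrow> l dvd a \<Longrightarrow> l dvd b \<Longrightarrow> False" "a \<noteq> 0 \<or> b \<noteq> 0"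
  shows "coprime a b"
proof (rule ccontr)
  assume "\<not> coprime a b"
  then have "\<not> is_unit (gcd a b)" "gcd a b \<noteq> 0"
    using assms(2) by (auto simp: coprime_iff_gcd_eq_1 is_unit_gcd)
  then obtain l where "prime l" "l dvd gcd a b"
    using prime_divisor_exists by blast
  then show False
    using assms(1)[of l] by simp
qed

theorem three_dvd_exponent:
  fixes x y g M' s :: int and m k :: nat
  assumes M: "M' * g ^ 2 = 4 * 27 ^ m - 1" and m: "m > 0"
    and odd: "odd x" "odd y" and s: "s = 1 \<or> s = - 1"
    and eq: "x ^ 2 - 3 * M' * y ^ 2 = s * 2 ^ (k + 2)"
  shows "3 dvd k"
proof (rule ccontr)
  assume k3: "\<not> 3 dvd k"
  then have k0: "k > 0"
    by (cases k) auto
  have "even ((4 :: int) * 27 ^ m)"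
    by simp
  then have "odd (M' * g ^ 2)"
    unfolding M by simp
  then have g2: "odd g"
    by auto
  have M9: "[M' * g ^ 2 = -1] (mod 3)"
    using m unfolding M cong_iff_dvd_diff by (cases m) auto
  have g3: "\<not> 3 dvd g"
  proof
    assume "3 dvd g"
    then have "3 dvd M' * g ^ 2"
      by (simp add: power2_eq_square)
    then show False
      using M9 cong_dvd_iff by fastforce
  qed
  \<comment> \<open>Dividing \<open>g\<close> and \<open>y\<close> by their common factor makes the
    Eisenstein integer \<beta> primitive, as \<open>cubic_jacobi_symbol\<close> demands.\<close>
  define c where "c = gcd g y"
  have c0: "c \<noteq> 0"
    using g2 by (auto simp: c_def)
  obtain g1 y1 where g1: "g = c * g1" and y1: "y = c * y1" and cop1: "coprime g1 y1"
    using gcd_coprime_exists[of g y] c0 unfolding c_def by (metis mult.commute)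
  have odd1: "odd g1" "odd y1"
    using g2 odd g1 y1 by auto
  have g13: "\<not> 3 dvd g1"
    using g3 g1 by auto
  have copxy: "coprime x y1"
  proof (rule coprimeI)
    fix l assume l: "l dvd x" "l dvd y1"
    then have "l dvd x ^ 2 - 3 * M' * y ^ 2"
      by (simp add: y1 power2_eq_square)
    then have "l dvd 2 ^ (k + 2)"
      using eq s by auto
    moreover have "coprime x 2"
      using odd(1) by simp
    then have "coprime x (2 ^ (k + 2))"
      by (simp only: coprime_power_right_iff simp_thms)
    ultimately show "is_unit l"
      using l(1) coprime_common_divisor by blast
  qed
  \<comment> \<open>Since \<surd>-3 = 1 + 2 \<omega>, the number (g1 x + y1 \<surd>-3)/2 has the
    coordinates \<open>a\<close> and \<open>y1\<close>. The division is exact because all of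
    \<open>g1\<close>, \<open>x\<close>, \<open>y1\<close> are odd.\<close>
  define a where "a = (g1 * x + y1) div 2"
  have a: "2 * a - y1 = g1 * x"
    using odd odd1 by (simp add: a_def)
  define \<beta> where "\<beta> = Eis a y1"
  define N where "N = eis_norm \<beta>"
  have N4: "4 * N = (g1 * x) ^ 2 + 3 * y1 ^ 2"
    unfolding N_def four_eis_norm by (simp add: \<beta>_def a)
  have N_eq: "N = 3 * 27 ^ m * y1 ^ 2 + g1 ^ 2 * (s * 2 ^ k)"
  proof -
    have "c ^ 2 * (4 * N) = g ^ 2 * x ^ 2 + 3 * y ^ 2"
      unfolding N4 g1 y1 by (simp add: algebra_simps power2_eq_square)
    also have "x ^ 2 = 4 * (s * 2 ^ k) + 3 * M' * y ^ 2"
      using eq by simp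
    also have "g ^ 2 * (4 * (s * 2 ^ k) + 3 * M' * y ^ 2) + 3 * y ^ 2
        = 4 * g ^ 2 * (s * 2 ^ k) + 3 * y ^ 2 * (M' * g ^ 2 + 1)"
      by (simp add: algebra_simps)
    also have "M' * g ^ 2 + 1 = 4 * 27 ^ m"
      using M by simp
    also have "4 * g ^ 2 * (s * 2 ^ k) + 3 * y ^ 2 * (4 * 27 ^ m)
        = c ^ 2 * (4 * (3 * 27 ^ m * y1 ^ 2 + g1 ^ 2 * (s * 2 ^ k)))"
      unfolding g1 y1 by (simp add: algebra_simps power2_eq_square)
    finally show ?thesis
      using c0 by simp
  qed
  have prime3: "prime (3::int)"
    by simp
  have s3: "\<not> 3 dvd s * 2 ^ k"
    using s prime_dvd_power[OF prime3, of 2 k] by auto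
  have N3: "\<not> 3 dvd N"
  proof
    assume "3 dvd N"
    then have "3 dvd N - 3 * (27 ^ m * y1 ^ 2)"
      by (intro dvd_diff) auto
    then have "3 dvd g1 ^ 2 * (s * 2 ^ k)"
      by (simp add: N_eq)
    then show False
      using g13 s3 prime3 prime_dvd_mult_iff[OF prime3] prime_dvd_power[OF prime3] by blast
  qed
  then have N0: "N \<noteq> 0"
    by auto
  have N2: "odd N"
    using odd1 k0 by (simp add: N_eq)
  have copg: "coprime g1 N"
  proof (rule coprime_if_no_common_prime)
    fix l :: int assume l: "prime l" "l dvd g1" "l dvd N"
    then have "l dvd N - g1 ^ 2 * (s * 2 ^ k)"
      by (simp add: power2_eq_square)
    then have "l dvd 3 ^ 1 * 27 ^ m * y1 ^ 2"
      by (simp add: N_eq)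
    then have "l dvd 3 \<or> l dvd 27 \<or> l dvd y1"
      using l(1) by (auto simp: prime_dvd_mult_iff dest: prime_dvd_power)
    moreover have "\<not> l dvd y1"
      using l cop1 coprime_common_divisor not_prime_unit by blast
    moreover have "\<not> l dvd 3 ^ 3" "\<not> l dvd 3"
      using l(1,3) N3 primes_dvd_imp_eq[OF l(1) prime3] prime_dvd_power[OF l(1), of 3 3] by auto
    ultimately show False
      by simp
  qed (use N0 in simp)
  have copx: "coprime x N"
  proof (rule coprime_if_no_common_prime)
    fix l :: int assume l: "prime l" "l dvd x" "l dvd N"
    then have "l dvd 4 * N - (g1 * x) ^ 2"
      by (simp add: power2_eq_square)
    then have "l dvd 3 * y1 ^ 2"
      by (simp add: N4)
    then have "l dvd 3 \<or> l dvd y1"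
      using l(1) by (auto simp: prime_dvd_mult_iff dest: prime_dvd_power)
    moreover have "\<not> l dvd y1"
      using l copxy coprime_common_divisor not_prime_unit by blast
    moreover have "\<not> l dvd 3"
      using l(1,3) N3 primes_dvd_imp_eq[OF l(1) prime3] by auto
    ultimately show False
      by simp
  qed (use N0 in simp)
  \<comment> \<open>Eliminating \<open>y1\<close> from the two formulas \<open>N4\<close> and
    \<open>N_eq\<close> leaves a multiple of g1^2, which is prime to N.\<close>
  have congN: "[s * 2 ^ k = 27 ^ m * x ^ 2] (mod N)"
  proof -
    have "g1 ^ 2 * (s * 2 ^ k - 27 ^ m * x ^ 2) = N - 27 ^ m * (4 * N)"
      unfolding N4 by (simp add: N_eq algebra_simps power2_eq_square)
    then have "N dvd g1 ^ 2 * (s * 2 ^ k - 27 ^ m * x ^ 2)"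
      by simp
    moreover have "coprime N (g1 ^ 2)"
      using copg by (simp add: coprime_commute)
    ultimately show ?thesis
      by (simp add: cong_iff_dvd_diff coprime_dvd_mult_right_iff)
  qed
  have prim: "coprime (re \<beta>) (im \<beta>)"
  proof -
    have "coprime (g1 * x) y1"
      using cop1 copxy by simp
    then have "coprime (2 * a - y1) y1"
      by (simp add: a)
    then have "coprime a y1"
      by (intro coprimeI) (metis coprime_common_divisor dvd_diff dvd_mult)
    then show ?thesis
      by (simp add: \<beta>_def)
  qed
  \<comment> \<open>W makes W \<beta> primary. The last clause records that a nontrivial W is chosen
    only when 3 does not divide \<open>y1\<close>, which the argument modulo 9 at the end relies
    on.\<close>
  obtain W where W: "W \<in> cube_units" "3 dvd im (W * \<beta>)" "W = 1 \<or> \<not> 3 dvd y1"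
  proof -
    have "N = (a + y1) ^ 2 - 3 * (a * y1)"
      by (simp add: N_def \<beta>_def eis_norm_def power2_eq_square algebra_simps)
    then have "\<not> 3 dvd (a + y1) ^ 2"
      using N3 by (auto simp: dvd_diff)
    then have "\<not> 3 dvd a + y1"
      by (auto simp: power2_eq_square)
    then have "3 dvd y1 \<or> 3 dvd a \<or> 3 dvd a - y1"
      by presburger
    then consider "3 dvd y1" | "3 dvd a" "\<not> 3 dvd y1" | "3 dvd a - y1" "\<not> 3 dvd y1"
      by blast
    then show ?thesis
    proof cases
      case 1
      then show ?thesis
        by (intro that[of 1]) (auto simp: \<beta>_def cube_units_def)
    next
      case 2
      then show ?thesis
        by (intro that[of "\<omega> ^ 2"]) (auto simp: \<beta>_def cube_units_def omega_squared)
    next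
      case 3
      then show ?thesis
        by (intro that[of "\<omega>"]) (auto simp: \<beta>_def cube_units_def)
    qed
  qed
  have W3: "W ^ 3 = 1"
    using W(1) by (rule cube_units_cube)
  have normW: "eis_norm W = 1"
    using W(1) by (auto elim!: cube_units_cases simp: eis_norm_def)
  have "W * \<beta> dvd W ^ 2 * (W * \<beta>)"
    by simp
  also have "W ^ 2 * (W * \<beta>) = \<beta>"
    using W3 by (simp add: power2_eq_square power3_eq_cube mult.assoc)
  finally have prim': "coprime (re (W * \<beta>)) (im (W * \<beta>))"
    using prim by (rule coprime_eis_dvd)
  have normWb: "eis_norm (W * \<beta>) = N"
    by (simp add: eis_norm_mult normW N_def)
  obtain G where G: "\<And>m n. G (m * n) = G m * G n"
      "\<And>m n. [m = n] (mod N) \<Longrightarrow> G m = G n"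
      "\<And>m. coprime m N \<Longrightarrow> G m \<in> cube_units"
      "\<And>q. prime q \<Longrightarrow> q \<noteq> 3 \<Longrightarrow> coprime (int q) N \<Longrightarrow>
        of_nat q dvd ((W * \<beta>) ^ 2 * cnj_eis (W * \<beta>)) ^ ((q ^ 2 - 1) div 3) - G (int q)"
    using cubic_jacobi_symbol[OF prim' W(2), unfolded normWb] by (elim exE conjE) blast
  \<comment> \<open>W contributes W^2 cnj W = W^4 = W to the base of the power in the reciprocity
    law.\<close>
  define z where "z = \<beta> ^ 2 * cnj_eis \<beta>"
  have z: "(W * \<beta>) ^ 2 * cnj_eis (W * \<beta>) = W * z"
  proof -
    have "(W * \<beta>) ^ 2 * cnj_eis (W * \<beta>) = W ^ 2 * W ^ 2 * z"
      by (simp add: z_def power_mult_distrib cnj_eis_mult cube_units_cnj[OF W(1)] mult_ac)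
    also have "W ^ 2 * W ^ 2 = W ^ 3 * W"
      by (simp add: power2_eq_square power3_eq_cube mult.assoc)
    finally show ?thesis
      by (simp add: W3)
  qed
  have G1: "G 1 = 1"
  proof -
    have "G 1 * G 1 = G 1 * 1" "G 1 \<noteq> 0"
      using G(1)[of 1 1] G(3)[of 1] cube_units_cube[of 0] by auto
    then show ?thesis
      by (metis mult_left_cancel)
  qed
  have Gpow: "G (n ^ j) = G n ^ j" for n j
    by (induction j) (simp_all add: G1 G(1))
  have Gm1: "G (- 1) = 1"
  proof -
    have "G (- 1) ^ 2 = 1"
      using Gpow[of "-1" 2] G1 by simp
    moreover have "G (- 1) ^ 3 = 1"
      using G(3)[of "-1"] cube_units_cube by simp
    moreover have "G (-1) ^ 3 = G (-1) ^ 2 * G (-1)"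
      by (simp add: power2_eq_square power3_eq_cube)
    ultimately show ?thesis
      by simp
  qed
  have x3: "\<not> 3 dvd x"
  proof
    assume "3 dvd x"
    then have "3 dvd x ^ 2 - 3 * M' * y ^ 2"
      by (simp add: power2_eq_square)
    moreover have "s * 2 ^ (k + 2) = s * 2 ^ k * 4"
      by simp
    ultimately have "3 dvd s * 2 ^ k * 4"
      using eq by metis
    then have "3 dvd s * 2 ^ k"
      by presburger
    then show False
      using s3 by blast
  qed
  have nat_abs: "q dvd nat \<bar>x\<bar> \<longleftrightarrow> int q dvd x" for q
    by (subst int_dvd_int_iff[symmetric]) simp
  have Gx: "G x = W ^ ((nat \<bar>x\<bar> ^ 2 - 1) div 3)"
  proof -
    have "G (int (nat \<bar>x\<bar>)) = W ^ ((nat \<bar>x\<bar> ^ 2 - 1) div 3)"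
    proof (rule cube_units_mult_primes[OF G(1) G1 W(1)])
      show "\<not> 3 dvd nat \<bar>x\<bar>"
        using x3 by (simp add: nat_abs)
      show "nat \<bar>x\<bar> > 0"
        using odd by auto
      fix q assume q: "prime q" "q dvd nat \<bar>x\<bar>"
      have qx: "int q dvd x"
        using q(2) by (simp only: nat_abs)
      have q3: "q \<noteq> 3" and q2: "q \<noteq> 2"
        using qx x3 odd(1) by auto
      have prime_q: "prime (int q)"
        using q(1) by simp
      have copq: "coprime (int q) N"
        using copx qx coprime_divisors dvd_refl by blast
      define e where "e = (q ^ 2 - 1) div 3"
      have q_odd: "odd q"
        using q(1) q2 prime_odd_nat prime_ge_2_nat by (metis le_neq_implies_less)
      have e3: "3 * e = (q - 1) * (q + 1)"
      proof -
        have "\<not> 3 dvd q"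
          using q(1) q3 primes_dvd_imp_eq[of 3 q] by auto
        then have "3 * e = q ^ 2 - 1"
          using square_mod_3[of q] unfolding e_def by linarith
        then show ?thesis
          by (simp add: power2_eq_square algebra_simps)
      qed
      have "even (q + 1)"
        using q_odd by simp
      then obtain j where j: "q + 1 = 2 * j"
        by (rule evenE)
      have e2: "3 * e = 2 * ((q - 1) * j)"
        using e3 unfolding j by simp
      have fermat: "of_int (int q) dvd (of_int n ^ ((q - 1) * i) - 1 :: eis)" if "\<not> int q dvd n" for n i
      proof -
        have "[(n ^ (q - 1)) ^ i = 1 ^ i] (mod int q)"
          by (intro cong_pow fermat_theorem_int q(1) that)
        then have "int q dvd n ^ ((q - 1) * i) - 1"
          by (simp add: power_mult cong_iff_dvd_diff)
        then have "of_int (int q) dvd (of_int (n ^ ((q - 1) * i)) - 1 :: eis)"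
          by (simp only: of_int_dvd_eis_iff eis_sel_simps re_of_int im_of_int) simp
        then show ?thesis
          by simp
      qed
      \<comment> \<open>\<open>u\<close> is y1 \<surd>-3. Because q divides x, 2 \<beta> is
        congruent to u and its conjugate to -u, so 8 z is congruent to the cube of -u. Its power
        with exponent e is a power of u^2 = -3 y1^2, an integer prime to q, with exponent a multiple
        of q - 1, so that Fermat's theorem gives 1.\<close>
      define u where "u = of_int y1 * (1 + 2 * \<omega>)"
      have "of_int (int q) dvd 2 * \<beta> - u" "of_int (int q) dvd cnj_eis (2 * \<beta>) - (- u)"
        using qx a unfolding of_int_dvd_eis_iff by (simp_all add: u_def \<beta>_def)
      then have "of_int (int q) dvd (2 * \<beta>) ^ 2 * cnj_eis (2 * \<beta>) - u ^ 2 * (- u)"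
        by (intro dvd_mult_diff dvd_power_diff)
      moreover have "cnj_eis 2 = 2"
        by (rule eis_eqI) auto
      then have "(2 * \<beta>) ^ 2 * cnj_eis (2 * \<beta>) = 2 ^ 3 * z"
        by (simp add: z_def cnj_eis_mult power_mult_distrib)
      moreover have "u ^ 2 * (- u) = (- u) ^ 3"
        by (simp add: power2_eq_square power3_eq_cube)
      ultimately have "of_int (int q) dvd (2 ^ 3 * z) ^ e - ((- u) ^ 3) ^ e"
        by (simp only: dvd_power_diff)
      moreover have "((- u) ^ 3) ^ e = (u ^ 2) ^ ((q - 1) * j)"
        by (simp only: power_mult[symmetric] e2) (simp add: power_mult)
      moreover have "u ^ 2 = of_int (- 3 * y1 ^ 2)"
        by (rule eis_eqI) (simp_all add: u_def power2_eq_square)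
      moreover have "\<not> int q dvd - 3 * y1 ^ 2"
      proof
        assume "int q dvd - 3 * y1 ^ 2"
        then have "int q dvd 3 * y1 ^ 2"
          by simp
        then have "int q dvd 3 \<or> int q dvd y1"
          using prime_dvd_mult_iff[OF prime_q] prime_dvd_power[OF prime_q] by blast
        moreover have "\<not> int q dvd y1"
          using prime_q qx copxy coprime_common_divisor not_prime_unit by blast
        moreover have "\<not> int q dvd int 3"
          using q(1) q3 primes_dvd_imp_eq[of q 3] unfolding int_dvd_int_iff by auto
        ultimately show False
          by simp
      qed
      ultimately have "of_int (int q) dvd (2 ^ 3 * z) ^ e - 1"
        using fermat[of "- 3 * y1 ^ 2" j] dvd_diff_trans by metis
      \<comment> \<open>The factor 8 disappears: 8^e = 2^(q^2 - 1) is 1 modulo q.\<close>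
      moreover have "\<not> q dvd 2"
        using primes_dvd_imp_eq[OF q(1), of 2] q2 by auto
      then have "\<not> int q dvd int 2"
        by (subst int_dvd_int_iff)
      then have "of_int (int q) dvd 2 ^ ((q - 1) * (q + 1)) - (1 :: eis)"
        using fermat[of 2 "q + 1"] by simp
      then have "of_int (int q) dvd (2 ^ ((q - 1) * (q + 1)) - 1) * z ^ e"
        by (rule dvd_mult2)
      then have "of_int (int q) dvd z ^ e - (2 ^ 3 * z) ^ e"
        by (subst dvd_minus_iff[symmetric])
          (simp only: power_mult_distrib power_mult[symmetric] e3 left_diff_distrib mult_1_left minus_diff_eq)
      ultimately have "of_int (int q) dvd z ^ e - 1"
        using dvd_diff_trans by blast
      then have "of_int (int q) dvd W ^ e * (z ^ e - 1)"
        by (rule dvd_mult)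
      then have "of_int (int q) dvd (W * z) ^ e - W ^ e"
        by (simp add: power_mult_distrib algebra_simps)
      moreover have "of_int (int q) dvd (W * z) ^ e - G (int q)"
        using G(4)[OF q(1) q3 copq] by (simp add: z e_def)
      ultimately have "of_int (int q) dvd G (int q) - W ^ e"
        using dvd_diff[of "of_int (int q)" "(W * z) ^ e - W ^ e" "(W * z) ^ e - G (int q)"] by simp
      then show "G (int q) = W ^ ((q ^ 2 - 1) div 3)"
        using prime_gt_1_nat[OF q(1)] G(3)[OF copq] cube_units_power[OF W(1)]
        by (intro cube_units_eqI[of _ _ "int q"]) (simp_all add: e_def)
    qed
    moreover have "G (int (nat \<bar>x\<bar>)) = G x"
      using G(1)[of "-1" x] Gm1 by (simp add: abs_if)
    ultimately show ?thesis
      by simp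
  qed
  \<comment> \<open>As N is odd, z and \<beta> agree modulo 2, and for q = 2 the exponent (q^2 -
    1)/3 is 1. So the symbol of 2 is W \<beta> reduced modulo 2.\<close>
  have "z = \<beta> * of_int N"
    unfolding N_def mult_cnj_eis[symmetric] by (simp add: z_def power2_eq_square)
  then have z\<beta>: "z - \<beta> = of_int (N - 1) * \<beta>"
    by (simp add: algebra_simps)
  have "even (N - 1)"
    using N2 by simp
  then have z2: "of_int 2 dvd z - \<beta>"
    unfolding z\<beta> of_int_dvd_eis_iff by (simp del: of_int_diff)
  \<comment> \<open>Because \<open>y1\<close> is odd, \<beta> is \<omega> or 1 + \<omega> modulo 2,
    and the latter is congruent to the cube root of unity -1 - \<omega>.\<close>
  obtain v where v: "v \<in> cube_units" "v \<noteq> 1" "of_int 2 dvd \<beta> - v"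
  proof (cases "even a")
    case True
    then have "of_int 2 dvd \<beta> - \<omega>"
      unfolding of_int_dvd_eis_iff \<beta>_def using odd1 by simp
    then show ?thesis
      by (intro that[of \<omega>]) (auto simp: cube_units_def \<omega>_def one_eis_def)
  next
    case False
    then have "of_int 2 dvd \<beta> - (- 1 - \<omega>)"
      unfolding of_int_dvd_eis_iff \<beta>_def using odd1 by simp
    moreover have "- 1 - \<omega> \<in> cube_units"
      by (simp add: cube_units_def omega_squared)
    moreover have "- 1 - \<omega> \<noteq> 1"
      by (simp add: \<omega>_def one_eis_def minus_eis_def uminus_eis_def)
    ultimately show ?thesis
      using that by blast
  qed
  have cop2: "coprime (int 2) N"
    using N2 by simp
  have G2: "G 2 = W * v"
  proof -
    have "of_int 2 dvd W * z - G 2"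
      using G(4)[of 2] cop2 by (simp add: z)
    moreover have "of_int 2 dvd W * (z - v)"
      using dvd_diff_trans[OF z2 v(3)] by (rule dvd_mult)
    ultimately have "of_int 2 dvd W * (z - v) - (W * z - G 2)"
      using dvd_diff by blast
    also have "W * (z - v) - (W * z - G 2) = G 2 - W * v"
      by (simp add: algebra_simps)
    finally have "of_int 2 dvd G 2 - W * v" .
    then show ?thesis
      using G(3)[of 2] cop2 cube_units_mult[OF W(1) v(1)]
      by (intro cube_units_eqI[of _ _ 2]) auto
  qed
  define e where "e = (nat \<bar>x\<bar> ^ 2 - 1) div 3"
  have "G (s * 2 ^ k) = G (27 ^ m * x ^ 2)"
    using congN by (rule G(2))
  moreover have "G s = 1"
    using s G1 Gm1 by auto
  \<comment> \<open>This is where n = 3m enters: 3^n is a cube.\<close>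
  moreover have "G (27 ^ m) = 1"
  proof -
    have "coprime 3 N"
      using N3 prime3 prime_imp_coprime by blast
    then have "(G 3 ^ 3) ^ m = 1"
      using G(3) cube_units_cube by simp
    moreover have "G (27 ^ m) = (G 3 ^ 3) ^ m"
      using Gpow[of "3 ^ 3" m] Gpow[of 3 3] by simp
    ultimately show ?thesis
      by simp
  qed
  ultimately have main: "(W * v) ^ k = W ^ (2 * e)"
    by (simp add: G(1) Gpow G2 Gx e_def power_mult[symmetric] mult.commute)
  have vk: "v ^ k \<noteq> 1"
  proof -
    have "k mod 3 = 1 \<or> k mod 3 = 2"
      using k3 by presburger
    then have "v ^ (k mod 3) \<noteq> 1"
      using v(1,2) by (auto elim!: cube_units_cases simp: omega_squared power2_eq_square
          \<omega>_def one_eis_def minus_eis_def uminus_eis_def times_eis_def)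
    then show ?thesis
      using cube_units_power_mod_3[OF v(1), of k] by simp
  qed
  show False
  proof (cases "W = 1")
    case True
    then show ?thesis
      using main vk by simp
  next
    case False
    then have y13: "\<not> 3 dvd y1"
      using W(3) by blast
    have sq: "[n ^ 2 = 1] (mod 3)" if "\<not> 3 dvd n" for n :: int
    proof -
      have "n mod 3 = 1 \<or> n mod 3 = 2"
        using that by presburger
      then show ?thesis
        by (auto simp: Cong.cong_def power2_eq_square mod_mult_eq[of n 3 n, symmetric])
    qed
    have y3: "\<not> 3 dvd y"
      using y13 g3 g1 prime_dvd_mult_iff[OF prime3] by (auto simp: y1)
    \<comment> \<open>Squares prime to 3 are 1 modulo 3, so M' y^2 and M' g^2 agree there, and the
      latter is -1. Hence 3 M' y^2 is 6 modulo 9. The resulting congruence for x gives e = -k modulo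
      3, so 2 e = k modulo 3, the powers of W in \<open>main\<close> cancel, and v^k = 1
      remains.\<close>
    have "[M' * y ^ 2 = M' * 1] (mod 3)"
      by (intro cong_mult cong_refl sq y3)
    also have "[M' * 1 = M' * g ^ 2] (mod 3)"
      by (intro cong_mult cong_refl cong_sym[OF sq] g3)
    also note M9
    finally have "3 dvd M' * y ^ 2 + 1"
      by (simp add: cong_iff_dvd_diff)
    then obtain w where "M' * y ^ 2 + 1 = 3 * w"
      by (elim dvdE)
    then have "x ^ 2 - (s * 2 ^ (k + 2) + 6) = 9 * (w - 1)"
      using eq by (simp add: mult.assoc)
    then have "[x ^ 2 = s * 2 ^ (k + 2) + 6] (mod 9)"
      unfolding cong_iff_dvd_diff by (rule dvdI)
    then have "3 dvd e + k"
      unfolding e_def by (rule square_mod_9_cases[OF s k3])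
    then have "(2 * e) mod 3 = k mod 3"
      by presburger
    then have "W ^ (2 * e) = W ^ k"
      using cube_units_power_mod_3[OF W(1)] by metis
    then have "W ^ k * v ^ k = W ^ k * 1"
      using main by (simp add: power_mult_distrib)
    moreover have "W ^ k \<noteq> 0"
      using W3 by auto
    ultimately show ?thesis
      using vk mult_left_cancel by blast
  qed
qed

subsection \<open>Quadratic subfields of the reals\<close>

lemma real_ring_simps [simp]:
  "carrier real_ring = UNIV" "x \<otimes>\<^bsub>real_ring\<^esub> y = x * y" "\<one>\<^bsub>real_ring\<^esub> = 1"
  "\<zero>\<^bsub>real_ring\<^esub> = 0" "x \<oplus>\<^bsub>real_ring\<^esub> y = x + y"
  by (simp_all add: ring_of_type_algebra_def)

interpretation real_ring: cring real_ring
  by (rule cring_from_type_algebra)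

lemma field_real_ring: "field real_ring"
  by (rule field_from_type_algebra)

lemma real_ring_uminus [simp]: "\<ominus>\<^bsub>real_ring\<^esub> x = - x"
  using real_ring.l_neg[of x] by (simp add: eq_neg_iff_add_eq_0)

lemma real_ring_inv [simp]: "x \<noteq> 0 \<Longrightarrow> inv\<^bsub>real_ring\<^esub> x = inverse x"
  by (rule real_ring.comm_inv_char) auto

definition quad_field :: "real \<Rightarrow> real set" where
  "quad_field \<delta> = {a + b * \<delta> | a b. a \<in> \<rat> \<and> b \<in> \<rat>}"

lemma quad_fieldI: "a \<in> \<rat> \<Longrightarrow> b \<in> \<rat> \<Longrightarrow> a + b * \<delta> \<in> quad_field \<delta>"
  by (auto simp: quad_field_def)

lemma quad_fieldE:
  assumes "x \<in> quad_field \<delta>"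
  obtains a b where "a \<in> \<rat>" "b \<in> \<rat>" "x = a + b * \<delta>"
  using assms by (auto simp: quad_field_def)

lemma quad_field_eqD:
  assumes "\<delta> \<notin> \<rat>" "a \<in> \<rat>" "b \<in> \<rat>" "a' \<in> \<rat>" "b' \<in> \<rat>" "a + b * \<delta> = a' + b' * \<delta>"
  shows "a = a' \<and> b = b'"
proof -
  have "b = b'"
  proof (rule ccontr)
    assume "b \<noteq> b'"
    then have "\<delta> = (a' - a) / (b - b')"
      using assms(6) by (simp add: field_simps)
    then show False
      using assms by (metis Rats_diff Rats_divide)
  qed
  then show ?thesis
    using assms(6) by simp
qed

lemma subfield_quad_field:
  assumes "\<delta> \<notin> \<rat>" "\<delta> ^ 2 \<in> \<rat>"
  shows "subfield (quad_field \<delta>) real_ring"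
proof (rule field.subfieldI'[OF field_real_ring])
  have mult: "x * y \<in> quad_field \<delta>" if xy: "x \<in> quad_field \<delta>" "y \<in> quad_field \<delta>" for x y
  proof -
    obtain a b where 1: "a \<in> \<rat>" "b \<in> \<rat>" "x = a + b * \<delta>"
      using xy(1) by (rule quad_fieldE)
    obtain a' b' where 2: "a' \<in> \<rat>" "b' \<in> \<rat>" "y = a' + b' * \<delta>"
      using xy(2) by (rule quad_fieldE)
    note * = 1(1,2) 2(1,2) 1(3) 2(3)
    have "x * y = (a * a' + b * b' * \<delta> ^ 2) + (a * b' + b * a') * \<delta>"
      by (simp add: * algebra_simps power2_eq_square)
    also have "\<dots> \<in> quad_field \<delta>"
      using * assms(2) by (intro quad_fieldI Rats_add Rats_mult)
    finally show ?thesis .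
  qed
  show "subring (quad_field \<delta>) real_ring"
  proof (rule real_ring.subringI)
    show "\<one>\<^bsub>real_ring\<^esub> \<in> quad_field \<delta>"
      using quad_fieldI[of 1 0 \<delta>] by simp
  next
    fix h assume "h \<in> quad_field \<delta>"
    then obtain a b where "a \<in> \<rat>" "b \<in> \<rat>" "h = a + b * \<delta>"
      by (auto simp: quad_field_def)
    then show "\<ominus>\<^bsub>real_ring\<^esub> h \<in> quad_field \<delta>"
      using quad_fieldI[of "- a" "- b" \<delta>] by simp
  next
    fix x y assume xy: "x \<in> quad_field \<delta>" "y \<in> quad_field \<delta>"
    obtain a b where 1: "a \<in> \<rat>" "b \<in> \<rat>" "x = a + b * \<delta>"
      using xy(1) by (rule quad_fieldE)
    obtain a' b' where 2: "a' \<in> \<rat>" "b' \<in> \<rat>" "y = a' + b' * \<delta>"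
      using xy(2) by (rule quad_fieldE)
    show "x \<oplus>\<^bsub>real_ring\<^esub> y \<in> quad_field \<delta>"
      using quad_fieldI[of "a + a'" "b + b'" \<delta>] 1 2 by (simp add: algebra_simps)
  qed (use mult in auto)
  fix x assume "x \<in> quad_field \<delta> - {\<zero>\<^bsub>real_ring\<^esub>}"
  then obtain a b where *: "a \<in> \<rat>" "b \<in> \<rat>" "x = a + b * \<delta>" and x0: "x \<noteq> 0"
    by (auto simp: quad_field_def)
  have "a - b * \<delta> \<noteq> 0"
    using quad_field_eqD[OF assms(1) *(1), of "- b" 0 0] * x0 by auto
  moreover have "a ^ 2 - b ^ 2 * \<delta> ^ 2 = x * (a - b * \<delta>)"
    by (simp add: * algebra_simps power2_eq_square)
  ultimately have n: "a ^ 2 - b ^ 2 * \<delta> ^ 2 \<noteq> 0" "inverse x = (a - b * \<delta>) / (a ^ 2 - b ^ 2 * \<delta> ^ 2)"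
    using x0 by (auto simp: field_simps)
  have "inverse x = a / (a ^ 2 - b ^ 2 * \<delta> ^ 2) + (- b / (a ^ 2 - b ^ 2 * \<delta> ^ 2)) * \<delta>"
    unfolding n(2) by (simp add: diff_divide_distrib)
  also have "\<dots> \<in> quad_field \<delta>"
    using * assms(2) by (intro quad_fieldI Rats_divide Rats_diff Rats_mult) auto
  finally show "inv\<^bsub>real_ring\<^esub> x \<in> quad_field \<delta>"
    using x0 by simp
qed

lemma rats_subset_subfield:
  assumes "subfield L real_ring"
  shows "\<rat> \<subseteq> L"
proof -
  note sub = subfieldE(1)[OF assms]
  have nat: "of_nat n \<in> L" for n
    using subringE(2,3,7)[OF sub] real_ring.zero_closed
    by (induction n) (auto intro: subringE(2)[OF sub, simplified] subringE(7)[OF sub, simplified] subringE(3)[OF sub, simplified])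
  have int: "of_int i \<in> L" for i
  proof (cases i rule: int_cases2)
    case (nonpos n)
    then show ?thesis
      using subringE(5)[OF sub nat[of n]] by simp
  qed (use nat in simp)
  show ?thesis
  proof
    fix x :: real assume "x \<in> \<rat>"
    then obtain i j where x: "x = of_int i / of_int j" "j > 0"
      by (rule Rats_cases')
    have "inv\<^bsub>real_ring\<^esub> (of_int j) \<in> L"
      using x(2) int[of j] real_ring.subfield_m_inv(1)[OF assms] by simp
    then have "of_int i * inverse (of_int j) \<in> L"
      using x(2) int[of i] subringE(6)[OF sub] by fastforce
    then show "x \<in> L"
      by (simp add: x divide_inverse)
  qed
qed

text \<open>The rational factor \<open>g\<close> will be the square root of the square part of the
  radicand.\<close>

lemma generate_field_eq_quad_field:
  assumes "\<delta> \<notin> \<rat>" "\<delta> ^ 2 \<in> \<rat>" "g \<in> \<rat>" "g \<noteq> 0"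
  shows "generate_field real_ring {g * \<delta>} = quad_field \<delta>"
proof (rule field.generate_fieldI[OF field_real_ring, symmetric])
  show "subfield (quad_field \<delta>) real_ring"
    using assms by (intro subfield_quad_field)
  show "{g * \<delta>} \<subseteq> quad_field \<delta>"
    using quad_fieldI[of 0 g \<delta>] assms by simp
  fix L assume L: "subfield L real_ring" "{g * \<delta>} \<subseteq> L"
  note sub = subfieldE(1)[OF L(1)]
  show "quad_field \<delta> \<subseteq> L"
  proof
    fix x assume "x \<in> quad_field \<delta>"
    then obtain a b where *: "a \<in> \<rat>" "b \<in> \<rat>" "x = a + b * \<delta>"
      by (auto simp: quad_field_def)
    have "a \<in> L" "b / g \<in> L"
      using * assms rats_subset_subfield[OF L(1)] by (auto intro: Rats_divide)
    then have "a + (b / g) * (g * \<delta>) \<in> L"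
      using subringE(6)[OF sub, of "b / g" "g * \<delta>"] subringE(7)[OF sub] L(2) by auto
    then show "x \<in> L"
      using assms(4) by (simp add: *)
  qed
qed auto

lemma real_quadratic_quad_field:
  assumes "\<delta> \<notin> \<rat>" "\<delta> ^ 2 \<in> \<rat>"
  shows "real_quadratic_field (quad_field \<delta>)"
  unfolding real_quadratic_field_def
proof
  show "subfield (quad_field \<delta>) real_ring"
    using assms by (rule subfield_quad_field)
  have rats: "subfield \<rat> real_ring"
  proof (rule field.subfieldI'[OF field_real_ring])
    show "subring \<rat> real_ring"
      by (rule real_ring.subringI) auto
  qed auto
  have "real_ring.dimension (Suc 1) \<rat> (real_ring.line_extension \<rat> \<delta> \<rat>)"
    using assms real_ring.dimension_one[OF rats] by (intro real_ring.Suc_dim) auto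
  moreover have "real_ring.line_extension \<rat> \<delta> \<rat> = quad_field \<delta>"
  proof (intro equalityI subsetI)
    fix x assume "x \<in> real_ring.line_extension \<rat> \<delta> \<rat>"
    then obtain k v where "k \<in> \<rat>" "v \<in> \<rat>" "x = k * \<delta> + v"
      by (auto simp: real_ring.line_extension_mem_iff)
    then show "x \<in> quad_field \<delta>"
      using quad_fieldI[of v k \<delta>] by (simp add: add.commute)
  next
    fix x assume "x \<in> quad_field \<delta>"
    then obtain a b where "a \<in> \<rat>" "b \<in> \<rat>" "x = a + b * \<delta>"
      by (rule quad_fieldE)
    then show "x \<in> real_ring.line_extension \<rat> \<delta> \<rat>"
      unfolding real_ring.line_extension_mem_iff
      by (intro bexI[where x = b] bexI[where x = a]) (simp_all add: add.commute)
  qed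
  ultimately show "real_ring.dimension 2 \<rat> (quad_field \<delta>)"
    by (simp add: numeral_2_eq_2)
qed

section \<open>Algebraic integers of a quadratic field\<close>

lemma quadratic_algebraic_int:
  fixes x :: real and s t :: int
  assumes "x ^ 2 = of_int s * x + of_int t"
  shows "algebraic_int x"
proof (rule algebraic_int.intros)
  show "poly [:- of_int t, - of_int s, 1:] x = 0"
    using assms by (simp add: algebra_simps power2_eq_square)
  show "lead_coeff [:- of_int t, - of_int s, 1 :: real:] = 1"
    by simp
  show "\<forall>i. coeff [:- of_int t, - of_int s, 1 :: real:] i \<in> \<int>"
    by (auto simp: coeff_pCons split: nat.split)
qed

text \<open>If b is the reduced denominator of r, then b^n divides N for every n, which for b \<ge>
  2 fails at n = N.\<close>

lemma Ints_if_bounded_denominators: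
  fixes r :: real
  assumes "r \<in> \<rat>" "N > 0" "\<And>n. of_nat N * r ^ n \<in> \<int>"
  shows "r \<in> \<int>"
proof -
  obtain a b where r: "r = of_int a / of_int b" "b > 0" "coprime a b"
    using assms(1) by (rule Rats_cases')
  have "b ^ n dvd int N" for n
  proof -
    obtain i where "of_nat N * r ^ n = of_int i"
      using assms(3)[of n] by (rule Ints_cases)
    then have "real_of_int (int N * a ^ n) = real_of_int (i * b ^ n)"
      using r(2) by (simp add: r(1) power_divide field_simps)
    then have "int N * a ^ n = i * b ^ n"
      by (subst (asm) of_int_eq_iff)
    then have "b ^ n dvd int N * a ^ n"
      by simp
    moreover have "coprime (b ^ n) (a ^ n)"
      using r(3) by (simp add: coprime_commute)
    ultimately show ?thesis
      by (simp add: coprime_dvd_mult_left_iff)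
  qed
  then have le: "b ^ n \<le> int N" for n
    using assms(2) by (intro zdvd_imp_le) auto
  have "b = 1"
  proof (rule ccontr)
    assume "b \<noteq> 1"
    then have "b \<ge> 2"
      using r(2) by simp
    then have "(2::int) ^ N \<le> b ^ N"
      by (intro power_mono) auto
    also have "\<dots> \<le> int N"
      by (rule le)
    also have "\<dots> < int (2 ^ N)"
      by (subst of_nat_less_iff) simp
    finally show False
      by simp
  qed
  then show ?thesis
    by (simp add: r)
qed

definition zlattice :: "real \<Rightarrow> real set" where
  "zlattice \<delta> = {of_int u + of_int v * \<delta> | u v. True}"

lemma zlatticeI: "of_int u + of_int v * \<delta> \<in> zlattice \<delta>"
  by (auto simp: zlattice_def)

lemma zlattice_add: "x \<in> zlattice \<delta> \<Longrightarrow> y \<in> zlattice \<delta> \<Longrightarrow> x + y \<in> zlattice \<delta>"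
proof -
  assume "x \<in> zlattice \<delta>" "y \<in> zlattice \<delta>"
  then obtain u v u' v' where "x = of_int u + of_int v * \<delta>" "y = of_int u' + of_int v' * \<delta>"
    by (auto simp: zlattice_def)
  then show ?thesis
    using zlatticeI[of "u + u'" "v + v'" \<delta>] by (simp add: algebra_simps)
qed

lemma zlattice_scale: "x \<in> zlattice \<delta> \<Longrightarrow> of_int n * x \<in> zlattice \<delta>"
proof -
  assume "x \<in> zlattice \<delta>"
  then obtain u v where "x = of_int u + of_int v * \<delta>"
    by (auto simp: zlattice_def)
  then show ?thesis
    using zlatticeI[of "n * u" "n * v" \<delta>] by (simp add: algebra_simps)
qed

lemma zlattice_sum: "(\<And>i. i \<in> A \<Longrightarrow> f i \<in> zlattice \<delta>) \<Longrightarrow> sum f A \<in> zlattice \<delta>"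
  by (induction A rule: infinite_finite_induct) (auto intro: zlattice_add simp: zlatticeI[of 0 0 \<delta>, simplified])

lemma quad_field_multiple_in_zlattice:
  assumes "x \<in> quad_field \<delta>"
  obtains N :: nat where "N > 0" "of_nat N * x \<in> zlattice \<delta>"
proof -
  obtain a b where ab: "a \<in> \<rat>" "b \<in> \<rat>" "x = a + b * \<delta>"
    using assms by (auto simp: quad_field_def)
  obtain i j where a: "a = of_int i / of_int j" "j > 0"
    using ab(1) by (rule Rats_cases')
  obtain k l where b: "b = of_int k / of_int l" "l > 0"
    using ab(2) by (rule Rats_cases')
  have "of_nat (nat (j * l)) = real_of_int (j * l)"
    using a(2) b(2) by simp
  then have "of_nat (nat (j * l)) * x = of_int (i * l) + of_int (k * j) * \<delta>"
    using a(2) b(2) by (simp add: ab(3) a(1) b(1) field_simps)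
  then have "of_nat (nat (j * l)) * x \<in> zlattice \<delta>"
    by (simp only: zlatticeI)
  moreover have "nat (j * l) > 0"
    using a(2) b(2) by simp
  ultimately show ?thesis
    by (rule that[rotated])
qed

text \<open>The monic equation expresses x^n with n \<ge> m by lower powers with integer
  coefficients, so a common denominator of the first m powers serves for all. This gives integrality
  of norms without minimal polynomials or conjugates of algebraic integers.\<close>

lemma algebraic_int_bounded_denominators:
  assumes "\<delta> \<notin> \<rat>" "\<delta> ^ 2 \<in> \<rat>" "x \<in> quad_field \<delta>" "algebraic_int x"
  obtains N :: nat where "N > 0" "\<And>n. of_nat N * x ^ n \<in> zlattice \<delta>"
proof -
  obtain p where p: "lead_coeff p = 1" "\<And>i. coeff p i \<in> \<int>" "poly p x = 0"
    using assms(4) by (auto elim: algebraic_int.cases)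
  define m where "m = degree p"
  have sub: "subring (quad_field \<delta>) real_ring"
    using subfield_quad_field[OF assms(1,2)] by (rule subfieldE(1))
  have pow: "x ^ i \<in> quad_field \<delta>" for i
  proof (induction i)
    case 0
    then show ?case
      using quad_fieldI[of 1 0 \<delta>] by simp
  next
    case (Suc i)
    then show ?case
      using subringE(6)[OF sub assms(3)] by simp
  qed
  have "\<forall>i. \<exists>N>0. of_nat N * x ^ i \<in> zlattice \<delta>"
    using pow quad_field_multiple_in_zlattice by metis
  then obtain N' where N': "\<And>i. N' i > (0::nat)" "\<And>i. of_nat (N' i) * x ^ i \<in> zlattice \<delta>"
    by metis
  define N where "N = (\<Prod>i<m. N' i)"
  have xm: "x ^ m = - (\<Sum>i<m. coeff p i * x ^ i)"
    using p(1,3) by (simp add: poly_altdef m_def lessThan_Suc_atMost[symmetric])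
  have "of_nat N * x ^ n \<in> zlattice \<delta>" for n
  proof (induction n rule: less_induct)
    case (less n)
    show ?case
    proof (cases "n < m")
      case True
      have "N = N' n * prod N' ({..<m} - {n})"
        unfolding N_def using True by (subst prod.remove[of _ n]) auto
      then have "of_nat N * x ^ n = of_int (int (prod N' ({..<m} - {n}))) * (of_nat (N' n) * x ^ n)"
        by simp
      then show ?thesis
        using zlattice_scale N'(2) by metis
    next
      case False
      have "x ^ n = x ^ (n - m) * x ^ m"
        using False by (simp flip: power_add)
      then have "of_nat N * x ^ n = (\<Sum>i<m. - coeff p i * (of_nat N * x ^ (n - m + i)))"
        unfolding xm by (simp add: sum_distrib_left power_add mult_ac sum_negf)
      also have "\<dots> \<in> zlattice \<delta>"
      proof (rule zlattice_sum)
        fix i assume i: "i \<in> {..<m}"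
        obtain c where "coeff p i = of_int c"
          using p(2) by (rule Ints_cases)
        then have c: "- coeff p i = of_int (- c)"
          by simp
        show "- coeff p i * (of_nat N * x ^ (n - m + i)) \<in> zlattice \<delta>"
          unfolding c using i False by (intro zlattice_scale less.IH) auto
      qed
      finally show ?thesis .
    qed
  qed
  moreover have "N > 0"
    unfolding N_def using N'(1) by (intro prod_pos) auto
  ultimately show ?thesis
    using that by blast
qed

text \<open>Norms are multiplicative, so N^2 times the n-th power of the norm is the norm of N (a +
  b \<delta>)^n, an integer of the form u^2 - D v^2. Bounded denominators force the rational norm to
  be an integer.\<close>

lemma quad_norm_in_Ints:
  assumes "\<delta> \<notin> \<rat>" "\<delta> ^ 2 = of_int D" "a \<in> \<rat>" "b \<in> \<rat>" "N > 0"
    and lat: "\<And>n. of_nat N * (a + b * \<delta>) ^ n \<in> zlattice \<delta>"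
  shows "a ^ 2 - of_int D * b ^ 2 \<in> \<int>"
proof (rule Ints_if_bounded_denominators)
  show "a ^ 2 - of_int D * b ^ 2 \<in> \<rat>"
    using assms(3,4) by auto
  show "N ^ 2 > 0"
    using assms(5) by simp
  fix n
  have "\<exists>A\<in>\<rat>. \<exists>B\<in>\<rat>. (a + b * \<delta>) ^ n = A + B * \<delta> \<and> (a ^ 2 - of_int D * b ^ 2) ^ n = A ^ 2 - of_int D * B ^ 2"
  proof (induction n)
    case (Suc n)
    then obtain A B where AB: "A \<in> \<rat>" "B \<in> \<rat>" "(a + b * \<delta>) ^ n = A + B * \<delta>"
      "(a ^ 2 - of_int D * b ^ 2) ^ n = A ^ 2 - of_int D * B ^ 2"
      by blast
    have "(a + b * \<delta>) ^ Suc n = (a + b * \<delta>) * (A + B * \<delta>)"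
      by (simp add: AB(3))
    also have "\<dots> = a * A + b * B * \<delta> ^ 2 + (a * B + b * A) * \<delta>"
      by (simp add: algebra_simps power2_eq_square)
    finally have "(a + b * \<delta>) ^ Suc n = a * A + b * B * \<delta> ^ 2 + (a * B + b * A) * \<delta>" .
    then have "(a + b * \<delta>) ^ Suc n = (a * A + b * B * of_int D) + (a * B + b * A) * \<delta>"
      by (simp add: assms(2))
    moreover have "(a ^ 2 - of_int D * b ^ 2) ^ Suc n = (a ^ 2 - of_int D * b ^ 2) * (A ^ 2 - of_int D * B ^ 2)"
      by (simp add: AB(4))
    then have "(a ^ 2 - of_int D * b ^ 2) ^ Suc n = (a * A + b * B * of_int D) ^ 2 - of_int D * (a * B + b * A) ^ 2"
      by (simp add: algebra_simps power2_eq_square)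
    moreover have "a * A + b * B * of_int D \<in> \<rat>" "a * B + b * A \<in> \<rat>"
      using assms(3,4) AB(1,2) by auto
    ultimately show ?case
      by blast
  next
    case 0
    show ?case
      by (rule bexI[where x = 1], rule bexI[where x = 0]) auto
  qed
  then obtain A B where AB: "A \<in> \<rat>" "B \<in> \<rat>" "(a + b * \<delta>) ^ n = A + B * \<delta>"
      "(a ^ 2 - of_int D * b ^ 2) ^ n = A ^ 2 - of_int D * B ^ 2"
    by blast
  obtain u v where "of_nat N * (a + b * \<delta>) ^ n = of_int u + of_int v * \<delta>"
    using lat[of n] by (auto simp: zlattice_def)
  then have "of_nat N * A + of_nat N * B * \<delta> = of_int u + of_int v * \<delta>"
    by (simp only: AB(3) distrib_left mult.assoc)
  then have "of_nat N * A = of_int u \<and> of_nat N * B = of_int v"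
    using assms(1) AB(1,2) by (intro quad_field_eqD) auto
  then have "of_nat (N ^ 2) * (a ^ 2 - of_int D * b ^ 2) ^ n = of_int (u ^ 2 - D * v ^ 2)"
    unfolding AB(4) by (simp add: algebra_simps power_mult_distrib[symmetric])
  then show "of_nat (N ^ 2) * (a ^ 2 - of_int D * b ^ 2) ^ n \<in> \<int>"
    by simp
qed

text \<open>The trace 2a is an integer because it is the difference of the norms of x + 1 and x,
  less 1. Then D (2b)^2 is an integer, so 2b is one since D is squarefree, and 2a and 2b have the
  same parity since D is odd.\<close>

lemma quad_algebraic_int_cases:
  fixes D :: int and \<delta> :: real
  assumes D: "squarefree D" "D mod 4 = 1" and \<delta>: "\<delta> \<notin> \<rat>" "\<delta> ^ 2 = of_int D"
    and x: "x \<in> quad_field \<delta>" "algebraic_int x"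
  obtains u v :: int where "x = of_int u + of_int v * ((1 + \<delta>) / 2)"
proof -
  obtain a b where ab: "a \<in> \<rat>" "b \<in> \<rat>" "x = a + b * \<delta>"
    using x by (auto simp: quad_field_def)
  obtain N where N: "N > 0" "\<And>n. of_nat N * x ^ n \<in> zlattice \<delta>"
    using algebraic_int_bounded_denominators[OF \<delta>(1) _ x] \<delta>(2) by auto
  have n0: "a ^ 2 - of_int D * b ^ 2 \<in> \<int>"
    using N ab \<delta> by (intro quad_norm_in_Ints[of \<delta> D a b N]) auto
  have "of_nat N * (x + 1) ^ n \<in> zlattice \<delta>" for n
  proof -
    have "of_nat N * (x + 1) ^ n = (\<Sum>k\<le>n. of_int (int (n choose k)) * (of_nat N * x ^ k))"
      by (subst binomial_ring) (simp add: sum_distrib_left mult_ac)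
    also have "\<dots> \<in> zlattice \<delta>"
      by (intro zlattice_sum zlattice_scale N(2))
    finally show ?thesis .
  qed
  moreover have "x + 1 = (a + 1) + b * \<delta>"
    by (simp add: ab)
  ultimately have n1: "(a + 1) ^ 2 - of_int D * b ^ 2 \<in> \<int>"
    using N(1) ab(1,2) \<delta> by (intro quad_norm_in_Ints[of \<delta> D _ _ N]) auto
  have "2 * a = ((a + 1) ^ 2 - of_int D * b ^ 2) - (a ^ 2 - of_int D * b ^ 2) - 1"
    by (simp add: power2_eq_square algebra_simps)
  then have "2 * a \<in> \<int>"
    using n0 n1 by (metis Ints_1 Ints_diff)
  then obtain A where A: "2 * a = of_int A"
    by (rule Ints_cases)
  obtain B where B: "a ^ 2 - of_int D * b ^ 2 = of_int B"
    using n0 by (rule Ints_cases)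
  obtain s t where st: "2 * b = of_int s / of_int t" "t > 0" "coprime s t"
  proof -
    have "2 * b \<in> \<rat>"
      using ab(2) by simp
    then show ?thesis
      using that by (metis Rats_cases')
  qed
  have "of_int D * (2 * b) ^ 2 = (2 * a) ^ 2 - 4 * (a ^ 2 - of_int D * b ^ 2)"
    by (simp add: algebra_simps power2_eq_square)
  also have "\<dots> = of_int (A ^ 2 - 4 * B)"
    by (simp add: A B)
  finally have "of_int D * (of_int s / of_int t) ^ 2 = real_of_int (A ^ 2 - 4 * B)"
    by (simp only: st(1))
  then have "of_int D * of_int s ^ 2 = real_of_int (A ^ 2 - 4 * B) * of_int t ^ 2"
    using st(2) by (simp add: power_divide divide_eq_eq)
  then have "real_of_int (D * s ^ 2) = real_of_int ((A ^ 2 - 4 * B) * t ^ 2)"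
    by simp
  then have Ds: "D * s ^ 2 = (A ^ 2 - 4 * B) * t ^ 2"
    by (subst (asm) of_int_eq_iff)
  then have "t ^ 2 dvd D * s ^ 2"
    by simp
  moreover have "coprime (t ^ 2) (s ^ 2)"
    using st(3) by (simp add: coprime_commute)
  ultimately have "t ^ 2 dvd D"
    by (simp add: coprime_dvd_mult_left_iff)
  then have "is_unit t"
    by (rule squarefreeD[OF D(1)])
  then have t: "t = 1"
    using st(2) by simp
  have "even (A - s)"
  proof -
    have "odd D"
      using D(2) by presburger
    then have "even (D * s ^ 2) \<longleftrightarrow> even s"
      by simp
    moreover have "even (D * s ^ 2) \<longleftrightarrow> even A"
      unfolding Ds t by simp
    ultimately show ?thesis
      by simp
  qed
  then obtain u where u: "A - s = 2 * u"
    by (elim evenE)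
  have "2 * x = of_int A + of_int s * \<delta>"
    using A st(1) by (simp add: ab(3) t algebra_simps)
  also have "of_int A = real_of_int s + 2 * of_int u"
    using u by (metis add.commute diff_add_cancel of_int_add of_int_mult of_int_numeral)
  finally have "x = of_int u + of_int s * ((1 + \<delta>) / 2)"
    by (simp add: field_simps)
  then show ?thesis
    by (rule that)
qed

lemma sqrt_squarefree_irrational:
  assumes "squarefree D" "D > (1::int)"
  shows "sqrt (of_int D) \<notin> \<rat>"
proof
  assume "sqrt (of_int D) \<in> \<rat>"
  moreover have "algebraic_int (sqrt (of_int D))"
    by (intro algebraic_int_sqrt) (simp add: int_imp_algebraic_int)
  ultimately have "sqrt (of_int D) \<in> \<int>"
    by (rule rational_algebraic_int_is_int[rotated])
  then obtain n where "sqrt (of_int D) = of_int n"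
    by (rule Ints_cases)
  then have "real_of_int D = of_int (n ^ 2)"
    using assms(2) by (metis of_int_0_le_iff of_int_power real_sqrt_pow2 less_imp_le order_trans zero_le_one)
  then have D: "D = n ^ 2"
    by (subst (asm) of_int_eq_iff)
  then have "is_unit n"
    using assms(1) by (intro squarefreeD[of D]) auto
  then have "n = 1 \<or> n = - 1"
    by auto
  then show False
    using assms(2) D by auto
qed

subsection \<open>Ideals of the maximal order\<close>

text \<open>\<open>c\<close> is the constant in w^2 = w + c for w = (1 + \<surd>D)/2, which together
  with 1 is an integral basis.\<close>

locale quad_order =
  fixes D c :: int
  assumes D_eq: "D = 4 * c + 1" and squarefree_D: "squarefree D" and D_gt_1: "D > 1"
begin

definition w :: real where
  "w = (1 + sqrt (of_int D)) / 2"

definition el :: "int \<Rightarrow> int \<Rightarrow> real" where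
  "el a b = of_int a + of_int b * w"

abbreviation R :: "real ring" where
  "R \<equiv> ring_of_integers (quad_field (sqrt (of_int D)))"

lemma sqrt_D: "sqrt (of_int D) \<notin> \<rat>" "sqrt (of_int D) ^ 2 = of_int D"
  using sqrt_squarefree_irrational[OF squarefree_D D_gt_1] D_gt_1 by simp_all

lemma w_squared: "w * w = w + of_int c"
proof -
  have "w * w = (1 + 2 * sqrt (of_int D) + sqrt (of_int D) ^ 2) / 4"
    by (simp add: w_def field_simps power2_eq_square)
  also have "sqrt (of_int D) ^ 2 = 4 * of_int c + 1"
    unfolding sqrt_D(2) by (subst D_eq) simp
  also have "(1 + 2 * sqrt (of_int D) + (4 * of_int c + 1)) / 4 = w + of_int c"
    by (simp add: w_def field_simps)
  finally show ?thesis .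
qed

lemma el_sqrt: "el a b = (of_int a + of_int b / 2) + (of_int b / 2) * sqrt (of_int D)"
  unfolding el_def w_def by (simp add: algebra_simps add_divide_distrib)

lemma el_eq_iff: "el a b = el a' b' \<longleftrightarrow> a = a' \<and> b = b'"
proof
  assume "el a b = el a' b'"
  then have *: "of_int a + of_int b / 2 = of_int a' + real_of_int b' / 2 \<and> of_int b / 2 = real_of_int b' / 2"
    unfolding el_sqrt using sqrt_D(1) by (intro quad_field_eqD[of "sqrt (of_int D)"]) auto
  then show "a = a' \<and> b = b'"
    by simp
qed simp

lemma el_add: "el a b + el a' b' = el (a + a') (b + b')"
  by (simp add: el_def algebra_simps)

lemma el_diff: "el a b - el a' b' = el (a - a') (b - b')"
  by (simp add: el_def algebra_simps)

lemma el_mult: "el a b * el a' b' = el (a * a' + c * b * b') (a * b' + b * a' + b * b')"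
proof -
  have "el a b * el a' b' = of_int (a * a') + of_int (a * b' + b * a') * w + of_int (b * b') * (w * w)"
    by (simp add: el_def algebra_simps)
  then show ?thesis
    unfolding w_squared by (simp add: el_def algebra_simps)
qed

lemma of_int_el: "of_int n = el n 0"
  by (simp add: el_def)

lemma el_0_iff: "el a b = 0 \<longleftrightarrow> a = 0 \<and> b = 0"
  using el_eq_iff[of a b 0 0] by (simp add: el_def)

definition nrm :: "int \<Rightarrow> int \<Rightarrow> int" where
  "nrm a b = a * a + a * b - c * b * b"

text \<open>The conjugate of w is 1 - w, so \<open>el (a + b) (- b)\<close> is the conjugate of
  \<open>el a b\<close>; it is written in this form throughout.\<close>

lemma el_conj: "el a b * el (a + b) (- b) = of_int (nrm a b)"
  unfolding el_mult of_int_el el_eq_iff nrm_def by (simp add: algebra_simps)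

lemma nrm_mult: "nrm (a * a' + c * b * b') (a * b' + b * a' + b * b') = nrm a b * nrm a' b'"
  by (simp add: nrm_def algebra_simps)

lemma nrm_eq_0_iff: "nrm a b = 0 \<longleftrightarrow> a = 0 \<and> b = 0"
proof
  assume "nrm a b = 0"
  then have "el a b = 0 \<or> el (a + b) (- b) = 0"
    using el_conj[of a b] by simp
  then show "a = 0 \<and> b = 0"
    by (auto simp: el_0_iff)
qed (simp add: nrm_def)

lemma carrier_R: "carrier R = {el a b | a b. True}"
proof (intro equalityI subsetI)
  fix x assume "x \<in> carrier R"
  then have x: "x \<in> quad_field (sqrt (of_int D))" "algebraic_int x"
    by (simp_all add: ring_of_integers_def)
  have "D mod 4 = 1"
    using D_eq by simp
  then obtain u v where "x = of_int u + of_int v * ((1 + sqrt (of_int D)) / 2)"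
    using quad_algebraic_int_cases[OF squarefree_D _ sqrt_D x] by blast
  then show "x \<in> {el a b | a b. True}"
    by (auto simp: el_def w_def)
next
  fix x assume "x \<in> {el a b | a b. True}"
  then obtain a b where x: "x = el a b"
    by blast
  have "x = (of_int a + of_int b / 2) + (of_int b / 2) * sqrt (of_int D)"
    unfolding x by (rule el_sqrt)
  also have "\<dots> \<in> quad_field (sqrt (of_int D))"
    by (intro quad_fieldI) auto
  finally have "x \<in> quad_field (sqrt (of_int D))" .
  moreover have "x ^ 2 = of_int (2 * a + b) * x + of_int (- nrm a b)"
    unfolding x power2_eq_square el_mult of_int_el el_add el_eq_iff by (simp add: nrm_def algebra_simps)
  then have "algebraic_int x"
    by (rule quadratic_algebraic_int)
  ultimately show "x \<in> carrier R"
    by (simp add: ring_of_integers_def)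
qed

lemma el_in_carrier [simp]: "el a b \<in> carrier R"
  by (auto simp: carrier_R)

lemma carrier_cases:
  assumes "x \<in> carrier R"
  obtains a b where "x = el a b"
  using assms by (auto simp: carrier_R)

lemma R_simps [simp]:
  "x \<otimes>\<^bsub>R\<^esub> y = x * y" "x \<oplus>\<^bsub>R\<^esub> y = x + y" "\<zero>\<^bsub>R\<^esub> = 0" "\<one>\<^bsub>R\<^esub> = 1"
  by (simp_all add: ring_of_integers_def)

lemma carrier_closed:
  assumes "x \<in> carrier R" "y \<in> carrier R"
  shows "x + y \<in> carrier R" "x * y \<in> carrier R" "- x \<in> carrier R"
proof -
  obtain a b a' b' where "x = el a b" "y = el a' b'"
    using assms carrier_cases by metis
  moreover have "- el a b = el (- a) (- b)"
    by (simp add: el_def)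
  ultimately show "x + y \<in> carrier R" "x * y \<in> carrier R" "- x \<in> carrier R"
    by (simp_all add: el_add el_mult)
qed

lemma of_int_in_carrier [simp]: "of_int n \<in> carrier R" "0 \<in> carrier R" "1 \<in> carrier R"
  using el_in_carrier[of n 0] el_in_carrier[of 0 0] el_in_carrier[of 1 0]
  by (simp_all add: el_def del: el_in_carrier)

lemma domain_R: "domain R"
proof -
  have "cring R"
  proof (rule cringI)
    show "abelian_group R"
      by (rule abelian_groupI) (auto simp: carrier_closed intro: bexI[of _ "- x" for x])
    show "comm_monoid R"
      by (rule comm_monoidI) (auto simp: carrier_closed)
  qed (simp add: distrib_right)
  then show ?thesis
    by (intro domain.intro domain_axioms.intro) auto
qed

sublocale R: domain R
  by (rule domain_R)

lemma ideal_I: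
  assumes "I \<subseteq> carrier R" "0 \<in> I" "\<And>x y. x \<in> I \<Longrightarrow> y \<in> I \<Longrightarrow> x + y \<in> I"
    "\<And>x y. x \<in> carrier R \<Longrightarrow> y \<in> I \<Longrightarrow> x * y \<in> I"
  shows "ideal I R"
proof (rule idealI)
  show "ring R"
    by (rule R.ring_axioms)
  show "subgroup I (add_monoid R)"
  proof (rule R.add.subgroupI)
    fix a assume a: "a \<in> I"
    have "- 1 * a \<in> I"
      using carrier_closed(3)[of 1 1] a by (intro assms(4)) auto
    moreover have "\<ominus>\<^bsub>R\<^esub> a = - a"
      using a assms(1) carrier_closed(3) by (intro R.minus_equality) auto
    ultimately show "\<ominus>\<^bsub>R\<^esub> a \<in> I"
      by simp
  qed (use assms in auto)
next
  fix a x assume "a \<in> I" "x \<in> carrier R"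
  then show "x \<otimes>\<^bsub>R\<^esub> a \<in> I" "a \<otimes>\<^bsub>R\<^esub> x \<in> I"
    using assms(4)[of x a] by (simp_all add: mult.commute)
qed

lemma ideal_D:
  assumes "ideal I R"
  shows "I \<subseteq> carrier R" "0 \<in> I" "\<And>x y. x \<in> I \<Longrightarrow> y \<in> I \<Longrightarrow> x + y \<in> I"
    "\<And>x y. x \<in> carrier R \<Longrightarrow> y \<in> I \<Longrightarrow> x * y \<in> I" "\<And>x y. x \<in> I \<Longrightarrow> y \<in> I \<Longrightarrow> x - y \<in> I"
proof -
  interpret ideal I R by fact
  show 1: "I \<subseteq> carrier R" "0 \<in> I" "\<And>x y. x \<in> I \<Longrightarrow> y \<in> I \<Longrightarrow> x + y \<in> I"
    "\<And>x y. x \<in> carrier R \<Longrightarrow> y \<in> I \<Longrightarrow> x * y \<in> I"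
    using a_subset zero_closed a_closed I_l_closed by auto
  show "x - y \<in> I" if "x \<in> I" "y \<in> I" for x y
    using 1(3)[of x "- 1 * y"] 1(4)[of "- 1" y] carrier_closed(3)[of 1 1] that by simp
qed

lemma ideal_scaled:
  assumes "ideal I R" "(\<lambda>x. a * x / b) ` I \<subseteq> carrier R"
  shows "ideal ((\<lambda>x. a * x / b) ` I) R"
proof (rule ideal_I[OF assms(2)])
  note I = ideal_D[OF assms(1)]
  show "0 \<in> (\<lambda>x. a * x / b) ` I"
    using I(2) by (auto intro!: image_eqI[of _ _ 0])
  fix x y assume "y \<in> (\<lambda>x. a * x / b) ` I"
  then obtain q where q: "q \<in> I" "y = a * q / b"
    by blast
  show "x + y \<in> (\<lambda>x. a * x / b) ` I" if x: "x \<in> (\<lambda>x. a * x / b) ` I"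
  proof -
    obtain q' where "q' \<in> I" "x = a * q' / b"
      using x by blast
    then have "x + y = a * (q' + q) / b" "q' + q \<in> I"
      using q I(3) by (simp_all add: add_divide_distrib distrib_left)
    then show ?thesis
      by blast
  qed
  show "x * y \<in> (\<lambda>x. a * x / b) ` I" if "x \<in> carrier R"
  proof -
    have "x * y = a * (x * q) / b" "x * q \<in> I"
      using q I(4) that by simp_all
    then show ?thesis
      by blast
  qed
qed

definition pr :: "real \<Rightarrow> real set" where
  "pr a = (*) a ` carrier R"

lemma ideal_pr: "a \<in> carrier R \<Longrightarrow> ideal (pr a) R"
proof (rule ideal_I)
  assume a: "a \<in> carrier R"
  then show "pr a \<subseteq> carrier R"
    by (auto simp: pr_def carrier_closed)
  show "0 \<in> pr a"
    by (auto simp: pr_def intro!: image_eqI[of _ _ 0])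
  fix x y assume "y \<in> pr a"
  then obtain v where v: "v \<in> carrier R" "y = a * v"
    by (auto simp: pr_def)
  show "x + y \<in> pr a" if x: "x \<in> pr a"
  proof -
    obtain u where "u \<in> carrier R" "x = a * u"
      using x by (auto simp: pr_def)
    then show ?thesis
      using v by (auto simp: pr_def carrier_closed distrib_left intro!: image_eqI[of _ _ "u + v"])
  qed
  show "x * y \<in> pr a" if "x \<in> carrier R"
    using that v by (auto simp: pr_def carrier_closed intro!: image_eqI[of _ _ "x * v"])
qed

abbreviation ip :: "real set \<Rightarrow> real set \<Rightarrow> real set" (infixl "\<star>" 80) where
  "I \<star> J \<equiv> ideal_prod R I J"

lemma ip_induct [consumes 1, case_names prod sum]:
  assumes "x \<in> I \<star> J" "\<And>i j. i \<in> I \<Longrightarrow> j \<in> J \<Longrightarrow> Q (i * j)"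
    "\<And>s t. s \<in> I \<star> J \<Longrightarrow> Q s \<Longrightarrow> t \<in> I \<star> J \<Longrightarrow> Q t \<Longrightarrow> Q (s + t)"
  shows "Q x"
  using assms(1) by (induction rule: ideal_prod.induct) (use assms(2,3) in auto)

lemma ip_prod: "i \<in> I \<Longrightarrow> j \<in> J \<Longrightarrow> i * j \<in> I \<star> J"
  using ideal_prod.prod[of i I j J R] by simp

lemma pr_ip: 
  assumes "a \<in> carrier R" "ideal I R"
  shows "pr a \<star> I = (*) a ` I"
proof (intro equalityI subsetI)
  fix x assume "x \<in> pr a \<star> I"
  then show "x \<in> (*) a ` I"
  proof (induction rule: ip_induct)
    case (prod i j)
    then obtain u where u: "u \<in> carrier R" "i = a * u"
      by (auto simp: pr_def)
    then show ?case
      using ideal_D(4)[OF assms(2) u(1) prod(2)] by (simp add: mult.assoc imageI)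
  next
    case (sum s t)
    then obtain u v where "u \<in> I" "v \<in> I" "s = a * u" "t = a * v"
      by auto
    then show ?case
      using ideal_D(3)[OF assms(2), of u v] by (simp add: distrib_left[symmetric] imageI)
  qed
next
  fix x assume "x \<in> (*) a ` I"
  then obtain u where "u \<in> I" "x = a * u"
    by auto
  moreover have "a \<in> pr a"
    by (auto simp: pr_def intro!: image_eqI[of _ _ 1])
  ultimately show "x \<in> pr a \<star> I"
    by (simp add: ip_prod)
qed

lemma pr_ip_cancel:
  assumes "a \<in> carrier R" "a \<noteq> 0" "ideal I R" "ideal J R" "pr a \<star> I = pr a \<star> J"
  shows "I = J"
proof -
  have "(*) a ` I = (*) a ` J"
    using assms by (simp add: pr_ip)
  moreover have "inj ((*) a)"
    using assms(2) by (intro injI) simp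
  ultimately show ?thesis
    by (simp add: inj_image_eq_iff)
qed

lemma pr_ip_pr:
  assumes "a \<in> carrier R" "b \<in> carrier R"
  shows "pr a \<star> pr b = pr (a * b)"
  unfolding pr_ip[OF assms(1) ideal_pr[OF assms(2)]] by (auto simp: pr_def image_image mult.assoc)

lemma pr_1: "pr 1 = carrier R"
  by (simp add: pr_def)

text \<open>Stated with products by principal ideals instead of translates, so that associativity
  and commutativity of ideal multiplication apply directly.\<close>

definition equivalent :: "real set \<Rightarrow> real set \<Rightarrow> bool" where
  "equivalent I J \<longleftrightarrow> (\<exists>a\<in>carrier R - {0}. \<exists>b\<in>carrier R - {0}. pr a \<star> I = pr b \<star> J)"

lemma class_rel_iff:
  "(I, J) \<in> ideal_class_rel R \<longleftrightarrow> I \<in> nonzero_ideals R \<and> J \<in> nonzero_ideals R \<and> equivalent I J"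
proof -
  have *: "a <#\<^bsub>R\<^esub> I = pr a \<star> I" if "a \<in> carrier R" "I \<in> nonzero_ideals R" for a I
    using that by (auto simp: nonzero_ideals_def pr_ip l_coset_def)
  show ?thesis
  proof (cases "I \<in> nonzero_ideals R \<and> J \<in> nonzero_ideals R")
    case True
    then have "(\<exists>a\<in>carrier R - {0}. \<exists>b\<in>carrier R - {0}. a <#\<^bsub>R\<^esub> I = b <#\<^bsub>R\<^esub> J) \<longleftrightarrow> equivalent I J"
      unfolding equivalent_def by (intro bex_cong refl) (simp add: *)
    then show ?thesis
      using True by (simp add: ideal_class_rel_def)
  qed (auto simp: ideal_class_rel_def)
qed

lemma nonzero_idealsD:
  assumes "I \<in> nonzero_ideals R"
  shows "ideal I R" "\<exists>x\<in>I. x \<noteq> 0"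
  using assms ideal_D(2)[of I] by (auto simp: nonzero_ideals_def)

lemma ip_nonzero:
  assumes "I \<in> nonzero_ideals R" "J \<in> nonzero_ideals R"
  shows "I \<star> J \<in> nonzero_ideals R"
proof -
  obtain x y where "x \<in> I" "y \<in> J" "x \<noteq> 0" "y \<noteq> 0"
    using assms nonzero_idealsD(2) by metis
  then have "x * y \<in> I \<star> J" "x * y \<noteq> 0"
    by (auto intro: ip_prod)
  then have "I \<star> J \<noteq> {0}"
    by blast
  moreover have "ideal (I \<star> J) R"
    using assms nonzero_idealsD(1) R.ideal_prod_is_ideal by blast
  ultimately show ?thesis
    by (simp add: nonzero_ideals_def)
qed

lemma pr_self: "a \<in> pr a"
  by (auto simp: pr_def intro!: image_eqI[of _ _ 1])

lemma pr_nonzero: "a \<in> carrier R \<Longrightarrow> a \<noteq> 0 \<Longrightarrow> pr a \<in> nonzero_ideals R"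
  using ideal_pr[of a] pr_self[of a] by (auto simp: nonzero_ideals_def)

end

subsection \<open>Finiteness of the class group\<close>

context quad_order
begin

lemma ideal_of_int_mult: "ideal I R \<Longrightarrow> x \<in> I \<Longrightarrow> of_int n * x \<in> I"
  by (rule ideal_D(4)) simp_all

lemma nrm_in_ideal:
  assumes "ideal I R" "el a b \<in> I"
  shows "of_int (nrm a b) \<in> I"
  using ideal_D(4)[OF assms(1) el_in_carrier assms(2), of "a + b" "- b"] el_conj[of a b]
  by (simp add: mult.commute)

text \<open>The Hermite normal form of a lattice of rank 2: the least positive integer in I, and an
  element whose w-coordinate is positive and least. Division with remainder, first in the
  w-coordinate and then in the other, shows that they generate I as an abelian group.\<close>

lemma two_generators:
  assumes "I \<in> nonzero_ideals R"
  obtains g1 g2 where "g1 \<in> I" "g2 \<in> I" "g1 \<noteq> 0" "g2 \<noteq> 0"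
    "\<And>x. x \<in> I \<Longrightarrow> \<exists>m n :: int. x = of_int m * g1 + of_int n * g2"
proof -
  have I: "ideal I R"
    using assms by (rule nonzero_idealsD)
  obtain x where x: "x \<in> I" "x \<noteq> 0"
    using assms nonzero_idealsD(2) by blast
  then obtain a b where ab: "x = el a b"
    using ideal_D(1)[OF I] carrier_cases by blast
  define N where "N = nat \<bar>nrm a b\<bar>"
  have "of_int (nrm a b) \<in> I"
    using I x(1) unfolding ab by (rule nrm_in_ideal)
  then have "of_int (sgn (nrm a b)) * of_int (nrm a b) \<in> I"
    using I ideal_of_int_mult by blast
  then have "of_int (int N) \<in> I"
    by (simp add: N_def sgn_mult_abs flip: of_int_mult) (metis abs_sgn mult.commute of_int_abs of_int_mult)
  moreover have "N > 0"
    using x(2) nrm_eq_0_iff[of a b] by (simp add: N_def ab el_0_iff)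
  ultimately have ex1: "\<exists>u::nat. u > 0 \<and> of_int (int u) \<in> I"
    by blast
  define u where "u = (LEAST u::nat. u > 0 \<and> of_int (int u) \<in> I)"
  have u: "u > 0" "of_int (int u) \<in> I"
    using LeastI_ex[OF ex1] unfolding u_def by auto
  have u_min: "v = 0" if "of_int (int v) \<in> I" "v < u" for v
    using not_less_Least[of v "\<lambda>u. u > 0 \<and> of_int (int u) \<in> I"] that unfolding u_def by auto
  have "el 0 1 * of_int (int u) \<in> I"
    using I u(2) by (intro ideal_D(4)) auto
  then have "el 0 (int u) \<in> I"
    by (simp add: of_int_el el_mult)
  then have ex2: "\<exists>v::nat. v > 0 \<and> (\<exists>t. el t (int v) \<in> I)"
    using u(1) by blast
  define v where "v = (LEAST v::nat. v > 0 \<and> (\<exists>t. el t (int v) \<in> I))"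
  obtain t where v: "v > 0" "el t (int v) \<in> I"
    using LeastI_ex[OF ex2] unfolding v_def by auto
  have v_min: "v' = 0" if "el t (int v') \<in> I" "v' < v" for v' t
    using not_less_Least[of v' "\<lambda>v. v > 0 \<and> (\<exists>t. el t (int v) \<in> I)"] that unfolding v_def by auto
  have gen: "\<exists>m n :: int. y = of_int m * of_int (int u) + of_int n * el t (int v)" if y: "y \<in> I" for y
  proof -
    obtain e f where ef: "y = el e f"
      using y ideal_D(1)[OF I] carrier_cases by blast
    define n where "n = f div int v"
    have "y - of_int n * el t (int v) = el (e - n * t) (f mod int v)"
      by (simp add: ef of_int_el el_mult el_diff n_def minus_div_mult_eq_mod)
    moreover have "y - of_int n * el t (int v) \<in> I"
      using I y v(2) by (intro ideal_D(5) ideal_of_int_mult)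
    moreover have f: "f mod int v = int (nat (f mod int v))"
      using v(1) by simp
    ultimately have 1: "el (e - n * t) (int (nat (f mod int v))) \<in> I"
      by simp
    have "nat (f mod int v) < v"
      using v(1) by (simp add: nat_less_iff)
    with 1 have "nat (f mod int v) = 0"
      by (rule v_min)
    then have y': "y - of_int n * el t (int v) = el (e - n * t) 0"
      using \<open>y - of_int n * el t (int v) = el (e - n * t) (f mod int v)\<close> f by simp
    define m where "m = (e - n * t) div int u"
    have "of_int (e - n * t) - of_int m * of_int (int u) = real_of_int ((e - n * t) mod int u)"
      unfolding of_int_mult[symmetric] of_int_diff[symmetric] m_def by (simp only: minus_div_mult_eq_mod)
    moreover have "of_int (e - n * t) - of_int m * of_int (int u) \<in> I"
    proof (rule ideal_D(5)[OF I])
      show "real_of_int (e - n * t) \<in> I"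
        using \<open>y - of_int n * el t (int v) \<in> I\<close> unfolding y' by (simp add: of_int_el)
      show "of_int m * real_of_int (int u) \<in> I"
        using I u(2) by (rule ideal_of_int_mult)
    qed
    moreover have g: "(e - n * t) mod int u = int (nat ((e - n * t) mod int u))"
      using u(1) by simp
    ultimately have "of_int (int (nat ((e - n * t) mod int u))) \<in> I"
      by simp
    moreover have "nat ((e - n * t) mod int u) < u"
      using u(1) by (simp add: nat_less_iff)
    ultimately have "nat ((e - n * t) mod int u) = 0"
      by (rule u_min)
    then have "of_int (e - n * t) = of_int m * real_of_int (int u)"
      using \<open>of_int (e - n * t) - of_int m * of_int (int u) = real_of_int ((e - n * t) mod int u)\<close> g by simp
    then have "y = of_int m * of_int (int u) + of_int n * el t (int v)"
      using y' by (simp add: of_int_el)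
    then show ?thesis
      by blast
  qed
  show ?thesis
    using u v gen by (intro that[of "of_int (int u)" "el t (int v)"]) (auto simp: el_0_iff)
qed

text \<open>The next two lemmas are the determinant trick, for the matrix of multiplication on two generators.\<close>

lemma multiplier_in_carrier:
  assumes "I \<in> nonzero_ideals R" "s \<in> quad_field (sqrt (of_int D))" "\<And>x. x \<in> I \<Longrightarrow> s * x \<in> I"
  shows "s \<in> carrier R"
proof -
  obtain g1 g2 where g: "g1 \<in> I" "g2 \<in> I" "g1 \<noteq> 0" "g2 \<noteq> 0"
    "\<And>x. x \<in> I \<Longrightarrow> \<exists>m n :: int. x = of_int m * g1 + of_int n * g2"
    using two_generators[OF assms(1)] by blast
  obtain m1 n1 :: int where 1: "s * g1 = of_int m1 * g1 + of_int n1 * g2"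
    using g(5)[OF assms(3)[OF g(1)]] by blast
  obtain m2 n2 :: int where 2: "s * g2 = of_int m2 * g1 + of_int n2 * g2"
    using g(5)[OF assms(3)[OF g(2)]] by blast
  have "((s - of_int m1) * g1) * ((s - of_int n2) * g2) = (of_int n1 * g2) * (of_int m2 * g1)"
    using 1 2 by (simp add: left_diff_distrib)
  then have "(g1 * g2) * ((s - of_int m1) * (s - of_int n2)) = (g1 * g2) * of_int (n1 * m2)"
    by (simp add: mult_ac)
  then have "(s - of_int m1) * (s - of_int n2) = of_int (n1 * m2)"
    using g(3,4) by simp
  then have "s ^ 2 = of_int (m1 + n2) * s + of_int (n1 * m2 - m1 * n2)"
    by (simp add: power2_eq_square algebra_simps)
  then have "algebraic_int s"
    by (rule quadratic_algebraic_int)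
  then show ?thesis
    using assms(2) by (simp add: ring_of_integers_def)
qed

lemma one_in_if_ip_eq:
  assumes "I \<in> nonzero_ideals R" "ideal Q R" "Q \<star> I = I"
  shows "1 \<in> Q"
proof -
  note Q = ideal_D[OF assms(2)]
  obtain g1 g2 where g: "g1 \<in> I" "g2 \<in> I" "g1 \<noteq> 0" "g2 \<noteq> 0"
    "\<And>x. x \<in> I \<Longrightarrow> \<exists>m n :: int. x = of_int m * g1 + of_int n * g2"
    using two_generators[OF assms(1)] by blast
  have gen: "\<exists>s\<in>Q. \<exists>t\<in>Q. x = s * g1 + t * g2" if "x \<in> Q \<star> I" for x
    using that
  proof (induction rule: ip_induct)
    case (prod i j)
    then obtain m n :: int where j: "j = of_int m * g1 + of_int n * g2"
      using g(5) by blast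
    have "i * j = (of_int m * i) * g1 + (of_int n * i) * g2"
      by (simp add: j algebra_simps)
    moreover have "of_int m * i \<in> Q" "of_int n * i \<in> Q"
      using assms(2) prod(1) by (auto intro: ideal_of_int_mult)
    ultimately show ?case
      by blast
  next
    case (sum x y)
    then obtain s t s' t' where "s \<in> Q" "t \<in> Q" "x = s * g1 + t * g2"
      "s' \<in> Q" "t' \<in> Q" "y = s' * g1 + t' * g2"
      by blast
    then have "x + y = (s + s') * g1 + (t + t') * g2" "s + s' \<in> Q" "t + t' \<in> Q"
      using Q(3) by (auto simp: algebra_simps)
    then show ?case
      by blast
  qed
  obtain q11 q12 where 1: "q11 \<in> Q" "q12 \<in> Q" "g1 = q11 * g1 + q12 * g2"
    using gen[of g1] g(1) assms(3) by auto
  obtain q21 q22 where 2: "q21 \<in> Q" "q22 \<in> Q" "g2 = q21 * g1 + q22 * g2"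
    using gen[of g2] g(2) assms(3) by auto
  have "(1 - q11) * g1 = q12 * g2" "(1 - q22) * g2 = q21 * g1"
    using 1(3) 2(3) by (simp_all add: left_diff_distrib)
  then have "((1 - q11) * g1) * ((1 - q22) * g2) = (q12 * g2) * (q21 * g1)"
    by simp
  then have "(g1 * g2) * ((1 - q11) * (1 - q22)) = (g1 * g2) * (q12 * q21)"
    by (simp add: mult_ac)
  then have "(1 - q11) * (1 - q22) = q12 * q21"
    using g(3,4) by simp
  then have "1 = q11 + q22 - q11 * q22 + q12 * q21"
    by (simp add: algebra_simps)
  moreover have "q11 * q22 \<in> Q" "q12 * q21 \<in> Q"
    using Q(1,4) 1 2 by auto
  then have "q11 + q22 - q11 * q22 + q12 * q21 \<in> Q"
    using Q(3,5) 1 2 by simp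
  ultimately show ?thesis
    by simp
qed

text \<open>If a Q I = b I, the fractional ideal Q' = (a/b) Q maps I to itself, so it lies in the
  ring by \<open>multiplier_in_carrier\<close>. Then Q' I = I forces 1 to be in Q', and the element
  q0 of Q with a q0 = b generates Q. In this way cancellation of I is obtained without invertibility
  of ideals.\<close>

lemma principal_if_fixes_class:
  assumes "I \<in> nonzero_ideals R" "Q \<in> nonzero_ideals R" "equivalent (Q \<star> I) I"
  obtains \<gamma> where "\<gamma> \<in> carrier R" "Q = pr \<gamma>"
proof -
  obtain a b where ab: "a \<in> carrier R" "a \<noteq> 0" "b \<in> carrier R" "b \<noteq> 0"
    and eq: "pr a \<star> (Q \<star> I) = pr b \<star> I"
    using assms(3) unfolding equivalent_def by blast
  note I = nonzero_idealsD(1)[OF assms(1)] and Q = nonzero_idealsD(1)[OF assms(2)]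
  note QD = ideal_D[OF Q]
  define Q' where "Q' = (\<lambda>q. a * q / b) ` Q"
  have field: "x * y \<in> quad_field (sqrt (of_int D))" "y \<noteq> 0 \<Longrightarrow> inverse y \<in> quad_field (sqrt (of_int D))"
    if "x \<in> quad_field (sqrt (of_int D))" "y \<in> quad_field (sqrt (of_int D))" for x y
  proof -
    have sub: "subfield (quad_field (sqrt (of_int D))) real_ring"
      using sqrt_D by (intro subfield_quad_field) auto
    show "x * y \<in> quad_field (sqrt (of_int D))"
      using subringE(6)[OF subfieldE(1)[OF sub] that] by simp
    show "inverse y \<in> quad_field (sqrt (of_int D))" if "y \<noteq> 0"
      using real_ring.subfield_m_inv(1)[OF sub, of y] \<open>y \<in> quad_field (sqrt (of_int D))\<close> that by simp
  qed
  have carr: "x \<in> quad_field (sqrt (of_int D))" if "x \<in> carrier R" for x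
    using that by (simp add: ring_of_integers_def)
  have Q'_carr: "Q' \<subseteq> carrier R"
  proof
    fix s assume "s \<in> Q'"
    then obtain q where q: "q \<in> Q" "s = a * q / b"
      by (auto simp: Q'_def)
    show "s \<in> carrier R"
    proof (rule multiplier_in_carrier[OF assms(1)])
      have "q \<in> carrier R"
        using q(1) QD(1) by blast
      then have "(a * q) * inverse b \<in> quad_field (sqrt (of_int D))"
        using ab carr by (intro field) auto
      then show "s \<in> quad_field (sqrt (of_int D))"
        by (simp add: q(2) divide_inverse)
      fix x assume "x \<in> I"
      then have "a * (q * x) \<in> pr a \<star> (Q \<star> I)"
        by (intro ip_prod pr_self q(1))
      then have "a * (q * x) \<in> (*) b ` I"
        unfolding eq pr_ip[OF ab(3) I] .
      then obtain z where "z \<in> I" "a * (q * x) = b * z"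
        by blast
      moreover from this have "s * x = z"
        using ab(4) by (simp add: q(2) field_simps)
      ultimately show "s * x \<in> I"
        by simp
    qed
  qed
  have Q': "ideal Q' R"
    using ideal_scaled[OF Q] Q'_carr unfolding Q'_def by blast
  have bQ': "pr b \<star> Q' = pr a \<star> Q"
    using ab(4) unfolding pr_ip[OF ab(3) Q'] pr_ip[OF ab(1) Q] by (simp add: Q'_def image_image)
  have "pr b \<star> (Q' \<star> I) = (pr b \<star> Q') \<star> I"
    using ideal_pr[OF ab(3)] Q' I by (rule R.ideal_prod_assoc[symmetric])
  also have "\<dots> = pr a \<star> (Q \<star> I)"
    unfolding bQ' using ideal_pr[OF ab(1)] Q I by (rule R.ideal_prod_assoc)
  finally have "pr b \<star> (Q' \<star> I) = pr b \<star> I"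
    by (simp only: eq)
  then have "Q' \<star> I = I"
    using pr_ip_cancel[OF ab(3,4) R.ideal_prod_is_ideal[OF Q' I] I] by blast
  then have "1 \<in> Q'"
    using one_in_if_ip_eq[OF assms(1) Q'] by blast
  then obtain q0 where q0: "q0 \<in> Q" "a * q0 / b = 1"
    by (auto simp: Q'_def)
  then have b: "b = a * q0"
    using ab(4) by (simp add: field_simps)
  have q0_carr: "q0 \<in> carrier R"
    using q0(1) QD(1) by blast
  have "Q = pr q0"
  proof (intro equalityI subsetI)
    fix q assume "q \<in> Q"
    then have "a * q / b \<in> carrier R"
      using Q'_carr by (auto simp: Q'_def)
    moreover have "q = q0 * (a * q / b)"
      using ab(2,4) b by (simp add: field_simps)
    ultimately show "q \<in> pr q0"
      unfolding pr_def by blast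
  next
    fix x assume "x \<in> pr q0"
    then show "x \<in> Q"
      using QD(4)[OF _ q0(1)] by (auto simp: pr_def mult.commute)
  qed
  then show ?thesis
    using q0_carr that by blast
qed

section \<open>Representatives of the ideal classes containing a fixed integer\<close>

lemma finite_ideals_containing:
  assumes "T > 0"
  shows "finite {J. ideal J R \<and> of_int T \<in> J}"
proof -
  define B where "B = (\<lambda>(a, b). el a b) ` ({0..<T} \<times> {0..<T})"
  have "finite B"
    by (simp add: B_def)
  have sub: "J \<subseteq> J'" if J: "ideal J R" "of_int T \<in> J" and J': "ideal J' R" "of_int T \<in> J'" "J \<inter> B = J' \<inter> B" for J J'
  proof
    fix x assume x: "x \<in> J"
    then obtain a b where ab: "x = el a b"
      using ideal_D(1)[OF J(1)] carrier_cases by blast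
    define z where "z = el (a div T) (b div T) * of_int T"
    have z: "z \<in> J" "z \<in> J'"
      unfolding z_def by (intro ideal_D(4)[OF J(1) el_in_carrier J(2)] ideal_D(4)[OF J'(1) el_in_carrier J'(2)])+
    have "x - z = el (a mod T) (b mod T)"
      by (simp add: ab z_def of_int_el el_mult el_diff minus_div_mult_eq_mod)
    then have "x - z \<in> B"
      using assms by (auto simp: B_def intro!: image_eqI[of _ _ "(a mod T, b mod T)"])
    moreover have "x - z \<in> J"
      using J(1) x z(1) by (intro ideal_D(5))
    ultimately have "x - z \<in> J'"
      using J'(3) by blast
    then have "(x - z) + z \<in> J'"
      using J'(1) z(2) by (intro ideal_D(3))
    then show "x \<in> J'"
      by simp
  qed
  have "inj_on (\<lambda>J. J \<inter> B) {J. ideal J R \<and> of_int T \<in> J}"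
  proof (rule inj_onI)
    fix J J' assume "J \<in> {J. ideal J R \<and> of_int T \<in> J}" "J' \<in> {J. ideal J R \<and> of_int T \<in> J}" "J \<inter> B = J' \<inter> B"
    then show "J = J'"
      using sub[of J J'] sub[of J' J] by auto
  qed
  moreover have "finite ((\<lambda>J. J \<inter> B) ` {J. ideal J R \<and> of_int T \<in> J})"
    using \<open>finite B\<close> by (intro finite_subset[OF _ finite_Pow_iff[THEN iffD2]]) auto
  ultimately show ?thesis
    by (rule finite_imageD[rotated])
qed

text \<open>The form \<open>nrm\<close> is bounded by |c| + 2 times the square of the larger
  coordinate; L is large enough for L^2 to absorb this constant.\<close>

lemma abs_nrm_less:
  assumes "\<bar>c\<bar> + 2 \<le> L" "L * \<bar>e\<bar> < N" "L * \<bar>f\<bar> < N"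
  shows "\<bar>nrm e f\<bar> < N ^ 2"
proof -
  have L: "L > 0"
    using assms(1) by linarith
  have N: "N > 0"
    using assms(2) L by (meson abs_ge_zero le_less_trans mult_nonneg_nonneg less_imp_le)
  define A B where "A = L * \<bar>e\<bar>" and "B = L * \<bar>f\<bar>"
  have AB: "0 \<le> A" "A < N" "0 \<le> B" "B < N"
    using assms L by (auto simp: A_def B_def)
  have "\<bar>nrm e f\<bar> \<le> \<bar>e * e\<bar> + \<bar>e * f\<bar> + \<bar>c * f * f\<bar>"
    unfolding nrm_def by linarith
  then have "L ^ 2 * \<bar>nrm e f\<bar> \<le> L ^ 2 * (\<bar>e * e\<bar> + \<bar>e * f\<bar> + \<bar>c * f * f\<bar>)"
    by (intro mult_left_mono) auto
  also have "\<dots> = A * A + A * B + \<bar>c\<bar> * (B * B)"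
    by (simp add: A_def B_def abs_mult power2_eq_square algebra_simps)
  also have "A * A < N * N"
    using AB by (intro mult_strict_mono) auto
  also have "A * B \<le> N * N"
    using AB by (intro mult_mono) auto
  also have "\<bar>c\<bar> * (B * B) \<le> \<bar>c\<bar> * (N * N)"
    using AB by (intro mult_left_mono mult_mono) auto
  also have "N * N + N * N + \<bar>c\<bar> * (N * N) = (\<bar>c\<bar> + 2) * N ^ 2"
    by (simp add: power2_eq_square algebra_simps)
  also have "\<dots> \<le> L ^ 2 * N ^ 2"
  proof (intro mult_right_mono)
    have "L * 1 \<le> L * L"
      using L by (intro mult_left_mono) auto
    then show "\<bar>c\<bar> + 2 \<le> L ^ 2"
      using assms(1) by (simp add: power2_eq_square)
  qed simp
  finally show ?thesis
    using L by simp
qed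

text \<open>Hurwitz's substitute for the Euclidean algorithm. Take \<alpha> in I with least nonzero
  norm. Dirichlet approximation of the two coordinates of \<beta>/\<alpha> gives t \<le> L^2 such
  that t \<beta> differs from a multiple of \<alpha> by an element of I of smaller norm, hence by 0.
  T is the factorial of L^2, so that every such t divides it.\<close>

lemma ex_common_multiplier:
  obtains T :: int where "T > 0"
    "\<And>I. I \<in> nonzero_ideals R \<Longrightarrow> \<exists>\<alpha>\<in>I. \<alpha> \<noteq> 0 \<and> (\<forall>\<beta>\<in>I. of_int T * \<beta> \<in> pr \<alpha>)"
proof -
  define L where "L = nat (\<bar>c\<bar> + 2)"
  have L: "L > 0" "\<bar>c\<bar> + 2 \<le> int L"
    by (simp_all add: L_def)
  define T where "T = int (fact (L ^ 2))"
  have "\<exists>\<alpha>\<in>I. \<alpha> \<noteq> 0 \<and> (\<forall>\<beta>\<in>I. of_int T * \<beta> \<in> pr \<alpha>)" if I0: "I \<in> nonzero_ideals R" for I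
  proof -
    have I: "ideal I R"
      using I0 by (rule nonzero_idealsD)
    define S where "S = (\<lambda>n::nat. \<exists>a b. el a b \<in> I \<and> el a b \<noteq> 0 \<and> n = nat \<bar>nrm a b\<bar>)"
    obtain x where "x \<in> I" "x \<noteq> 0"
      using I0 nonzero_idealsD(2) by blast
    then obtain a0 b0 where "el a0 b0 \<in> I" "el a0 b0 \<noteq> 0"
      using ideal_D(1)[OF I] carrier_cases by blast
    then have ex: "\<exists>n. S n"
      unfolding S_def by blast
    obtain a b where ab: "el a b \<in> I" "el a b \<noteq> 0" "(LEAST n. S n) = nat \<bar>nrm a b\<bar>"
      using LeastI_ex[OF ex] unfolding S_def by blast
    have min: "x = 0 \<and> y = 0" if "el x y \<in> I" "\<bar>nrm x y\<bar> < \<bar>nrm a b\<bar>" for x y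
    proof (rule ccontr)
      assume "\<not> (x = 0 \<and> y = 0)"
      then have "S (nat \<bar>nrm x y\<bar>)"
        using that(1) unfolding S_def by (auto simp: el_0_iff)
      then have "nat \<bar>nrm a b\<bar> \<le> nat \<bar>nrm x y\<bar>"
        unfolding ab(3)[symmetric] by (rule Least_le)
      then show False
        using that(2) by simp
    qed
    define N where "N = nrm a b"
    have N0: "N \<noteq> 0"
      using ab(2) by (simp add: N_def nrm_eq_0_iff el_0_iff)
    have "of_int T * \<beta> \<in> pr (el a b)" if \<beta>: "\<beta> \<in> I" for \<beta>
    proof -
      obtain e0 f0 where ef0: "\<beta> = el e0 f0"
        using \<beta> ideal_D(1)[OF I] carrier_cases by blast
      \<comment> \<open>Multiplying by the conjugate of \<alpha> = \<open>el a b\<close> clears the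
        denominator: e/N and f/N are the coordinates of \<beta>/\<alpha>.\<close>
      have "\<beta> * el (a + b) (- b) \<in> carrier R"
        unfolding ef0 by (simp add: el_mult)
      then obtain e f where ef: "\<beta> * el (a + b) (- b) = el e f"
        by (rule carrier_cases)
      define \<theta> where "\<theta> = (\<lambda>i::nat. (if i = 0 then of_int e else of_int f) / real_of_int N)"
      obtain t p where t: "0 < t" "t \<le> int (L ^ 2)"
        and p: "\<And>i. i < 2 \<Longrightarrow> \<bar>of_int t * \<theta> i - of_int (p i)\<bar> < 1 / L"
        using Dirichlet_approx_simult[OF L(1), of 2 \<theta>] by blast
      have scaled: "int L * \<bar>t * g - N * q\<bar> < \<bar>N\<bar>"
        if "\<bar>of_int t * (of_int g / real_of_int N) - of_int q\<bar> < 1 / L" for g q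
      proof -
        have "of_int t * (of_int g / real_of_int N) - of_int q = of_int (t * g - N * q) / of_int N"
          using N0 by (simp add: field_simps)
        then have "\<bar>of_int (t * g - N * q)\<bar> / \<bar>real_of_int N\<bar> < 1 / L"
          using that by (simp add: abs_divide)
        then have "L * \<bar>real_of_int (t * g - N * q)\<bar> < \<bar>real_of_int N\<bar>"
          using N0 L(1) by (simp add: field_simps)
        then have "real_of_int (int L * \<bar>t * g - N * q\<bar>) < real_of_int \<bar>N\<bar>"
          by simp
        then show ?thesis
          by (subst (asm) of_int_less_iff)
      qed
      define \<delta> where "\<delta> = of_int t * \<beta> - el (p 0) (p 1) * el a b"
      have "\<delta> \<in> I"
        unfolding \<delta>_def using I \<beta> ab(1) by (intro ideal_D(5) ideal_of_int_mult) (auto intro: ideal_D(4))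
      then obtain x y where xy: "\<delta> = el x y"
        using ideal_D(1)[OF I] carrier_cases by blast
      have "\<delta> * el (a + b) (- b) = of_int t * el e f - el (p 0) (p 1) * of_int N"
        by (simp add: \<delta>_def left_diff_distrib mult.assoc ef N_def el_conj)
      also have "\<dots> = el (t * e - N * p 0) (t * f - N * p 1)"
        by (simp add: of_int_el el_mult el_diff mult.commute)
      finally have "nrm x y * nrm (a + b) (- b) = nrm (t * e - N * p 0) (t * f - N * p 1)"
        unfolding xy el_mult el_eq_iff by (metis nrm_mult)
      moreover have "nrm (a + b) (- b) = N"
        by (simp add: N_def nrm_def algebra_simps)
      moreover have "\<bar>nrm (t * e - N * p 0) (t * f - N * p 1)\<bar> < \<bar>N\<bar> ^ 2"
        using p[of 0] p[of 1] by (intro abs_nrm_less[OF L(2)] scaled) (simp_all add: \<theta>_def)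
      ultimately have "\<bar>nrm x y\<bar> * \<bar>N\<bar> < \<bar>N\<bar> * \<bar>N\<bar>"
        by (simp add: abs_mult[symmetric] power2_eq_square)
      then have "\<bar>nrm x y\<bar> < \<bar>N\<bar>"
        by (rule mult_right_less_imp_less) simp
      then have "\<delta> = 0"
        using min[of x y] \<open>\<delta> \<in> I\<close> xy by (simp add: N_def el_0_iff)
      then have *: "of_int t * \<beta> = el a b * el (p 0) (p 1)"
        by (simp add: \<delta>_def mult.commute)
      have "nat t \<le> L ^ 2"
        using t(2) by (simp only: nat_le_iff)
      then have "nat t dvd fact (L ^ 2)"
        using t(1) by (intro dvd_fact) auto
      then have "t dvd T"
        unfolding T_def using t(1) int_dvd_int_iff[of "nat t" "fact (L ^ 2)"] by simp
      then obtain t' where "T = t * t'"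
        by (elim dvdE)
      then have "of_int T * \<beta> = of_int t' * (of_int t * \<beta>)"
        by simp
      also have "\<dots> = el a b * (of_int t' * el (p 0) (p 1))"
        by (simp add: *)
      finally show ?thesis
        unfolding pr_def by (auto simp: carrier_closed)
    qed
    then show ?thesis
      using ab(1,2) by blast
  qed
  moreover have "T > 0"
    by (simp add: T_def)
  ultimately show ?thesis
    using that by blast
qed

text \<open>The class of I also contains (T/\<alpha>) I, which is an ideal of the ring and contains
  T, the image of \<alpha>. Only finitely many ideals contain T.\<close>

theorem finite_ideal_classes: "finite (ideal_classes (quad_field (sqrt (of_int D))))"
proof -
  obtain T where T: "T > 0"
    "\<And>I. I \<in> nonzero_ideals R \<Longrightarrow> \<exists>\<alpha>\<in>I. \<alpha> \<noteq> 0 \<and> (\<forall>\<beta>\<in>I. of_int T * \<beta> \<in> pr \<alpha>)"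
    by (rule ex_common_multiplier) blast
  have "\<exists>J. ideal J R \<and> of_int T \<in> J \<and> (I, J) \<in> ideal_class_rel R" if I0: "I \<in> nonzero_ideals R" for I
  proof -
    have I: "ideal I R"
      using I0 by (rule nonzero_idealsD)
    obtain \<alpha> where \<alpha>: "\<alpha> \<in> I" "\<alpha> \<noteq> 0" "\<And>\<beta>. \<beta> \<in> I \<Longrightarrow> of_int T * \<beta> \<in> pr \<alpha>"
      using T(2)[OF I0] by blast
    have \<alpha>_carr: "\<alpha> \<in> carrier R"
      using \<alpha>(1) ideal_D(1)[OF I] by blast
    define J where "J = (\<lambda>\<beta>. of_int T * \<beta> / \<alpha>) ` I"
    have "J \<subseteq> carrier R"
      using \<alpha>(2,3) by (force simp: J_def pr_def)
    then have J: "ideal J R"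
      using ideal_scaled[OF I] unfolding J_def by blast
    have TJ: "of_int T \<in> J"
      using \<alpha>(1,2) by (auto simp: J_def intro!: image_eqI[of _ _ \<alpha>])
    then have J0: "J \<in> nonzero_ideals R"
      using J T(1) by (auto simp: nonzero_ideals_def)
    have "(*) \<alpha> ` J = (*) (of_int T) ` I"
      unfolding J_def image_image using \<alpha>(2) by simp
    then have "pr (of_int T) \<star> I = pr \<alpha> \<star> J"
      using pr_ip[OF of_int_in_carrier(1) I] pr_ip[OF \<alpha>_carr J] by simp
    moreover have "of_int T \<in> carrier R - {0}" "\<alpha> \<in> carrier R - {0}"
      using T(1) \<alpha>(2) \<alpha>_carr by simp_all
    ultimately have "equivalent I J"
      unfolding equivalent_def by blast
    then show ?thesis
      using I0 J TJ J0 by (auto simp: class_rel_iff)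
  qed
  then have "ideal_classes (quad_field (sqrt (of_int D)))
      \<subseteq> (\<lambda>J. ideal_class_rel R `` {J}) ` {J. ideal J R \<and> of_int T \<in> J}"
    unfolding ideal_classes_def quotient_def
    using equiv_class_eq[OF equiv_ideal_class_rel[OF domain_R]] by fastforce
  then show ?thesis
    using finite_ideals_containing[OF T(1)] finite_surj by blast
qed

end

subsection \<open>The ideal classes of the primes above 2\<close>

text \<open>The set A is a disjoint union of cycles of the injection F. The induction removes the
  cycle of one element; its length is a period, hence divisible by d.\<close>

lemma dvd_card_if_dvd_periods:
  fixes F :: "'a \<Rightarrow> 'a"
  assumes "finite A" "\<And>x. x \<in> A \<Longrightarrow> F x \<in> A" "inj_on F A"
    "\<And>x k. x \<in> A \<Longrightarrow> (F ^^ k) x = x \<Longrightarrow> d dvd k"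
  shows "d dvd card A"
  using assms
proof (induction "card A" arbitrary: A rule: less_induct)
  case less
  note closed = less.prems(2) and inj = less.prems(3)
  show ?case
  proof (cases "A = {}")
    case False
    then obtain x where x: "x \<in> A"
      by blast
    have iter: "(F ^^ i) y \<in> A" if "y \<in> A" for i y
      using that closed by (induction i) auto
    have cancel: "y = z" if "y \<in> A" "z \<in> A" "(F ^^ i) y = (F ^^ i) z" for i y z
      using that(3)
    proof (induction i)
      case (Suc i)
      then have "F ((F ^^ i) y) = F ((F ^^ i) z)"
        by simp
      then show ?case
        using inj_onD[OF inj _ iter[OF that(1)] iter[OF that(2)]] Suc.IH by blast
    qed simp
    have "\<not> inj_on (\<lambda>i. (F ^^ i) x) UNIV"
      using finite_imageD[of "\<lambda>i. (F ^^ i) x" UNIV] finite_subset[OF _ less.prems(1)] iter[OF x]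
      by (auto simp: image_subset_iff)
    then obtain i j where ij: "i < j" "(F ^^ i) x = (F ^^ j) x"
      unfolding inj_on_def by (metis linorder_neqE_nat)
    have diff: "(F ^^ (j - i)) x = x" if "i < j" "(F ^^ i) x = (F ^^ j) x" for i j
    proof -
      have "(F ^^ i) x = (F ^^ i) ((F ^^ (j - i)) x)"
        using that by (metis add_diff_inverse_nat comp_apply funpow_add less_imp_le not_less)
      then show ?thesis
        using cancel[OF x iter[OF x]] by metis
    qed
    note per = diff[OF ij]
    define k where "k = (LEAST k. k > 0 \<and> (F ^^ k) x = x)"
    have k: "k > 0" "(F ^^ k) x = x"
      using LeastI[of "\<lambda>k. k > 0 \<and> (F ^^ k) x = x" "j - i"] per ij(1) unfolding k_def by auto
    have k_min: "(F ^^ l) x \<noteq> x" if "0 < l" "l < k" for l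
      using not_less_Least[of l "\<lambda>k. k > 0 \<and> (F ^^ k) x = x"] that unfolding k_def by blast
    define C where "C = (\<lambda>i. (F ^^ i) x) ` {..<k}"
    have inj_C: "inj_on (\<lambda>i. (F ^^ i) x) {..<k}"
    proof (rule linorder_inj_onI)
      fix i j assume ij: "i < j" "i \<in> {..<k}" "j \<in> {..<k}"
      show "(F ^^ i) x \<noteq> (F ^^ j) x"
      proof
        assume "(F ^^ i) x = (F ^^ j) x"
        with ij(1) have "(F ^^ (j - i)) x = x"
          by (rule diff)
        then show False
          using k_min[of "j - i"] ij less_imp_diff_less[of j k i] by auto
      qed
    qed auto
    have card_C: "card C = k"
      unfolding C_def using inj_C by (simp add: card_image)
    have C_sub: "C \<subseteq> A"
      using iter[OF x] by (auto simp: C_def)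
    have "d dvd card (A - C)"
    proof (rule less.hyps)
      have "x \<in> C"
        using k(1) by (auto simp: C_def intro!: image_eqI[of _ _ 0])
      then show "card (A - C) < card A"
        using less.prems(1) x by (intro psubset_card_mono) auto
      show "inj_on F (A - C)"
        using inj by (rule inj_on_subset) auto
      show "d dvd l" if "y \<in> A - C" "(F ^^ l) y = y" for y l
        using less.prems(4) that by blast
      fix y assume y: "y \<in> A - C"
      have "F y \<notin> C"
      proof
        assume "F y \<in> C"
        then obtain i where i: "i < k" "F y = (F ^^ i) x"
          by (auto simp: C_def)
        \<comment> \<open>The predecessor on the cycle; that of x itself is the last element. By
          injectivity it is the only preimage, so the complement of C is closed under F.\<close>
        define l where "l = (if i = 0 then k - 1 else i - 1)"
        have "(F ^^ Suc l) x = (F ^^ i) x"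
          using k by (cases i) (simp_all add: l_def del: funpow.simps)
        then have "F y = F ((F ^^ l) x)"
          using i(2) by simp
        then have "y = (F ^^ l) x"
          using inj_onD[OF inj _ _ iter[OF x]] y by blast
        moreover have "l < k"
          using i(1) by (auto simp: l_def)
        ultimately show False
          using y by (auto simp: C_def)
      qed
      then show "F y \<in> A - C"
        using closed y by blast
    qed (use less.prems(1) in auto)
    moreover have "d dvd k"
      using less.prems(4)[OF x k(2)] .
    moreover have "card A = card (A - C) + card C"
      using C_sub less.prems(1) by (metis card_Diff_subset card_mono finite_subset le_add_diff_inverse2)
    ultimately show ?thesis
      using card_C by simp
  qed simp
qed

context quad_order
begin

lemma el_in_pr_of_int_iff: "el a b \<in> pr (of_int n) \<longleftrightarrow> n dvd a \<and> n dvd b"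
proof
  assume "el a b \<in> pr (of_int n)"
  then obtain x where "x \<in> carrier R" "el a b = of_int n * x"
    by (auto simp: pr_def)
  moreover from this obtain a' b' where "x = el a' b'"
    using carrier_cases by blast
  ultimately have "el a b = el (n * a') (n * b')"
    by (simp add: of_int_el el_mult)
  then show "n dvd a \<and> n dvd b"
    by (simp add: el_eq_iff)
next
  assume "n dvd a \<and> n dvd b"
  then obtain a' b' where "a = n * a'" "b = n * b'"
    by (auto elim!: dvdE)
  then have "el a b = of_int n * el a' b'"
    by (simp add: of_int_el el_mult)
  then show "el a b \<in> pr (of_int n)"
    unfolding pr_def by (metis imageI el_in_carrier)
qed

definition ipow :: "real set \<Rightarrow> nat \<Rightarrow> real set" where
  "ipow Q k = ((\<star>) Q ^^ k) (carrier R)"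

lemma ipow_0 [simp]: "ipow Q 0 = carrier R" and ipow_Suc [simp]: "ipow Q (Suc k) = Q \<star> ipow Q k"
  by (simp_all add: ipow_def)

lemma ideal_carrier: "ideal (carrier R) R"
  using ideal_pr[of 1] by (simp add: pr_1)

lemma carrier_ip: "ideal I R \<Longrightarrow> carrier R \<star> I = I"
  using pr_ip[of 1 I] by (simp add: pr_1)

lemma ideal_ipow: "ideal Q R \<Longrightarrow> ideal (ipow Q k) R"
  by (induction k) (auto intro: ideal_carrier R.ideal_prod_is_ideal)

lemma ipow_nonzero: "Q \<in> nonzero_ideals R \<Longrightarrow> ipow Q k \<in> nonzero_ideals R"
  using pr_nonzero[of 1] by (induction k) (simp_all add: pr_1 ip_nonzero)

lemma funpow_ip:
  assumes "ideal Q R" "ideal I R"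
  shows "((\<star>) Q ^^ k) I = ipow Q k \<star> I"
proof (induction k)
  case (Suc k)
  then show ?case
    using R.ideal_prod_assoc[OF assms(1) ideal_ipow[OF assms(1)] assms(2)] by simp
qed (simp add: carrier_ip assms)

lemma ip_left_commute:
  assumes "ideal I R" "ideal J R" "ideal L R"
  shows "I \<star> (J \<star> L) = J \<star> (I \<star> L)"
  using R.ideal_prod_assoc[OF assms] R.ideal_prod_assoc[OF assms(2,1,3)] R.ideal_prod_commute[OF assms(1,2)]
  by simp

lemma ipow_ip_ipow:
  assumes "ideal Q R" "ideal Q' R" "Q \<star> Q' = pr (of_int n)"
  shows "ipow Q k \<star> ipow Q' k = pr (of_int (n ^ k))"
proof (induction k)
  case (Suc k)
  note I = assms(1,2) ideal_ipow[OF assms(1), of k] ideal_ipow[OF assms(2), of k]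
  have "ipow Q (Suc k) \<star> ipow Q' (Suc k) = Q \<star> (ipow Q k \<star> (Q' \<star> ipow Q' k))"
    using R.ideal_prod_assoc[OF I(1,3) R.ideal_prod_is_ideal[OF I(2,4)]] by simp
  also have "\<dots> = Q \<star> (Q' \<star> (ipow Q k \<star> ipow Q' k))"
    by (simp only: ip_left_commute[OF I(3,2,4)])
  also have "\<dots> = (Q \<star> Q') \<star> (ipow Q k \<star> ipow Q' k)"
    by (rule R.ideal_prod_assoc[symmetric, OF I(1,2) R.ideal_prod_is_ideal[OF I(3,4)]])
  also have "\<dots> = pr (of_int (n ^ Suc k))"
    unfolding assms(3) Suc pr_ip_pr[OF of_int_in_carrier(1) of_int_in_carrier(1)]
    by (simp only: of_int_mult power_Suc)
  finally show ?case .
qed (simp add: carrier_ip ideal_carrier pr_1)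

text \<open>The conjugate of I is contained in J. The inclusion alone is preserved by products and
  suffices for norm estimates, so equality need not be tracked.\<close>

definition conj_sub :: "real set \<Rightarrow> real set \<Rightarrow> bool" where
  "conj_sub I J \<longleftrightarrow> (\<forall>a b. el a b \<in> I \<longrightarrow> el (a + b) (- b) \<in> J)"

lemma conj_sub_ip:
  assumes "ideal I R" "ideal J R" "conj_sub I I'" "conj_sub J J'"
  shows "conj_sub (I \<star> J) (I' \<star> J')"
proof -
  have "\<forall>a b. x = el a b \<longrightarrow> el (a + b) (- b) \<in> I' \<star> J'" if "x \<in> I \<star> J" for x
    using that
  proof (induction rule: ip_induct)
    case (prod i j)
    obtain p q where i: "i = el p q"
      using prod(1) ideal_D(1)[OF assms(1)] carrier_cases by blast
    obtain r s where j: "j = el r s"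
      using prod(2) ideal_D(1)[OF assms(2)] carrier_cases by blast
    have "el (p + q) (- q) * el (r + s) (- s) \<in> I' \<star> J'"
      using assms(3,4) prod by (intro ip_prod) (auto simp: conj_sub_def i j)
    then show ?case
      by (auto simp: i j el_mult el_eq_iff algebra_simps)
  next
    case (sum s t)
    have "I \<star> J \<subseteq> carrier R"
      using assms(1,2) by (rule R.ideal_prod_in_carrier)
    then have "s \<in> carrier R" "t \<in> carrier R"
      using sum.hyps by blast+
    then obtain a b a' b' where st: "s = el a b" "t = el a' b'"
      by (elim carrier_cases) blast
    then have "el (a + b) (- b) \<in> I' \<star> J'" "el (a' + b') (- b') \<in> I' \<star> J'"
      using sum.IH by blast+
    then have "el (a + b) (- b) \<oplus>\<^bsub>R\<^esub> el (a' + b') (- b') \<in> I' \<star> J'"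
      by (rule ideal_prod.sum)
    then show ?case
      by (auto simp: st el_add el_eq_iff algebra_simps)
  qed
  then show ?thesis
    by (auto simp: conj_sub_def)
qed

lemma conj_sub_ipow:
  assumes "ideal I R" "conj_sub I J"
  shows "conj_sub (ipow I k) (ipow J k)"
proof (induction k)
  case (Suc k)
  then show ?case
    using conj_sub_ip[OF assms(1) ideal_ipow[OF assms(1)] assms(2)] by simp
qed (simp add: conj_sub_def)

lemma equivalent_ip:
  assumes "ideal I R" "ideal J R" "ideal Q R" "equivalent I J"
  shows "equivalent (Q \<star> I) (Q \<star> J)"
proof -
  obtain a b where ab: "a \<in> carrier R - {0}" "b \<in> carrier R - {0}" "pr a \<star> I = pr b \<star> J"
    using assms(4) unfolding equivalent_def by blast
  then have "pr a \<star> (Q \<star> I) = pr b \<star> (Q \<star> J)"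
    using ip_left_commute[OF ideal_pr[of a] assms(3,1)] ip_left_commute[OF ideal_pr[of b] assms(3,2)] by auto
  then show ?thesis
    using ab unfolding equivalent_def by blast
qed

end

text \<open>For even c, that is D = 1 modulo 8, the polynomial X^2 - X - c has the roots 0 and 1
  modulo 2. Sending w to 0 or to 1 gives two ring homomorphisms onto the field of two elements;
  \<open>P\<close> and \<open>P'\<close> are their kernels.\<close>

locale quad_order_split_2 = quad_order +
  assumes even_c: "even c"
begin

text \<open>The two prime ideals above 2.\<close>

definition P :: "real set" where
  "P = {el a b | a b. even a}"

definition P' :: "real set" where
  "P' = {el a b | a b. even (a + b)}"

lemma el_in_P_iff: "el a b \<in> P \<longleftrightarrow> even a" and el_in_P'_iff: "el a b \<in> P' \<longleftrightarrow> even (a + b)"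
  by (auto simp: P_def P'_def el_eq_iff)

lemma ideal_P: "ideal P R"
proof (rule ideal_I)
  show "P \<subseteq> carrier R"
    by (auto simp: P_def)
  show "0 \<in> P"
    using el_in_P_iff[of 0 0] by (simp add: el_def)
  fix x y assume y: "y \<in> P"
  show "x + y \<in> P" if "x \<in> P"
    using that y by (auto simp: P_def el_add el_eq_iff)
  show "x * y \<in> P" if "x \<in> carrier R"
    using that y even_c by (auto simp: P_def carrier_R el_mult el_eq_iff)
qed

lemma ideal_P': "ideal P' R"
proof (rule ideal_I)
  show "P' \<subseteq> carrier R"
    by (auto simp: P'_def)
  show "0 \<in> P'"
    using el_in_P'_iff[of 0 0] by (simp add: el_def)
  fix x y assume y: "y \<in> P'"
  show "x + y \<in> P'" if "x \<in> P'"
    using that y by (auto simp: P'_def el_add el_eq_iff)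
  show "x * y \<in> P'" if "x \<in> carrier R"
    using that y even_c by (auto simp: P'_def carrier_R el_mult el_eq_iff)
qed

lemma P_nonzero: "P \<in> nonzero_ideals R" and P'_nonzero: "P' \<in> nonzero_ideals R"
proof -
  have "el 2 0 \<in> P" "el 2 0 \<in> P'" "el 2 0 \<noteq> 0"
    by (simp_all add: el_in_P_iff el_in_P'_iff el_0_iff)
  then show "P \<in> nonzero_ideals R" "P' \<in> nonzero_ideals R"
    using ideal_P ideal_P' by (auto simp: nonzero_ideals_def)
qed

lemma P_ip_P': "P \<star> P' = pr (of_int 2)"
proof (intro equalityI subsetI)
  have pr2: "ideal (pr (of_int 2)) R"
    by (rule ideal_pr[OF of_int_in_carrier(1)])
  fix x assume "x \<in> P \<star> P'"
  then show "x \<in> pr (of_int 2)"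
  proof (induction rule: ip_induct)
    case (prod i j)
    then obtain a b a' b' where ij: "i = el a b" "j = el a' b'" and e: "even a" "even (a' + b')"
      by (auto simp: P_def P'_def)
    have "a * b' + b * a' + b * b' = a * b' + b * (a' + b')"
      by (simp add: algebra_simps)
    then have "even (a * b' + b * a' + b * b')"
      using e by simp
    then show ?case
      using e even_c unfolding ij el_mult el_in_pr_of_int_iff by simp
  next
    case (sum s t)
    then show ?case
      using ideal_D(3)[OF pr2] by blast
  qed
next
  have I: "ideal (P \<star> P') R"
    using ideal_P ideal_P' by (rule R.ideal_prod_is_ideal)
  \<comment> \<open>2 = 2 (1 - w) + w 2, where 2 lies in both ideals, w in \<open>P\<close> and 1 -
    w in \<open>P'\<close>.\<close>
  have "el 2 0 * el 1 (- 1) \<in> P \<star> P'" "el 0 1 * el 2 0 \<in> P \<star> P'"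
    by (intro ip_prod; simp add: el_in_P_iff el_in_P'_iff)+
  then have "el 2 0 * el 1 (- 1) + el 0 1 * el 2 0 \<in> P \<star> P'"
    by (rule ideal_D(3)[OF I])
  then have two: "of_int 2 \<in> P \<star> P'"
    by (simp only: el_mult el_add of_int_el) simp
  fix x assume "x \<in> pr (of_int 2)"
  then show "x \<in> P \<star> P'"
    using ideal_D(4)[OF I _ two] by (auto simp: pr_def mult.commute)
qed

text \<open>With the next lemma: w^k witnesses that the k-th power of \<open>P\<close> is not
  contained in \<open>P'\<close>. No theory of prime ideals is needed for this.\<close>

lemma w_power_in: "w ^ k \<in> ipow P k"
proof (induction k)
  case (Suc k)
  have "w = el 0 1"
    by (simp add: el_def)
  then have "w \<in> P"
    by (simp add: el_in_P_iff)
  then show ?case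
    using Suc by (simp add: ip_prod)
qed simp

lemma w_power_not_in: "w ^ k \<notin> P'"
proof -
  have "\<exists>a b. w ^ k = el a b \<and> odd (a + b)"
  proof (induction k)
    case 0
    then show ?case
      by (intro exI[of _ 1] exI[of _ 0]) (simp add: el_def)
  next
    case (Suc k)
    then obtain a b where ab: "w ^ k = el a b" "odd (a + b)"
      by blast
    have "w ^ Suc k = el 0 1 * el a b"
      by (simp add: ab el_def)
    then have "w ^ Suc k = el (c * b) (a + b)"
      by (simp add: el_mult)
    moreover have "odd (c * b + (a + b))"
      using ab(2) even_c by simp
    ultimately show ?case
      by blast
  qed
  then show ?thesis
    using el_in_P'_iff by auto
qed

text \<open>Write 2^k = \<gamma> \<delta> with \<delta> in the k-th power of \<open>P'\<close>. The
  norms of \<gamma> and \<delta> are both divisible by 2^k and have product 4^k, so that of \<gamma>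
  is 2^k up to sign. No norm of ideals is involved.\<close>

lemma principal_ipow_P:
  assumes "ipow P k = pr \<gamma>" "\<gamma> \<in> carrier R" "k > 0"
  obtains x y s :: int where "odd x" "odd y" "s = 1 \<or> s = - 1" "x ^ 2 - D * y ^ 2 = s * 2 ^ (k + 2)"
proof -
  obtain u v where uv: "\<gamma> = el u v"
    using assms(2) carrier_cases by blast
  have "\<gamma> \<in> ipow P k"
    unfolding assms(1) by (rule pr_self)
  have conj_P: "conj_sub P P'" "conj_sub P' P"
    by (auto simp: conj_sub_def el_in_P_iff el_in_P'_iff)
  have PP: "ipow P k \<star> ipow P' k = pr (of_int (2 ^ k))"
    using ideal_P ideal_P' P_ip_P' by (rule ipow_ip_ipow)
  \<comment> \<open>An element of one of the two k-th powers times its conjugate lies in their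
    product, which is generated by 2^k.\<close>
  have nrm_dvd: "2 ^ k dvd nrm a b" if "el a b \<in> ipow P k \<or> el a b \<in> ipow P' k" for a b
  proof -
    have "el a b * el (a + b) (- b) \<in> ipow P k \<star> ipow P' k"
    proof (cases "el a b \<in> ipow P k")
      case True
      then show ?thesis
        using conj_sub_ipow[OF ideal_P conj_P(1), of k] by (auto intro: ip_prod simp: conj_sub_def)
    next
      case False
      then have "el (a + b) (- b) * el a b \<in> ipow P k \<star> ipow P' k"
        using that conj_sub_ipow[OF ideal_P' conj_P(2), of k] by (auto intro: ip_prod simp: conj_sub_def)
      then show ?thesis
        by (simp add: mult.commute)
    qed
    then have "of_int (nrm a b) \<in> pr (of_int (2 ^ k))"
      unfolding PP el_conj .
    then show ?thesis
      using el_in_pr_of_int_iff[of "nrm a b" 0 "2 ^ k"] by (simp only: of_int_el simp_thms)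
  qed
  have "of_int (2 ^ k) \<in> pr \<gamma> \<star> ipow P' k"
    unfolding PP assms(1)[symmetric] by (rule pr_self)
  then have "of_int (2 ^ k) \<in> (*) \<gamma> ` ipow P' k"
    by (simp only: pr_ip[OF assms(2) ideal_ipow[OF ideal_P']])
  then obtain \<delta> where \<delta>: "\<delta> \<in> ipow P' k" "of_int (2 ^ k) = \<gamma> * \<delta>"
    by blast
  then obtain a b where ab: "\<delta> = el a b"
    using ideal_D(1)[OF ideal_ipow[OF ideal_P']] carrier_cases by blast
  have "el (2 ^ k) 0 = el u v * el a b"
    using \<delta>(2) by (simp only: uv ab of_int_el)
  then have "nrm u v * nrm a b = nrm (2 ^ k) 0"
    unfolding el_mult el_eq_iff by (metis nrm_mult)
  then have prod: "nrm u v * nrm a b = 2 ^ k * 2 ^ k"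
    by (simp add: nrm_def)
  obtain s s' where s: "nrm u v = 2 ^ k * s" and s': "nrm a b = 2 ^ k * s'"
    using nrm_dvd[of u v] nrm_dvd[of a b] \<open>\<gamma> \<in> ipow P k\<close> \<delta>(1) by (auto simp: uv ab elim!: dvdE)
  have "(2 ^ k * 2 ^ k) * (s * s') = (2 ^ k * 2 ^ k) * (1 :: int)"
    using prod unfolding s s' by (simp add: mult_ac)
  then have "s * s' = 1"
    by simp
  then have s1: "s = 1 \<or> s = - 1"
    by (auto simp: zmult_eq_1_iff)
  have "ipow P k \<subseteq> P"
    using assms(3) R.ideal_prod_inter[OF ideal_P ideal_ipow[OF ideal_P]] by (cases k) auto
  then have "even u"
    using \<open>\<gamma> \<in> ipow P k\<close> by (auto simp: uv el_in_P_iff)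
  \<comment> \<open>Otherwise \<gamma>, and with it the whole k-th power of \<open>P\<close>, would
    lie in \<open>P'\<close>.\<close>
  moreover have "odd (u + v)"
  proof
    assume "even (u + v)"
    then have "\<gamma> \<in> P'"
      by (simp add: uv el_in_P'_iff)
    moreover have "w ^ k \<in> pr \<gamma>"
      using w_power_in assms(1) by blast
    ultimately have "w ^ k \<in> P'"
      using ideal_D(4)[OF ideal_P'] by (auto simp: pr_def mult.commute)
    then show False
      using w_power_not_in by blast
  qed
  ultimately have "odd v"
    by simp
  \<comment> \<open>2 \<gamma> = (2u + v) + v \<surd>D, so x = 2u + v and y = v; both are odd
    because v is.\<close>
  moreover have "(2 * u + v) ^ 2 - D * v ^ 2 = 4 * nrm u v"
    by (simp add: D_eq nrm_def power2_eq_square algebra_simps)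
  then have "(2 * u + v) ^ 2 - D * v ^ 2 = s * 2 ^ (k + 2)"
    by (simp add: s)
  ultimately show ?thesis
    using s1 that[of "2 * u + v" v s] by simp
qed

text \<open>Multiplication by \<open>P\<close> is injective on classes because multiplying further
  by \<open>P'\<close> amounts to multiplying by 2, which does not change the class. If its k-th
  iterate fixes a class, the k-th power of \<open>P\<close> is principal, and the assumption on the
  norm equation applies.\<close>

theorem dvd_class_number:
  assumes "\<And>x y s k. odd x \<Longrightarrow> odd y \<Longrightarrow> s = 1 \<or> s = - 1 \<Longrightarrow> x ^ 2 - D * y ^ 2 = s * 2 ^ (k + 2) \<Longrightarrow> d dvd k"
  shows "d dvd class_number (quad_field (sqrt (of_int D)))"
proof -
  define r where "r = ideal_class_rel R"
  define Y where "Y = nonzero_ideals R"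
  have eq: "equiv Y r"
    unfolding Y_def r_def by (rule equiv_ideal_class_rel[OF domain_R])
  have r: "(I, J) \<in> r \<longleftrightarrow> I \<in> Y \<and> J \<in> Y \<and> equivalent I J" for I J
    by (simp add: r_def Y_def class_rel_iff)
  have Y: "ideal I R" if "I \<in> Y" for I
    using that nonzero_idealsD(1) by (simp add: Y_def)
  have PX: "P \<star> I \<in> Y" if "I \<in> Y" for I
    using that P_nonzero ip_nonzero by (simp add: Y_def)
  have r_P: "(P \<star> I, P \<star> J) \<in> r" if "(I, J) \<in> r" for I J
    using that Y PX equivalent_ip[OF _ _ ideal_P] by (simp add: r)
  have r_P_inv: "(I, J) \<in> r" if "I \<in> Y" "J \<in> Y" "(P \<star> I, P \<star> J) \<in> r" for I J
  proof -
    have "(P' \<star> (P \<star> I), P' \<star> (P \<star> J)) \<in> r"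
      using that(3) Y ip_nonzero[OF P'_nonzero] equivalent_ip[OF _ _ ideal_P'] by (simp add: r Y_def)
    moreover have "P' \<star> (P \<star> L) = pr (of_int 2) \<star> L" if "L \<in> Y" for L
      using ip_left_commute[OF ideal_P' ideal_P Y[OF that]] R.ideal_prod_assoc[OF ideal_P ideal_P' Y[OF that]] P_ip_P'
      by simp
    ultimately have "equivalent (pr (of_int 2) \<star> I) (pr (of_int 2) \<star> J)"
      using that(1,2) by (simp add: r)
    then obtain a b where ab: "a \<in> carrier R - {0}" "b \<in> carrier R - {0}"
      "pr a \<star> (pr (of_int 2) \<star> I) = pr b \<star> (pr (of_int 2) \<star> J)"
      unfolding equivalent_def by blast
    have *: "pr e \<star> (pr (of_int 2) \<star> L) = pr (e * of_int 2) \<star> L" if "e \<in> carrier R" "L \<in> Y" for e L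
      using R.ideal_prod_assoc[OF ideal_pr[OF that(1)] ideal_pr[OF of_int_in_carrier(1)[of 2]] Y[OF that(2)]]
        pr_ip_pr[OF that(1) of_int_in_carrier(1)[of 2]] by (simp only:)
    have "pr (a * of_int 2) \<star> I = pr (b * of_int 2) \<star> J"
      using ab that(1,2) by (simp only: *[symmetric] Diff_iff)
    moreover have "a * of_int 2 \<in> carrier R - {0}" "b * of_int 2 \<in> carrier R - {0}"
      using ab(1,2) carrier_closed(2)[OF _ of_int_in_carrier(1)[of 2]] by auto
    ultimately show ?thesis
      using that(1,2) unfolding r equivalent_def by blast
  qed
  define F where "F = (\<lambda>C. r `` ((\<star>) P ` C))"
  have F: "F (r `` {I}) = r `` {P \<star> I}" if "I \<in> Y" for I
  proof -
    have "r `` {P \<star> J} = r `` {P \<star> I}" if "(I, J) \<in> r" for J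
      using equiv_class_eq[OF eq r_P[OF that]] by simp
    moreover have "(I, I) \<in> r"
      using eq that by (auto simp: equiv_def refl_on_def)
    ultimately show ?thesis
      unfolding F_def by blast
  qed
  have F_iter: "(F ^^ k) (r `` {I}) = r `` {((\<star>) P ^^ k) I} \<and> ((\<star>) P ^^ k) I \<in> Y" if "I \<in> Y" for I k
    by (induction k) (use that F PX in auto)
  have "d dvd card (Y // r)"
  proof (rule dvd_card_if_dvd_periods)
    show "finite (Y // r)"
      using finite_ideal_classes by (simp add: ideal_classes_def Y_def r_def)
    show "F C \<in> Y // r" if "C \<in> Y // r" for C
      using that by (elim quotientE) (auto simp: F PX intro: quotientI)
    show "inj_on F (Y // r)"
    proof (rule inj_onI)
      fix C C' assume "C \<in> Y // r" "C' \<in> Y // r" and FC: "F C = F C'"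
      then obtain I J where IJ: "I \<in> Y" "J \<in> Y" "C = r `` {I}" "C' = r `` {J}"
        by (auto elim!: quotientE)
      then have "r `` {P \<star> I} = r `` {P \<star> J}"
        using FC F by simp
      then have "(P \<star> I, P \<star> J) \<in> r"
        using eq_equiv_class[OF _ eq PX[OF IJ(2)]] by blast
      then show "C = C'"
        using r_P_inv[OF IJ(1,2)] equiv_class_eq[OF eq] IJ(3,4) by blast
    qed
    fix C k assume "C \<in> Y // r" and Ck: "(F ^^ k) C = C"
    then obtain I where I: "I \<in> Y" "C = r `` {I}"
      by (auto elim!: quotientE)
    show "d dvd k"
    proof (cases "k = 0")
      case False
      have "r `` {((\<star>) P ^^ k) I} = r `` {I}"
        using Ck F_iter[OF I(1), of k] by (simp add: I(2))
      then have "(ipow P k \<star> I, I) \<in> r"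
        using eq_equiv_class[OF _ eq I(1)] funpow_ip[OF ideal_P Y[OF I(1)]] by metis
      then have "equivalent (ipow P k \<star> I) I"
        by (simp add: r)
      then obtain \<gamma> where "\<gamma> \<in> carrier R" "ipow P k = pr \<gamma>"
        using principal_if_fixes_class[OF _ ipow_nonzero[OF P_nonzero]] I(1) unfolding Y_def by blast
      then show ?thesis
        using principal_ipow_P[of k \<gamma>] False assms by (metis neq0_conv)
    qed simp
  qed
  then show ?thesis
    by (simp add: class_number_def ideal_classes_def Y_def r_def)
qed

end

subsection \<open>The fields of the theorem\<close>

text \<open>4 27^m - 1 is 3 modulo 8 and odd squares are 1, so M' is 3 and 3 M' is 1 modulo 8. As m
  > 0, 3 does not divide 4 27^m - 1, which keeps 3 M' squarefree.\<close>

lemma split_2_field: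
  fixes m :: nat
  assumes "m > 0"
  obtains M' g c :: int where "M' * g ^ 2 = 4 * 27 ^ m - 1" "quad_order_split_2 (3 * M') c"
    "rat_adjoin_sqrt (3 * (4 * 3 ^ (3 * m) - 1)) = quad_field (sqrt (of_int (3 * M')))"
proof -
  define M :: int where "M = 4 * 27 ^ m - 1"
  define M' where "M' = squarefree_part M"
  define g where "g = square_part M"
  have M: "M' * g ^ 2 = M"
    unfolding M'_def g_def by (rule squarefree_decompose[symmetric])
  have "(27::int) ^ m \<ge> 1"
    by simp
  then have M_pos: "M > 0"
    unfolding M_def by linarith
  have g0: "g \<noteq> 0"
    using M M_pos by auto
  have M'_pos: "M' > 0"
    using M M_pos g0 by (metis zero_less_mult_pos2 zero_less_power2)
  have sqf: "squarefree M'"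
    using M_pos by (simp add: M'_def)
  have "[4 * 27 ^ m - 1 = (0 - 1 :: int)] (mod 3)"
    using assms by (intro cong_diff cong_refl) (cases m; simp add: cong_0_iff)
  then have M3: "\<not> 3 dvd M"
    unfolding M_def by (auto simp: Cong.cong_def dvd_eq_mod_eq_0)
  then have "\<not> 3 dvd M'"
    unfolding M[symmetric] by auto
  then have "coprime 3 M'"
    by (intro prime_imp_coprime) auto
  then have sqf3: "squarefree (3 * M')"
    using sqf by (intro squarefree_mult_coprime) (auto intro: squarefree_prime)
  have "odd ((27::int) ^ m)"
    by simp
  then obtain w where "(27::int) ^ m = 2 * w + 1"
    by (elim oddE)
  then have M8: "M = 8 * w + 3"
    by (simp add: M_def)
  then have "odd g"
    using M by (metis even_add even_mult_iff even_numeral even_power odd_numeral pos2 mult_2 numeral_Bit0)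
  then obtain h where h: "g = 2 * h + 1"
    by (elim oddE)
  have "even (h * (h + 1))"
    by simp
  then obtain l where l: "h * (h + 1) = 2 * l"
    by (elim evenE)
  have "g ^ 2 = 4 * (h * (h + 1)) + 1"
    by (simp add: h power2_eq_square algebra_simps)
  then have g8: "g ^ 2 = 8 * l + 1"
    by (simp add: l)
  have "8 * (M' * l) + M' = 8 * w + 3"
    using M M8 g8 by (simp add: algebra_simps)
  then have D8: "3 * M' = 4 * (2 * (1 + 3 * (w - M' * l))) + 1"
    by (simp add: algebra_simps)
  have split: "quad_order_split_2 (3 * M') (2 * (1 + 3 * (w - M' * l)))"
    using D8 sqf3 M'_pos by unfold_locales auto
  define \<delta> where "\<delta> = sqrt (of_int (3 * M'))"
  have "(3::real) ^ (3 * m) = 27 ^ m"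
    by (simp add: power_mult)
  then have "3 * (4 * 3 ^ (3 * m) - 1) = real_of_int (3 * M)"
    by (simp add: M_def)
  also have "\<dots> = of_int (3 * M') * of_int g ^ 2"
    by (simp add: M[symmetric])
  finally have "sqrt (3 * (4 * 3 ^ (3 * m) - 1)) = of_int \<bar>g\<bar> * \<delta>"
    by (simp add: \<delta>_def real_sqrt_mult)
  moreover have "\<delta> \<notin> \<rat>" "\<delta> ^ 2 \<in> \<rat>"
    using sqrt_squarefree_irrational[OF sqf3] M'_pos by (simp_all add: \<delta>_def)
  ultimately have "rat_adjoin_sqrt (3 * (4 * 3 ^ (3 * m) - 1)) = quad_field \<delta>"
    unfolding rat_adjoin_sqrt_def using g0 by (simp only:) (rule generate_field_eq_quad_field; simp)
  then show ?thesis
    using that M split unfolding M_def \<delta>_def by blast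
qed

text \<open>Squaring \<surd>D1 = a + b \<surd>D2 gives a b = 0, and b \<noteq> 0 since \<surd>D1 is
  irrational. So D1 = b^2 D2, and squarefreeness on both sides leaves b = 1 or b = -1.\<close>

lemma quad_field_sqrt_eqD:
  assumes D: "squarefree D1" "D1 > 1" "squarefree D2" "D2 > (1::int)"
    and eq: "quad_field (sqrt (of_int D1)) = quad_field (sqrt (of_int D2))"
  shows "D1 = D2"
proof -
  have irr: "sqrt (of_int D1) \<notin> \<rat>" "sqrt (of_int D2) \<notin> \<rat>"
    using sqrt_squarefree_irrational D by auto
  have "sqrt (of_int D1) \<in> quad_field (sqrt (of_int D2))"
    unfolding eq[symmetric] using quad_fieldI[of 0 1 "sqrt (of_int D1)"] by simp
  then obtain a b where ab: "a \<in> \<rat>" "b \<in> \<rat>" "sqrt (of_int D1) = a + b * sqrt (of_int D2)"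
    by (rule quad_fieldE)
  have "of_int D1 + 0 * sqrt (of_int D2) = sqrt (of_int D1) ^ 2"
    using D by simp
  also have "\<dots> = a ^ 2 + b ^ 2 * sqrt (of_int D2) ^ 2 + 2 * a * b * sqrt (of_int D2)"
    unfolding ab(3) by (simp add: power2_eq_square algebra_simps)
  also have "sqrt (of_int D2) ^ 2 = of_int D2"
    using D by simp
  finally have "of_int D1 + 0 * sqrt (of_int D2) = a ^ 2 + b ^ 2 * of_int D2 + 2 * a * b * sqrt (of_int D2)" .
  then have sq: "of_int D1 = a ^ 2 + b ^ 2 * of_int D2 \<and> 0 = 2 * a * b"
    by (rule quad_field_eqD[OF irr(2), rotated -1]) (use ab(1,2) in auto)
  moreover have "b \<noteq> 0"
    using irr(1) ab by auto
  ultimately have "a = 0"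
    by simp
  then have D1: "of_int D1 = b ^ 2 * of_int D2"
    using sq by simp
  obtain s t where st: "b = of_int s / of_int t" "t > 0" "coprime s t"
    using ab(2) by (metis Rats_cases')
  have "real_of_int (D1 * t ^ 2) = real_of_int (D2 * s ^ 2)"
    using D1 st(2) by (simp add: st(1) power_divide field_simps)
  then have eq: "D1 * t ^ 2 = D2 * s ^ 2"
    by (subst (asm) of_int_eq_iff)
  have cop: "coprime (t ^ 2) (s ^ 2)"
    using st(3) by (simp add: coprime_commute)
  have "t ^ 2 dvd D2 * s ^ 2"
    unfolding eq[symmetric] by simp
  then have "t ^ 2 dvd D2"
    using cop by (simp add: coprime_dvd_mult_left_iff)
  then have t: "is_unit t"
    by (rule squarefreeD[OF D(3)])
  have "s ^ 2 dvd D1 * t ^ 2"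
    unfolding eq by simp
  then have "s ^ 2 dvd D1"
    using cop by (simp add: coprime_dvd_mult_left_iff coprime_commute)
  then have s: "is_unit s"
    by (rule squarefreeD[OF D(1)])
  have "t ^ 2 = 1" "s ^ 2 = 1"
    using s t by (auto simp: abs_if split: if_splits)
  then show ?thesis
    using eq by simp
qed

lemma ex_new_rat_adjoin_sqrt:
  assumes "finite B" "\<And>m. m \<in> B \<Longrightarrow> m > 0"
  obtains n :: nat where "n > 0" "\<And>m. m \<in> B \<Longrightarrow>
    rat_adjoin_sqrt (3 * (4 * 3 ^ (3 * n) - 1)) \<noteq> rat_adjoin_sqrt (3 * (4 * 3 ^ (3 * m) - 1))"
proof -
  define N :: nat where "N = (\<Prod>m\<in>B. 4 * 27 ^ m - 1)"
  have int_M: "int (4 * 27 ^ m - 1) = 4 * 27 ^ m - 1" for m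
    by (simp add: of_nat_diff)
  have cop3: "coprime 3 (4 * 27 ^ m - 1 :: nat)" if "m \<in> B" for m
  proof -
    obtain j where j: "m = Suc j"
      using assms(2)[OF \<open>m \<in> B\<close>] by (cases m) auto
    define t :: nat where "t = 27 ^ j"
    have "t \<ge> 1"
      by (simp add: t_def)
    then have "(4 * 27 ^ m - 1 :: nat) = 3 * (36 * t - 1) + 2"
      by (simp add: j t_def[symmetric])
    moreover have "\<not> 3 dvd 3 * i + 2" for i :: nat
      by presburger
    ultimately have "\<not> 3 dvd (4 * 27 ^ m - 1 :: nat)"
      by metis
    then show ?thesis
      by (intro prime_imp_coprime) auto
  qed
  then have "coprime 3 N"
    unfolding N_def by (intro prod_coprime_right)
  then have "coprime (27 :: nat) N"
    using coprime_power_left_iff[of 3 3 N] by simp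
  have "(4 * 27 ^ m - 1 :: nat) > 0" for m
  proof -
    have "(27::nat) ^ m \<ge> 1"
      by simp
    then show ?thesis
      by linarith
  qed
  then have "N > 0"
    unfolding N_def by (intro prod_pos) blast
  define n where "n = totient N"
  have n: "n > 0"
    using \<open>N > 0\<close> by (simp add: n_def)
  have "[27 ^ n = 1] (mod N)"
    unfolding n_def using \<open>coprime 27 N\<close> by (rule euler_theorem)
  then have "[int (27 ^ n) = int 1] (mod int N)"
    by (subst cong_int_iff)
  then have N27: "int N dvd 27 ^ n - 1"
    by (simp add: cong_iff_dvd_diff)
  show ?thesis
  proof (rule that[OF n], rule notI)
    fix m assume m: "m \<in> B"
      and K: "rat_adjoin_sqrt (3 * (4 * 3 ^ (3 * n) - 1)) = rat_adjoin_sqrt (3 * (4 * 3 ^ (3 * m) - 1))"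
    obtain M1 g1 c1 where 1: "M1 * g1 ^ 2 = 4 * 27 ^ n - 1" "quad_order_split_2 (3 * M1) c1"
      "rat_adjoin_sqrt (3 * (4 * 3 ^ (3 * n) - 1)) = quad_field (sqrt (of_int (3 * M1)))"
      using n by (rule split_2_field)
    obtain M2 g2 c2 where 2: "M2 * g2 ^ 2 = 4 * 27 ^ m - 1" "quad_order_split_2 (3 * M2) c2"
      "rat_adjoin_sqrt (3 * (4 * 3 ^ (3 * m) - 1)) = quad_field (sqrt (of_int (3 * M2)))"
      using assms(2)[OF m] by (rule split_2_field)
    interpret D1: quad_order_split_2 "3 * M1" c1 by fact
    interpret D2: quad_order_split_2 "3 * M2" c2 by fact
    have "3 * M1 = 3 * M2"
      using D1.squarefree_D D1.D_gt_1 D2.squarefree_D D2.D_gt_1 K 1(3) 2(3)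
      by (intro quad_field_sqrt_eqD) auto
    then have "M1 = M2"
      by simp
    have "M1 dvd 4 * 27 ^ n - 1" "M1 dvd 4 * 27 ^ m - 1"
      unfolding 1(1)[symmetric] \<open>M1 = M2\<close> 2(1)[symmetric] by simp_all
    have "(4 * 27 ^ m - 1 :: nat) dvd N"
      unfolding N_def using assms(1) m by (intro dvd_prodI)
    then have "(4 * 27 ^ m - 1 :: int) dvd int N"
      unfolding int_M[symmetric] by (subst int_dvd_int_iff)
    \<comment> \<open>Modulo M1 the power 27^n is 1, so 4 27^n - 1 is congruent to 3 and M1 divides
      3. But M1 also divides 4 27^m - 1, which is prime to 3.\<close>
    then have "M1 dvd 27 ^ n - 1"
      using \<open>M1 dvd 4 * 27 ^ m - 1\<close> N27 dvd_trans by blast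
    then have "M1 dvd 4 * (27 ^ n - 1)"
      by (rule dvd_mult)
    with \<open>M1 dvd 4 * 27 ^ n - 1\<close> have "M1 dvd (4 * 27 ^ n - 1) - 4 * (27 ^ n - 1)"
      by (rule dvd_diff)
    then have "M1 dvd 3"
      by simp
    moreover have "coprime (int 3) (int (4 * 27 ^ m - 1))"
      using cop3[OF m] by (subst coprime_int_iff)
    then have "coprime 3 (4 * 27 ^ m - 1 :: int)"
      unfolding int_M by simp
    ultimately have "is_unit M1"
      using \<open>M1 dvd 4 * 27 ^ m - 1\<close> coprime_common_divisor by blast
    then have "M1 = 1"
      using D1.D_gt_1 by auto
    then have sq: "g1 ^ 2 = 4 * 27 ^ n - 1"
      using 1(1) by simp
    have "g1 ^ 2 mod 4 = 0 \<or> g1 ^ 2 mod 4 = 1"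
    proof (cases "even g1")
      case True
      then show ?thesis
        by (auto elim!: evenE simp: power_mult_distrib)
    next
      case False
      then obtain h where "g1 = 2 * h + 1"
        by (elim oddE)
      then have "g1 ^ 2 = 4 * (h * h + h) + 1"
        by (simp add: power2_eq_square algebra_simps)
      then show ?thesis
        by presburger
    qed
    moreover have "(4 * 27 ^ n - 1 :: int) mod 4 = 3"
      by (simp add: mod_diff_left_eq[symmetric, of "4 * _"])
    ultimately show False
      unfolding sq by simp
  qed
qed

theorem theorem3p1:
  shows "(\<forall>n::nat. n > 0 \<longrightarrow> [n = 0] (mod 3) \<longrightarrow>
            (let K = rat_adjoin_sqrt (3 * (4 * 3 ^ n - 1)) in
               real_quadratic_field K \<and> finite (ideal_classes K) \<and> 3 dvd class_number K))
       \<and> infinite {K. real_quadratic_field K \<and> finite (ideal_classes K) \<and> 3 dvd class_number K \<and>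
            (\<exists>n::nat. n > 0 \<and> [n = 0] (mod 3) \<and> K = rat_adjoin_sqrt (3 * (4 * 3 ^ n - 1)))}"
    (is "?A \<and> infinite ?S")
proof
  define K where "K = (\<lambda>m::nat. rat_adjoin_sqrt (3 * (4 * 3 ^ (3 * m) - 1)))"
  have main: "real_quadratic_field (K m) \<and> finite (ideal_classes (K m)) \<and> 3 dvd class_number (K m)"
    if m: "m > 0" for m
  proof -
    obtain M' g c where M': "M' * g ^ 2 = 4 * 27 ^ m - 1" "quad_order_split_2 (3 * M') c"
      "rat_adjoin_sqrt (3 * (4 * 3 ^ (3 * m) - 1)) = quad_field (sqrt (of_int (3 * M')))"
      using m by (rule split_2_field)
    interpret quad_order_split_2 "3 * M'" c by fact
    have "real_quadratic_field (quad_field (sqrt (of_int (3 * M'))))"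
      using sqrt_D by (intro real_quadratic_quad_field) auto
    moreover have "3 dvd class_number (quad_field (sqrt (of_int (3 * M'))))"
      by (rule dvd_class_number) (rule three_dvd_exponent[OF M'(1) m])
    ultimately show ?thesis
      unfolding K_def M'(3) using finite_ideal_classes by blast
  qed
  show ?A
  proof (intro allI impI)
    fix n :: nat assume "n > 0" "[n = 0] (mod 3)"
    then obtain m where "n = 3 * m" "m > 0"
      by (auto simp: cong_0_iff elim!: dvdE)
    then show "let K = rat_adjoin_sqrt (3 * (4 * 3 ^ n - 1)) in
        real_quadratic_field K \<and> finite (ideal_classes K) \<and> 3 dvd class_number K"
      using main[of m] by (simp add: K_def Let_def)
  qed
  show "infinite ?S"
  proof
    assume "finite ?S"
    have K_in: "K m \<in> ?S" if "m > 0" for m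
      using main[OF that] that unfolding K_def
      by (auto simp: cong_0_iff intro!: exI[of _ "3 * m"])
    then have "K ` {0<..} \<subseteq> ?S"
      by auto
    then have "finite (K ` {0<..})"
      using \<open>finite ?S\<close> by (rule finite_subset)
    \<comment> \<open>If there were only finitely many fields, finitely many positive indices would
      represent all of them.\<close>
    then obtain B where B: "B \<subseteq> {0<..}" "finite B" "K ` {0<..} = K ` B"
      using finite_subset_image[of "K ` {0<..}" K "{0<..}"] by auto
    obtain n where n: "n > 0" "\<And>m. m \<in> B \<Longrightarrow> K n \<noteq> K m"
      using ex_new_rat_adjoin_sqrt[OF B(2)] B(1) unfolding K_def by auto
    then have "K n \<in> K ` B"
      using B(3) by auto
    then show False
      using n(2) by auto
  qed
qed

end
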